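(* Let $A$ be a finite Abelian group of order $n$. The path $P_n$ on $n$ vertices is $A$-antimagic if and only if $n\not\equiv 2\pmod 4$.
   Context: $P_n$ denotes the path with $n$ vertices (and $n-1$ edges). For a finite Abelian group $A$ and a tree $T$ with $|A|$ vertices, an $A$-antimagic labeling of $T$ is an injective map $f\colon E(T)\to A$ (the identity element $0$ is allowed as an edge label) such that the vertex sums $f^*(v)=\sum_{u\in N(v)}f(uv)$ (the sum of the labels of all edges incident with $v$) are pairwise distinct for $v\in V(T)$. The tree $T$ is $A$-antimagic if it admits an $A$-antimagic labeling. *)

theory Defs
  imports "HOL-Algebra.Algebra" "HOL-Number_Theory.Cong"
begin

text \<open>A finite simple graph is a pair of its vertex set and its set of two-element edges.\<close>

type_synonym 'v sgraph = "'v set \<times> 'v set set"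

definition neighbours :: "'v sgraph \<Rightarrow> 'v \<Rightarrow> 'v set" where
  "neighbours T v = {u \<in> fst T. u \<noteq> v \<and> {u, v} \<in> snd T}"

text \<open>The path with \<open>n\<close> vertices \<open>0, \<dots>, n - 1\<close> and edges \<open>{i, i + 1}\<close>.\<close>

definition path_graph :: "nat \<Rightarrow> nat sgraph" where
  "path_graph n = ({..<n}, {{i, Suc i} | i. Suc i < n})"

text \<open>Abelian groups in HOL-Algebra are written multiplicatively, so sums over
  neighbourhoods become \<^const>\<open>finprod\<close>.\<close>

definition vertex_sum :: "('a, 'm) monoid_scheme \<Rightarrow> 'v sgraph \<Rightarrow> ('v set \<Rightarrow> 'a) \<Rightarrow> 'v \<Rightarrow> 'a" where
  "vertex_sum A T f v = finprod A (\<lambda>u. f {u, v}) (neighbours T v)"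

text \<open>The labelling condition itself makes sense for every finite simple graph; it is meant for
  trees \<open>T\<close> with exactly as many vertices as \<open>A\<close> has elements. The identity of \<open>A\<close> is
  an admissible label.\<close>

definition antimagic_labeling ::
    "('a, 'm) monoid_scheme \<Rightarrow> 'v sgraph \<Rightarrow> ('v set \<Rightarrow> 'a) \<Rightarrow> bool" where
  "antimagic_labeling A T f \<longleftrightarrow>
     f \<in> snd T \<rightarrow> carrier A \<and> inj_on f (snd T) \<and> inj_on (vertex_sum A T f) (fst T)"

definition antimagic :: "('a, 'm) monoid_scheme \<Rightarrow> 'v sgraph \<Rightarrow> bool" where
  "antimagic A T \<longleftrightarrow> (\<exists>f. antimagic_labeling A T f)"

end

(*
  Work with representatives in a ring V, modulo subgroups: A = V / L. The necessity of the condition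
  is a parity argument for a subgroup of index 2. For sufficiency let K / L be the subgroup of elements
  of odd order.

  - K / L has a cyclic arrangement u with pairwise distinct adjacent sums: extend along cyclic
    quotients of odd order q, where 0, g, ..., (q - 1) g does the job.
  - If V / K is noncyclic, the non-identity elements of V / K are arranged in a cycle whose adjacent
    sums are again exactly the non-identity elements, and which contains r, s, t consecutively with
    2 s = 0, t = r + s (or satisfies a similar condition). Passing from V / M to V / N with M / N a
    Klein four-group, three disjoint cycles arise in a natural way, and exchanging edges at r, s, t
    merges them; the base cases are groups of order 4 and 8 and Z_2 x Z_8k. Omitting the label s and
    inserting u at the identity turns the cycle into a path labelling.
  - If V / K is cyclic of order divisible by 4, the path labelling is an interleaving of a sequence c
    with c + t, t being the involution; the model is 0, n/2, 1, n/2 + 1, ..., n - 1 in Z_n with n/4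
    omitted.
*)

theory Submission imports Defs "HOL-Library.Function_Algebras" begin

subsection \<open>Arrangements modulo a subgroup\<close>

text \<open>Representatives allow several quotients to be compared within one type, and they can be
  moved inside their classes until two sums agree exactly; the merging of cycles rests on that. The
  odd and the 2-primary part need different products. In \<open>K / L\<close> doubling is injective,
  so translating an arrangement by \<open>u\<close>, which moves its adjacent sums by
  \<open>2 u\<close>, causes no collisions. In a 2-group \<open>2 u\<close> may vanish, so
  translates have to alternate between two shifts, and the result falls apart into several cycles.
  The distinction between cyclic and noncyclic is forced: if the non-identity elements form a cycle
  whose adjacent sums are again these elements, their total equals its own double and is therefore
  0, but in a cyclic group of even order the total is the involution. The congruence condition
  excludes exactly the order 2 for \<open>V / K\<close>. A cyclic \<open>V / K\<close> of order 4
  needs extra care: the interleaving wants a long enough run of multiples of a generator around the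
  omitted label, which is obtained by absorbing a cyclic quotient of odd order.\<close>

definition subgrp :: "'v::comm_ring_1 set \<Rightarrow> bool" where
  "subgrp N \<longleftrightarrow> 0 \<in> N \<and> (\<forall>x\<in>N. \<forall>y\<in>N. x - y \<in> N)"

definition cls :: "'v::comm_ring_1 set \<Rightarrow> 'v \<Rightarrow> 'v set" where
  "cls N x = {y. y - x \<in> N}"

definition indep :: "'v::comm_ring_1 set \<Rightarrow> 'v list \<Rightarrow> bool" where
  "indep N xs \<longleftrightarrow> distinct (map (cls N) xs)"

definition covers :: "'v::comm_ring_1 set \<Rightarrow> 'v set \<Rightarrow> 'v list \<Rightarrow> bool" where
  "covers N S xs \<longleftrightarrow> (\<forall>v\<in>S. \<exists>x\<in>set xs. v - x \<in> N)"

fun psums :: "'v::comm_ring_1 list \<Rightarrow> 'v list" where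
  "psums (x # y # zs) = (x + y) # psums (y # zs)"
| "psums _ = []"

text \<open>A single entry counts as a loop: \<open>csums [x]\<close> is \<open>[x + x]\<close>, so
  \<open>[0]\<close> is a cycle for the trivial group.\<close>

definition csums :: "'v::comm_ring_1 list \<Rightarrow> 'v list" where
  "csums xs = psums (xs @ [hd xs])"

section \<open>Closure of subgroups and comparison of classes\<close>

lemma subgrp_0: "subgrp N \<Longrightarrow> 0 \<in> N"
  and subgrp_diff: "subgrp N \<Longrightarrow> x \<in> N \<Longrightarrow> y \<in> N \<Longrightarrow> x - y \<in> N"
  by (auto simp: subgrp_def)

lemma subgrp_minus: "subgrp N \<Longrightarrow> x \<in> N \<Longrightarrow> - x \<in> N"
  using subgrp_diff[of N 0 x] by (simp add: subgrp_0)

lemma subgrp_add: "subgrp N \<Longrightarrow> x \<in> N \<Longrightarrow> y \<in> N \<Longrightarrow> x + y \<in> N"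
  using subgrp_diff[of N x "- y"] by (simp add: subgrp_minus)

lemma subgrp_of_nat: "subgrp N \<Longrightarrow> x \<in> N \<Longrightarrow> of_nat n * x \<in> N"
  by (induction n) (auto simp: subgrp_0 subgrp_add distrib_right)

lemma subgrp_of_int: "subgrp N \<Longrightarrow> x \<in> N \<Longrightarrow> of_int n * x \<in> N"
  by (cases n rule: int_cases2) (auto simp: subgrp_of_nat subgrp_minus)

lemma subgrp_numeral: "subgrp N \<Longrightarrow> x \<in> N \<Longrightarrow> numeral n * x \<in> N"
  using subgrp_of_nat[of N x "numeral n"] by simp

lemmas subgrp_closed = subgrp_0 subgrp_diff subgrp_minus subgrp_add subgrp_of_nat subgrp_of_int
  subgrp_numeral

lemma subgrp_uminus_iff: "subgrp N \<Longrightarrow> - x \<in> N \<longleftrightarrow> x \<in> N"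
  using subgrp_minus[of N x] subgrp_minus[of N "- x"] by auto

lemma subgrp_diff_commute: "subgrp N \<Longrightarrow> x - y \<in> N \<longleftrightarrow> y - x \<in> N"
  using subgrp_uminus_iff[of N "x - y"] by simp

lemma subgrp_shift: "subgrp N \<Longrightarrow> x - y \<in> N \<Longrightarrow> x \<in> N \<longleftrightarrow> y \<in> N"
  using subgrp_add[of N "x - y" y] subgrp_diff[of N x "x - y"] by auto

lemma cls_eq: assumes "subgrp N" shows "cls N x = cls N y \<longleftrightarrow> x - y \<in> N"
proof
  assume "cls N x = cls N y"
  moreover have "x \<in> cls N x" using assms by (simp add: cls_def subgrp_0)
  ultimately show "x - y \<in> N" by (auto simp: cls_def)
next
  assume *: "x - y \<in> N"
  have "z - x \<in> N \<longleftrightarrow> z - y \<in> N" for z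
    using subgrp_shift[OF assms, of "z - y" "z - x"] * by auto
  then show "cls N x = cls N y" by (auto simp: cls_def)
qed

lemma cls_0: "subgrp N \<Longrightarrow> cls N x = cls N 0 \<longleftrightarrow> x \<in> N"
  by (simp add: cls_eq)

lemma cls_add: "subgrp N \<Longrightarrow> cls N x = cls N x' \<Longrightarrow> cls N y = cls N y' \<Longrightarrow> cls N (x + y) = cls N (x' + y')"
  using subgrp_add[of N "x - x'" "y - y'"] by (simp add: cls_eq algebra_simps)

lemma indep_mset: "mset (map (cls N) xs) = mset (map (cls N) ys) \<Longrightarrow> indep N xs \<longleftrightarrow> indep N ys"
  unfolding indep_def by (metis mset_eq_imp_distinct_iff)

lemma indep_append: assumes "subgrp N"
  shows "indep N (xs @ ys) \<longleftrightarrow> indep N xs \<and> indep N ys \<and> (\<forall>x\<in>set xs. \<forall>y\<in>set ys. x - y \<notin> N)"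
  unfolding indep_def using cls_eq[OF assms] by (auto simp: disjoint_iff image_iff)

lemma indep_Cons: assumes "subgrp N"
  shows "indep N (x # ys) \<longleftrightarrow> (\<forall>y\<in>set ys. x - y \<notin> N) \<and> indep N ys"
  unfolding indep_def using cls_eq[OF assms] by (auto simp: image_iff)

lemma indep_Nil [simp]: "indep N []"
  by (simp add: indep_def)

lemma covers_mset: assumes "subgrp N" "mset (map (cls N) xs) = mset (map (cls N) ys)" "covers N S xs"
  shows "covers N S ys"
proof -
  have "cls N ` set xs = cls N ` set ys"
    using assms(2) by (metis set_map mset_eq_setD)
  then have "\<exists>y\<in>set ys. cls N x = cls N y" if "x \<in> set xs" for x
    using that by (metis imageE image_eqI)
  then show ?thesis
    using assms(3) cls_eq[OF assms(1)] unfolding covers_def by metis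
qed

section \<open>Adjacent sums along paths and cycles\<close>

lemma psums_append: "xs \<noteq> [] \<Longrightarrow> ys \<noteq> [] \<Longrightarrow> psums (xs @ ys) = psums xs @ (last xs + hd ys) # psums ys"
proof (induction xs rule: psums.induct)
  case (1 x y zs)
  then show ?case by simp
next
  case ("2_2" v)
  then show ?case by (cases ys) auto
qed simp

lemma csums_psums: "xs \<noteq> [] \<Longrightarrow> csums xs = psums xs @ [last xs + hd xs]"
  by (simp add: csums_def psums_append)

lemma psums_rev: "psums (rev xs) = rev (psums xs)"
proof (induction xs rule: psums.induct)
  case (1 x y zs)
  have "psums (rev (x # y # zs)) = psums (rev (y # zs) @ [x])" by simp
  also have "\<dots> = psums (rev (y # zs)) @ [y + x]"
    by (subst psums_append) (auto simp: last_rev)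
  finally show ?case using 1 by (simp add: add.commute)
qed auto

lemma length_psums [simp]: "length (psums xs) = length xs - 1"
  by (induction xs rule: psums.induct) auto

lemma psums_map_add: "psums (map ((+) u) xs) = map ((+) (2 * u)) (psums xs)"
  by (induction xs rule: psums.induct) (auto simp: algebra_simps)

lemma cls_psums_cong: assumes "subgrp N" "map (cls N) xs = map (cls N) ys"
  shows "map (cls N) (psums xs) = map (cls N) (psums ys)"
  using assms(2)
proof (induction xs arbitrary: ys rule: psums.induct)
  case (1 x y zs)
  then obtain x' y' zs' where ys: "ys = x' # y' # zs'" by (auto simp: map_eq_Cons_conv)
  have "cls N (x + y) = cls N (x' + y')"
    using 1(2) ys by (intro cls_add[OF assms(1)]) auto
  then show ?case using 1 ys by auto
next
  case "2_1" then show ?case by simp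
next
  case ("2_2" v) then show ?case by (cases ys) auto
qed

lemma cls_csums_cong: assumes "subgrp N" "map (cls N) xs = map (cls N) ys"
  shows "map (cls N) (csums xs) = map (cls N) (csums ys)"
proof (cases xs)
  case Nil
  then show ?thesis using assms by simp
next
  case (Cons x xs')
  then obtain y ys' where "ys = y # ys'" using assms(2) by (cases ys) auto
  then show ?thesis unfolding csums_def using Cons assms by (intro cls_psums_cong) auto
qed

text \<open>Lists of pairs \<open>(b, vs)\<close> describe the fibres of the quotient map modulo \<open>L\<close> over the
  classes modulo \<open>M\<close>.\<close>

definition fibres :: "('v::comm_ring_1 \<times> 'v list) list \<Rightarrow> 'v list" where
  "fibres ps = concat (map (\<lambda>(b, vs). map ((+) b) vs) ps)"

text \<open>Entries that agree modulo \<open>L\<close> agree modulo \<open>M\<close>, so they lie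
  over the same base point, and there the fibre list separates them. The fibre lists may differ from
  one base point to the next; this is needed for the sums, where one fibre has a different shape
  from the others.\<close>

lemma indep_fibres:
  assumes L: "subgrp L" and M: "subgrp M" "L \<subseteq> M"
    and b: "indep M (map fst ps)"
    and v: "\<And>b vs. (b, vs) \<in> set ps \<Longrightarrow> set vs \<subseteq> M \<and> indep L vs"
  shows "indep L (fibres ps)"
  using b v
proof (induction ps)
  case Nil
  then show ?case by (simp add: fibres_def)
next
  case (Cons p ps)
  obtain b vs where p: "p = (b, vs)" by force
  have 1: "indep L (map ((+) b) vs)"
    using Cons.prems(2)[of b vs] p unfolding indep_def by (simp add: distinct_map inj_on_def cls_eq[OF L])
  have 2: "indep L (fibres ps)"
    using Cons p by (intro Cons.IH) (auto simp: indep_Cons[OF M(1)])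
  have 3: "b + v - y \<notin> L" if vy: "v \<in> set vs" "y \<in> set (fibres ps)" for v y
  proof
    assume *: "b + v - y \<in> L"
    obtain b' vs' v' where y: "(b', vs') \<in> set ps" "v' \<in> set vs'" "y = b' + v'"
      using vy(2) by (auto simp: fibres_def)
    have "v' \<in> M" "v \<in> M" using Cons.prems(2)[of b' vs'] Cons.prems(2)[of b vs] y vy p by auto
    moreover have "b + v - y \<in> M" using * M by auto
    ultimately have "(b + v - y) + v' - v \<in> M" by (meson M(1) subgrp_add subgrp_diff)
    then have "b - b' \<in> M" using y by (simp add: algebra_simps)
    moreover have "b - b' \<notin> M"
      using Cons.prems(1) p y(1) by (force simp: indep_Cons[OF M(1)])
    ultimately show False by simp
  qed
  have "fibres (p # ps) = map ((+) b) vs @ fibres ps" by (simp add: fibres_def p)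
  then show ?case using 1 2 3 by (auto simp: indep_append[OF L])
qed

lemma covers_fibres:
  assumes L: "subgrp L" and M: "subgrp M"
    and b: "covers M S (map fst ps)"
    and v: "\<And>b vs. (b, vs) \<in> set ps \<Longrightarrow> covers L M vs"
  shows "covers L S (fibres ps)"
  unfolding covers_def
proof
  fix x assume "x \<in> S"
  then obtain p where p: "p \<in> set ps" "x - fst p \<in> M"
    using b by (auto simp: covers_def)
  then obtain v where "v \<in> set (snd p)" "x - fst p - v \<in> L"
    using v[of "fst p" "snd p"] by (auto simp: covers_def)
  then show "\<exists>y\<in>set (fibres ps). x - y \<in> L"
    using p by (intro bexI[of _ "fst p + v"]) (auto simp: fibres_def algebra_simps split_beta intro!: bexI[of _ p])
qed

text \<open>The copies of \<open>b\<close> are traversed whole, one for each entry of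
  \<open>us\<close>, so that the step closing the cycle \<open>b\<close> is replaced by a step into
  the next copy.\<close>

definition blocks :: "'v::comm_ring_1 list \<Rightarrow> 'v list \<Rightarrow> 'v list" where
  "blocks b us = concat (map (\<lambda>u. map ((+) u) b) us)"

lemma blocks_Cons: "blocks b (u # us) = map ((+) u) b @ blocks b us"
  by (simp add: blocks_def)

lemma hd_blocks: "b \<noteq> [] \<Longrightarrow> us \<noteq> [] \<Longrightarrow> hd (blocks b us) = hd us + hd b"
  by (cases us; cases b) (auto simp: blocks_def)

lemma blocks_eq_Nil: "blocks b us = [] \<longleftrightarrow> b = [] \<or> us = []"
  by (auto simp: blocks_def)

lemma last_blocks: "b \<noteq> [] \<Longrightarrow> us \<noteq> [] \<Longrightarrow> last (blocks b us) = last us + last b"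
  by (induction us) (auto simp: blocks_Cons blocks_eq_Nil last_map)

lemma mset_fibres_Cons:
  "mset (fibres (map (\<lambda>x. (x, u # us)) b)) = mset (map ((+) u) b) + mset (fibres (map (\<lambda>x. (x, us)) b))"
  by (induction b) (auto simp: fibres_def add.commute)

lemma mset_fibres_Nil: "mset (fibres (map (\<lambda>x. (x, [])) b)) = {#}"
  by (induction b) (auto simp: fibres_def)

lemma mset_fibres_append: "mset (fibres (ps @ qs)) = mset (fibres ps) + mset (fibres qs)"
  by (simp add: fibres_def)

lemma mset_blocks: "mset (blocks b us) = mset (fibres (map (\<lambda>x. (x, us)) b))"
proof (induction us)
  case Nil
  show ?case by (induction b) (auto simp: blocks_def fibres_def)
next
  case (Cons u us)
  then show ?case by (simp only: blocks_Cons mset_append mset_fibres_Cons)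
qed

text \<open>Inside the copy translated by \<open>u\<close> the adjacent sums move by
  \<open>2 * u\<close>, and the step from copy \<open>u\<close> to copy \<open>v\<close> has sum
  \<open>(last b + hd b) + (u + v)\<close>. Hence the fibre over an inner sum of \<open>b\<close>
  consists of doubles, whereas the fibre over the closing sum of \<open>b\<close> consists of
  adjacent sums of \<open>us\<close>.\<close>

lemma mset_psums_blocks:
  assumes "b \<noteq> []" "us \<noteq> []"
  shows "mset (psums (blocks b us)) =
    mset (fibres (map (\<lambda>x. (x, map ((*) 2) us)) (psums b) @ [(last b + hd b, psums us)]))"
  using assms(2)
proof (induction us rule: psums.induct)
  case (1 u v us)
  have "psums (blocks b (u # v # us)) =
      map ((+) (2 * u)) (psums b) @ (u + last b + (v + hd b)) # psums (blocks b (v # us))"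
    using assms(1) by (subst blocks_Cons, subst psums_append)
      (auto simp: blocks_eq_Nil psums_map_add hd_blocks last_map)
  then show ?case
    using 1 by (simp add: mset_fibres_append mset_fibres_Cons) (simp add: fibres_def add_ac)
next
  case ("2_2" u)
  have "mset (fibres (map (\<lambda>x. (x, [2 * u])) (psums b))) = mset (map ((+) (2 * u)) (psums b))"
    by (subst mset_fibres_Cons) (simp add: mset_fibres_Nil)
  then show ?case
    by (simp add: blocks_def psums_map_add mset_fibres_append) (simp add: fibres_def)
qed simp

lemma mset_csums_blocks:
  assumes "b \<noteq> []" "us \<noteq> []"
  shows "mset (csums (blocks b us)) =
    mset (fibres (map (\<lambda>x. (x, map ((*) 2) us)) (psums b) @ [(last b + hd b, csums us)]))"
  using assms mset_psums_blocks[OF assms]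
  by (simp add: csums_psums blocks_eq_Nil hd_blocks last_blocks mset_fibres_append)
    (simp add: fibres_def algebra_simps)

section \<open>Odd torsion and harmonious cycles\<close>

definition odd_torsion :: "'v::comm_ring_1 set \<Rightarrow> 'v set \<Rightarrow> bool" where
  "odd_torsion L K \<longleftrightarrow> (\<forall>x\<in>K. \<exists>j::nat. odd j \<and> of_nat j * x \<in> L)"

text \<open>For \<open>j = 2 * i + 1\<close> the element \<open>x\<close> is the difference of
  \<open>j x\<close> and \<open>i (2 x)\<close>.\<close>

lemma odd_torsion_double: assumes "subgrp L" "odd_torsion L K" "x \<in> K" "2 * x \<in> L"
  shows "x \<in> L"
proof -
  obtain j :: nat where j: "odd j" "of_nat j * x \<in> L" using assms by (auto simp: odd_torsion_def)
  then obtain i where i: "j = 2 * i + 1" using oddE by blast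
  have "of_nat j * x - of_nat i * (2 * x) \<in> L"
    using assms j by (blast intro: subgrp_closed)
  then show ?thesis by (simp add: i algebra_simps)
qed

text \<open>For \<open>j = 2 * i + 1\<close> the multiple \<open>(i + 1) x\<close> is a half of
  \<open>x\<close> modulo \<open>L\<close>.\<close>

lemma odd_torsion_half: assumes "subgrp L" "subgrp K" "odd_torsion L K" "x \<in> K"
  obtains y where "y \<in> K" "2 * y - x \<in> L"
proof -
  obtain j :: nat where j: "odd j" "of_nat j * x \<in> L" using assms by (auto simp: odd_torsion_def)
  then obtain i where i: "j = 2 * i + 1" using oddE by blast
  have "2 * (of_nat (i + 1) * x) - x = of_nat j * x" by (simp add: i algebra_simps)
  with j that[of "of_nat (i + 1) * x"] show thesis
    using subgrp_of_nat[OF assms(2,4), of "i+1"] by simp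
qed

text \<open>A group with such a cycle is called harmonious. With 0 in front the closing sum is
  \<open>last us\<close>; so when the cycle is cut there, the end vertex at \<open>last us\<close>
  has the sum that the cut would lose, and the other end carries the label 0, which can be glued to
  any label without changing it.\<close>

definition harmonious :: "'v::comm_ring_1 set \<Rightarrow> 'v set \<Rightarrow> 'v list \<Rightarrow> bool" where
  "harmonious L K us \<longleftrightarrow> us \<noteq> [] \<and> hd us = 0 \<and> set us \<subseteq> K \<and> indep L us \<and> covers L K us \<and>
     indep L (csums us)"

lemma set_psums: "subgrp K \<Longrightarrow> set us \<subseteq> K \<Longrightarrow> set (psums us) \<subseteq> K"
  by (induction us rule: psums.induct) (auto simp: subgrp_add)

lemma set_csums: "subgrp K \<Longrightarrow> set us \<subseteq> K \<Longrightarrow> us \<noteq> [] \<Longrightarrow> set (csums us) \<subseteq> K"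
  unfolding csums_def by (intro set_psums) auto

lemma indep_double: assumes "subgrp L" "subgrp K" "odd_torsion L K" "set us \<subseteq> K" "indep L us"
  shows "indep L (map ((*) 2) us)"
  using assms(4,5)
proof (induction us)
  case (Cons u us)
  have "2 * u - 2 * v \<notin> L" if "v \<in> set us" for v
  proof
    assume "2 * u - 2 * v \<in> L"
    then have "u - v \<in> L"
      using Cons.prems(1) that assms(2)
      by (subst (asm) right_diff_distrib[symmetric])
        (rule odd_torsion_double[OF assms(1,3)], auto simp: subgrp_diff)
    then show False using Cons.prems(2) that by (auto simp: indep_Cons[OF assms(1)])
  qed
  with Cons show ?case by (auto simp: indep_Cons[OF assms(1)])
qed simp

lemma indep_blocks:
  assumes "subgrp L" "subgrp K" "L \<subseteq> K" "harmonious L K us" "indep K b"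
  shows "indep L (blocks b us)"
proof -
  have "indep L (fibres (map (\<lambda>x. (x, us)) b))"
    using assms(4,5) by (intro indep_fibres[OF assms(1-3)]) (auto simp: harmonious_def comp_def)
  then show ?thesis
    using indep_mset mset_blocks by (metis mset_map)
qed

lemma covers_blocks:
  assumes "subgrp L" "subgrp K" "harmonious L K us" "covers K S b"
  shows "covers L S (blocks b us)"
proof -
  have "covers L S (fibres (map (\<lambda>x. (x, us)) b))"
    using assms(3,4) by (intro covers_fibres[OF assms(1,2)]) (auto simp: harmonious_def comp_def)
  then show ?thesis
    using covers_mset[OF assms(1)] mset_blocks by (metis mset_map)
qed

lemma indep_csums_blocks:
  assumes "subgrp L" "subgrp K" "L \<subseteq> K" "odd_torsion L K" "harmonious L K us" "b \<noteq> []"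
    "indep K (csums b)"
  shows "indep L (csums (blocks b us))"
proof -
  have us: "us \<noteq> []" "set us \<subseteq> K" "indep L us" "indep L (csums us)"
    using assms(5) by (auto simp: harmonious_def)
  have "indep L (fibres (map (\<lambda>x. (x, map ((*) 2) us)) (psums b) @ [(last b + hd b, csums us)]))"
  proof (intro indep_fibres[OF assms(1-3)])
    show "indep K (map fst (map (\<lambda>x. (x, map ((*) 2) us)) (psums b) @ [(last b + hd b, csums us)]))"
      using assms(6,7) by (simp add: csums_psums comp_def)
    have "set (map ((*) 2) us) \<subseteq> K" using us(2) subgrp_numeral[OF assms(2)] by auto
    moreover have "set (csums us) \<subseteq> K" using us set_csums[OF assms(2)] by blast
    moreover have "indep L (map ((*) 2) us)" using us indep_double[OF assms(1,2,4)] by blast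
    ultimately show "set vs \<subseteq> K \<and> indep L vs"
      if "(x, vs) \<in> set (map (\<lambda>x. (x, map ((*) 2) us)) (psums b) @ [(last b + hd b, csums us)])" for x vs
      using that us(4) by auto
  qed
  then show ?thesis
    using indep_mset mset_csums_blocks[OF assms(6) us(1)] by (metis mset_map)
qed

section \<open>Cyclic extensions of a subgroup\<close>

lemma order_mod:
  assumes N: "subgrp N" and ex: "\<exists>j>0. of_nat j * g \<in> N"
  obtains q :: nat where "q > 0" "\<And>i::int. of_int i * g \<in> N \<longleftrightarrow> int q dvd i"
proof -
  define q where "q = (LEAST j::nat. j > 0 \<and> of_nat j * g \<in> N)"
  have q: "q > 0" "of_nat q * g \<in> N"
    using LeastI_ex[OF ex] by (auto simp: q_def)
  have min: "\<not> (0 < j \<and> of_nat j * g \<in> N)" if "j < q" for j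
    using not_less_Least[of j "\<lambda>j. j > 0 \<and> of_nat j * g \<in> N"] that by (simp add: q_def)
  have "of_int i * g \<in> N \<longleftrightarrow> int q dvd i" for i
  proof
    assume "int q dvd i"
    then obtain c where "i = int q * c" by blast
    then have "of_int i * g = of_int c * (of_nat q * g)" by (simp add: algebra_simps)
    then show "of_int i * g \<in> N" using q N by (simp add: subgrp_of_int)
  next
    assume i: "of_int i * g \<in> N"
    define r where "r = nat (i mod int q)"
    have r: "int r = i mod int q" "r < q"
      using q(1) by (auto simp: r_def nat_less_iff)
    have "i = i div int q * int q + int r" using r by simp
    then have "of_int i = (of_int (i div int q) * of_nat q + of_nat r :: 'a)"
      by (metis of_int_add of_int_mult of_int_of_nat_eq)
    then have "of_nat r * g = of_int i * g - of_int (i div int q) * (of_nat q * g)"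
      by (simp add: algebra_simps)
    also have "\<dots> \<in> N" using i q N by (blast intro: subgrp_closed)
    finally have "r = 0" using min[OF r(2)] by auto
    then show "int q dvd i" using r by auto
  qed
  with q(1) that show thesis by blast
qed

lemma indep_multiples:
  assumes N: "subgrp N" and q: "\<And>i::int. of_int i * g \<in> N \<longleftrightarrow> q dvd i"
  shows "indep N (map (\<lambda>i. of_int i * g) is) \<longleftrightarrow> distinct (map (\<lambda>i. i mod q) is)"
proof -
  have "of_int i * g - of_int j * g \<in> N \<longleftrightarrow> i mod q = j mod q" for i j
    using q[of "i - j"] by (simp add: left_diff_distrib mod_eq_dvd_iff)
  then show ?thesis
    unfolding indep_def by (induction "is") (auto simp: cls_eq[OF N] image_iff)
qed

definition adjoin :: "'v::comm_ring_1 \<Rightarrow> 'v set \<Rightarrow> 'v set" where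
  "adjoin g N = {of_int i * g + x |i x. x \<in> N}"

lemma subgrp_adjoin: assumes "subgrp N" shows "subgrp (adjoin g N)"
proof -
  have "0 \<in> adjoin g N" unfolding adjoin_def using subgrp_0[OF assms]
    by (auto intro!: exI[of _ 0])
  moreover have "(of_int i * g + x) - (of_int j * g + y) \<in> adjoin g N" if "x \<in> N" "y \<in> N" for i j x y
    unfolding adjoin_def using subgrp_diff[OF assms that]
    by (auto intro!: exI[of _ "i - j"] exI[of _ "x - y"] simp: algebra_simps)
  ultimately show ?thesis unfolding subgrp_def by (auto simp: adjoin_def)
qed

lemma adjoin_superset: "N \<subseteq> adjoin g N"
proof
  fix x assume "x \<in> N"
  moreover have "x = of_int 0 * g + x" by simp
  ultimately show "x \<in> adjoin g N" unfolding adjoin_def by blast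
qed

lemma adjoin_self: assumes "subgrp N" shows "g \<in> adjoin g N"
proof -
  have "g = of_int 1 * g + 0" by simp
  then show ?thesis unfolding adjoin_def using subgrp_0[OF assms] by blast
qed

lemma adjoin_subset: "subgrp K \<Longrightarrow> N \<subseteq> K \<Longrightarrow> g \<in> K \<Longrightarrow> adjoin g N \<subseteq> K"
  unfolding adjoin_def by (auto intro: subgrp_add subgrp_of_int)

lemma covers_multiples:
  assumes q: "q > 0" "of_int (int q) * g \<in> N" and N: "subgrp N"
  shows "covers N (adjoin g N) (map (\<lambda>i. of_int i * g) (map int [0..<q]))"
  unfolding covers_def
proof
  fix v assume "v \<in> adjoin g N"
  then obtain i x where v: "v = of_int i * g + x" "x \<in> N" by (auto simp: adjoin_def)
  have "v - of_int (i mod int q) * g = of_int (i - i mod int q) * g + x"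
    by (simp add: v algebra_simps)
  also have "i - i mod int q = i div int q * int q" by (simp add: minus_mod_eq_div_mult)
  also have "of_int (i div int q * int q) * g + x = of_int (i div int q) * (of_int (int q) * g) + x"
    by (simp add: algebra_simps)
  also have "\<dots> \<in> N" using N v q by (blast intro: subgrp_closed)
  finally have "v - of_int (i mod int q) * g \<in> N" .
  moreover have "i mod int q \<in> int ` {0..<q}"
    using q(1) by (intro image_eqI[of _ _ "nat (i mod int q)"]) (auto simp: nat_less_iff)
  ultimately show "\<exists>x\<in>set (map (\<lambda>i. of_int i * g) (map int [0..<q])). v - x \<in> N"
    unfolding set_map set_upt image_image[symmetric] by blast
qed

lemma psums_multiples:
  "psums (map (\<lambda>i. of_int i * g) is) = map (\<lambda>i. of_int i * g) (psums is)"
  by (induction "is" rule: psums.induct) (auto simp: algebra_simps)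

lemma psums_map_upt: "psums (map f [0..<n]) = map (\<lambda>i. f i + f (Suc i)) [0..<n - 1]"
proof (cases n)
  case (Suc m)
  have "psums (map f [0..<Suc m]) = map (\<lambda>i. f i + f (Suc i)) [0..<m]"
  proof (induction m)
    case (Suc m)
    have "psums (map f [0..<Suc (Suc m)]) = psums (map f [0..<Suc m] @ [f (Suc m)])" by simp
    also have "\<dots> = psums (map f [0..<Suc m]) @ [f m + f (Suc m)]"
      by (subst psums_append) auto
    finally show ?case using Suc.IH by simp
  qed simp
  then show ?thesis using Suc by simp
qed simp

text \<open>The closing sum \<open>q - 1\<close> is congruent to \<open>2 * (q - 1) + 1\<close>, so
  it continues the pattern \<open>2 * i + 1\<close> of the other sums, and 2 is invertible modulo
  the odd number \<open>q\<close>.\<close>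

lemma distinct_harmonious_odd:
  assumes q: "odd (q::nat)"
  shows "distinct (map (\<lambda>i. i mod int q) (csums (map int [0..<q])))"
proof -
  have q0: "q > 0" using q by (auto intro: gr0I)
  have "csums (map int [0..<q]) = map (\<lambda>i. 2 * int i + 1) [0..<q - 1] @ [int q - 1]"
    using q0 by (auto simp: csums_psums psums_map_upt hd_map last_map last_upt)
  also have "map (\<lambda>i. i mod int q) \<dots> = map (\<lambda>i. (2 * int i + 1) mod int q) [0..<q]"
  proof -
    have "2 * int (q - 1) + 1 = int q - 1 + int q" using q0 by (simp add: of_nat_diff)
    then have "(int q - 1) mod int q = (2 * int (q - 1) + 1) mod int q" by (metis mod_add_self2)
    then have "map (\<lambda>i. i mod int q) (map (\<lambda>i. 2 * int i + 1) [0..<q - 1] @ [int q - 1]) =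
        map (\<lambda>i. (2 * int i + 1) mod int q) ([0..<q - 1] @ [q - 1])" by simp
    also have "[0..<q - 1] @ [q - 1] = [0..<q]" using q0 by (metis Suc_diff_1 upt_Suc_append zero_le)
    finally show ?thesis .
  qed
  also have "distinct \<dots>"
  proof -
    have "i = j" if "i < q" "j < q" "(2 * int i + 1) mod int q = (2 * int j + 1) mod int q" for i j
    proof -
      have "int q dvd 2 * (int i - int j)"
        using that(3) by (simp add: mod_eq_dvd_iff algebra_simps)
      moreover have "coprime (int q) 2" using q by simp
      ultimately have "int q dvd int i - int j"
        using coprime_dvd_mult_right_iff by blast
      then show "i = j" using that(1,2) by (simp add: mod_eq_dvd_iff[symmetric])
    qed
    then show ?thesis by (auto simp: distinct_map inj_on_def)
  qed
  finally show ?thesis .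
qed

definition finite_index :: "'v::comm_ring_1 set \<Rightarrow> bool" where
  "finite_index N \<longleftrightarrow> finite (range (cls N))"

lemma indep_length: assumes "finite_index L" "indep L us"
  shows "length us \<le> card (range (cls L))"
proof -
  have "length us = card (set (map (cls L) us))"
    using assms(2) distinct_card[of "map (cls L) us"] by (simp add: indep_def)
  also have "\<dots> \<le> card (range (cls L))"
    using assms(1) by (intro card_mono) (auto simp: finite_index_def)
  finally show ?thesis .
qed

lemma odd_torsion_order:
  assumes L: "subgrp L" and H: "subgrp H" "L \<subseteq> H" and K: "odd_torsion L K" and g: "g \<in> K" "g \<notin> H"
  obtains q :: nat where "odd q" "q > 1" "\<And>i::int. of_int i * g \<in> H \<longleftrightarrow> int q dvd i"
proof -
  obtain j :: nat where j: "odd j" "of_nat j * g \<in> L" using K g by (auto simp: odd_torsion_def)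
  then have "\<exists>j>0. of_nat j * g \<in> H" using H by (intro exI[of _ j]) (auto intro: gr0I)
  then obtain q :: nat where q: "q > 0" "\<And>i::int. of_int i * g \<in> H \<longleftrightarrow> int q dvd i"
    using order_mod[OF H(1)] by blast
  have "int q dvd int j" using q(2)[of "int j"] j H by auto
  then have "odd q" using j(1) by (meson dvd_trans int_dvd_int_iff)
  moreover have "q \<noteq> 1" using q(2)[of 1] g by auto
  ultimately show thesis using that[of q] q by fastforce
qed

text \<open>The multiples of \<open>g\<close> form a cycle over \<open>H\<close> whose length is the
  odd order \<open>q\<close> of \<open>g\<close> modulo \<open>H\<close>; its blocks along
  \<open>us\<close> are harmonious, and the length is multiplied by \<open>q\<close>.\<close>

lemma harmonious_adjoin:
  assumes L: "subgrp L" and H: "subgrp H" "L \<subseteq> H" and K: "odd_torsion L K" "H \<subseteq> K"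
    and g: "g \<in> K" "g \<notin> H" and us: "harmonious L H us"
  shows "\<exists>us'. harmonious L (adjoin g H) us' \<and> length us < length us' \<and> (odd (length us) \<longrightarrow> odd (length us'))"
proof -
  obtain q :: nat where q: "odd q" "q > 1" "\<And>i::int. of_int i * g \<in> H \<longleftrightarrow> int q dvd i"
    using odd_torsion_order[OF L H K(1) g] by metis
  define b where "b = map (\<lambda>i. of_int i * g) (map int [0..<q])"
  have b: "b \<noteq> []" "hd b = 0" using q(2) by (auto simp: b_def hd_map)
  have cb: "csums b = map (\<lambda>i. of_int i * g) (csums (map int [0..<q]))"
    using psums_multiples[of g "map int [0..<q] @ [0]"] b q(2) unfolding csums_def b_def
    by (simp add: hd_map)
  have H': "odd_torsion L H" using K by (auto simp: odd_torsion_def)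
  have us': "us \<noteq> []" "hd us = 0" using us by (auto simp: harmonious_def)
  have "indep H b" unfolding b_def
    by (subst indep_multiples[OF H(1) q(3)]) (auto simp: distinct_map inj_on_def)
  moreover have "indep H (csums b)" unfolding cb
    by (subst indep_multiples[OF H(1) q(3)]) (rule distinct_harmonious_odd[OF q(1)])
  moreover have "covers H (adjoin g H) b" unfolding b_def
    using q(2) q(3)[of "int q"] by (intro covers_multiples[OF _ _ H(1)]) auto
  ultimately have "indep L (blocks b us)" "indep L (csums (blocks b us))" "covers L (adjoin g H) (blocks b us)"
    using indep_blocks[OF L H us] indep_csums_blocks[OF L H H' us b(1)] covers_blocks[OF L H(1) us] by blast+
  moreover have "set (blocks b us) \<subseteq> adjoin g H"
  proof -
    have "set us \<subseteq> adjoin g H" "set b \<subseteq> adjoin g H"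
      using us adjoin_superset[of H g] adjoin_self[OF H(1), of g] subgrp_adjoin[OF H(1), of g]
      by (auto simp: harmonious_def b_def intro: subgrp_of_int subgrp_of_nat)
    then show ?thesis using subgrp_add[OF subgrp_adjoin[OF H(1)]] by (auto simp: blocks_def subset_iff)
  qed
  ultimately have "harmonious L (adjoin g H) (blocks b us)"
    using b us' unfolding harmonious_def by (simp add: blocks_eq_Nil hd_blocks)
  moreover have "length (blocks b us) = length us * q"
    by (induction us) (auto simp: blocks_def b_def)
  ultimately show ?thesis using q(1,2) us' by (intro exI[of _ "blocks b us"]) auto
qed

text \<open>Lengths of independent lists are bounded by the index of \<open>L\<close>, so there is a
  longest harmonious cycle of odd length for a subgroup between \<open>L\<close> and
  \<open>K\<close>; it cannot be extended, hence belongs to \<open>K\<close>. The parity is carried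
  along because the length is the order of \<open>K / L\<close>, and this is how that order is known
  to be odd.\<close>

lemma harmonious_exists:
  assumes L: "subgrp L" "finite_index L" and K: "subgrp K" "L \<subseteq> K" "odd_torsion L K"
  shows "\<exists>us. harmonious L K us \<and> odd (length us)"
proof -
  define P where "P n \<longleftrightarrow> (\<exists>H us. subgrp H \<and> L \<subseteq> H \<and> H \<subseteq> K \<and> harmonious L H us \<and> odd (length us) \<and> length us = n)" for n
  have "harmonious L L [0]"
    by (auto simp: harmonious_def subgrp_0[OF L(1)] csums_def covers_def indep_def)
  then have "P 1" unfolding P_def using L K by (intro exI[of _ L] exI[of _ "[0]"]) auto
  moreover have "\<forall>n. P n \<longrightarrow> n \<le> card (range (cls L))"
    unfolding P_def harmonious_def using indep_length[OF L(2)] by blast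
  ultimately obtain n where n: "P n" "\<And>m. P m \<Longrightarrow> m \<le> n"
    using GreatestI_nat[of P] Greatest_le_nat[of P] by metis
  then obtain H us where H: "subgrp H" "L \<subseteq> H" "H \<subseteq> K" "harmonious L H us" "odd (length us)" "length us = n"
    unfolding P_def by blast
  have "H = K"
  proof (rule ccontr)
    assume "H \<noteq> K"
    then obtain g where g: "g \<in> K" "g \<notin> H" using H by blast
    obtain us' where "harmonious L (adjoin g H) us'" "length us < length us'" "odd (length us')"
      using harmonious_adjoin[OF L(1) H(1,2) K(3) H(3) g H(4)] H(5) by blast
    then have "P (length us')" unfolding P_def
      using subgrp_adjoin[OF H(1), of g] adjoin_superset[of H g] adjoin_subset[OF K(1) H(3) g(1)] H(2) by blast
    with n(2) \<open>length us < length us'\<close> H(6) show False by fastforce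
  qed
  then show ?thesis using H by blast
qed

text \<open>Such a cycle is known as a #-harmonious sequence. Since \<open>csums xs\<close> is as
  long as \<open>xs\<close>, the sums represent exactly the classes other than \<open>N\<close>. The
  odd length is what makes alternating shifts fit together when the cycle is traversed
  repeatedly.\<close>

definition sharp :: "'v::comm_ring_1 set \<Rightarrow> 'v list \<Rightarrow> bool" where
  "sharp N xs \<longleftrightarrow> odd (length xs) \<and> indep N (0 # xs) \<and> indep N (0 # csums xs) \<and> covers N UNIV (0 # xs)"

lemma sharp_cong: assumes "subgrp N" "map (cls N) xs = map (cls N) ys" "sharp N xs"
  shows "sharp N ys"
proof -
  have "length xs = length ys" using assms(2) by (metis length_map)
  moreover have "indep N (0 # ys)" using assms unfolding sharp_def indep_def by simp
  moreover have "indep N (0 # csums ys)"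
    using assms(3) cls_csums_cong[OF assms(1,2)] unfolding sharp_def indep_def by simp
  moreover have "covers N UNIV (0 # ys)"
  proof (rule covers_mset[OF assms(1)])
    show "mset (map (cls N) (0 # xs)) = mset (map (cls N) (0 # ys))"
      by (simp only: list.map assms(2))
    show "covers N UNIV (0 # xs)" using assms(3) by (simp add: sharp_def)
  qed
  ultimately show ?thesis using assms(3) by (simp add: sharp_def)
qed

text \<open>The list starts at \<open>s\<close>, so the neighbours of \<open>s\<close> in the cycle
  are \<open>r\<close> and \<open>t\<close>. Modulo \<open>N\<close> the two sums at
  \<open>s\<close> are \<open>r + s = t\<close> and \<open>s + t = r\<close>: removing
  \<open>s\<close> loses just the labels of its neighbours, and those reappear as sums once the
  neighbours become ends or meet a label 0.\<close>

definition triple_sharp :: "'v::comm_ring_1 set \<Rightarrow> bool" where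
  "triple_sharp N \<longleftrightarrow> (\<exists>s t ys r. sharp N (s # t # ys @ [r]) \<and> 2 * s \<in> N \<and> r + s - t \<in> N)"

text \<open>A substitute for \<open>triple_sharp\<close>, used for the cycles of order 8. The sums
  at \<open>x\<close> are \<open>p\<close> and \<open>q\<close>, which are adjacent elsewhere in the
  cycle, and \<open>p + q = y + z\<close> modulo \<open>N\<close>; so after the removal of
  \<open>x\<close> an edge between \<open>y\<close> and \<open>z\<close> can replace the edge
  between \<open>p\<close> and \<open>q\<close>.\<close>

definition edge_sharp :: "'v::comm_ring_1 set \<Rightarrow> bool" where
  "edge_sharp N \<longleftrightarrow> (\<exists>x y ys p q qs z. sharp N (x # y # ys @ p # q # qs @ [z]) \<and>
     2 * x \<in> N \<and> p - (x + z) \<in> N \<and> q - (x + y) \<in> N)"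

text \<open>A constant shift by an element \<open>u\<close> with \<open>2 * u\<close> in
  \<open>N\<close> would leave all adjacent sums in place. Alternating between \<open>u\<close> and
  \<open>v\<close> moves each of them by \<open>u + v\<close>.\<close>

fun alternate :: "'v::comm_ring_1 \<Rightarrow> 'v \<Rightarrow> 'v list \<Rightarrow> 'v list" where
  "alternate u v [] = []"
| "alternate u v (x # xs) = (x + u) # alternate v u xs"

lemma length_alternate [simp]: "length (alternate u v xs) = length xs"
  by (induction u v xs rule: alternate.induct) auto

lemma alternate_eq_Nil [simp]: "alternate u v xs = [] \<longleftrightarrow> xs = []"
  by (cases xs) auto

lemma hd_alternate: "xs \<noteq> [] \<Longrightarrow> hd (alternate u v xs) = hd xs + u"
  by (cases xs) auto

lemma last_alternate:
  "xs \<noteq> [] \<Longrightarrow> last (alternate u v xs) = last xs + (if odd (length xs) then u else v)"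
  by (induction u v xs rule: alternate.induct) auto

lemma psums_alternate: "psums (alternate u v xs) = map (\<lambda>x. x + (u + v)) (psums xs)"
proof (induction xs arbitrary: u v rule: psums.induct)
  case (1 x y zs)
  then show ?case by (simp add: algebra_simps)
qed auto

text \<open>For \<open>b\<close> of odd length a pass that starts with one shift also ends with it,
  and the next pass starts with the following one. So the joins are shifted like the inner sums of
  the pass before them, and each entry of \<open>b\<close> receives every one of the three shifts
  once.\<close>

definition passes :: "'v::comm_ring_1 \<Rightarrow> 'v \<Rightarrow> 'v \<Rightarrow> 'v list \<Rightarrow> 'v list" where
  "passes u v w b = alternate u v b @ alternate v w b @ alternate w u b"

lemma mset_passes: "mset (passes u v w b) = mset (fibres (map (\<lambda>x. (x, [u, v, w])) b))"
proof -
  have "mset (alternate u v b) + mset (alternate v w b) + mset (alternate w u b) =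
      mset (fibres (map (\<lambda>x. (x, [u, v, w])) b))"
  proof (induction b arbitrary: u v w)
    case (Cons x b)
    have "mset (fibres (map (\<lambda>x. (x, [v, u, w])) b)) = mset (fibres (map (\<lambda>x. (x, [u, v, w])) b))"
      by (simp add: mset_fibres_Cons mset_fibres_Nil)
    then show ?case using Cons[of v u w] by (simp add: fibres_def ac_simps)
  qed (simp add: fibres_def)
  then show ?thesis by (simp add: passes_def add.assoc)
qed

lemma mset_csums_passes:
  assumes "odd (length b)"
  shows "mset (csums (passes u v w b)) = mset (fibres (map (\<lambda>x. (x, [u + v, v + w, w + u])) (csums b)))"
proof -
  have b: "b \<noteq> []" using assms by auto
  have "mset (map (\<lambda>x. x + (u + v)) B) + mset (map (\<lambda>x. x + (v + w)) B) + mset (map (\<lambda>x. x + (w + u)) B) =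
      mset (fibres (map (\<lambda>x. (x, [u + v, v + w, w + u])) B))" for B :: "'a list"
    by (induction B) (auto simp: fibres_def)
  from this[of "psums b"] show ?thesis
    using b assms by (simp add: csums_psums passes_def psums_append psums_alternate hd_alternate
        last_alternate mset_fibres_append algebra_simps) (simp add: fibres_def algebra_simps)
qed

text \<open>\<open>M / N\<close> is a Klein four-group with basis \<open>u\<close>,
  \<open>v\<close>.\<close>

definition klein :: "'v::comm_ring_1 set \<Rightarrow> 'v set \<Rightarrow> 'v \<Rightarrow> 'v \<Rightarrow> bool" where
  "klein N M u v \<longleftrightarrow> subgrp N \<and> subgrp M \<and> N \<subseteq> M \<and> u \<in> M \<and> v \<in> M \<and> u \<notin> N \<and> v \<notin> N \<and> u - v \<notin> N \<and>
     (\<forall>x\<in>M. 2 * x \<in> N) \<and> (\<forall>x\<in>M. x \<in> N \<or> x - u \<in> N \<or> x - v \<in> N \<or> x - (u + v) \<in> N)"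

subsection \<open>Extension by a Klein four-group\<close>

lemma klein_basis:
  assumes k: "klein N M u v" and ab: "a \<in> M" "b \<in> M" "a \<notin> N" "b \<notin> N" "a - b \<notin> N"
  shows "klein N M a b"
proof -
  have N: "subgrp N" and M: "subgrp M" and d: "\<And>x. x \<in> M \<Longrightarrow> 2 * x \<in> N" and uv: "u \<in> M" "v \<in> M"
    and cov: "\<And>x. x \<in> M \<Longrightarrow> x \<in> N \<or> x - u \<in> N \<or> x - v \<in> N \<or> x - (u + v) \<in> N"
    using k by (auto simp: klein_def)
  have c: "cls N (2 * x) = cls N 0" if "x \<in> M" for x using d[OF that] by (simp add: cls_0[OF N])
  have cov': "cls N x = cls N 0 \<or> cls N x = cls N u \<or> cls N x = cls N v \<or> cls N x = cls N (u + v)" if "x \<in> M" for x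
    using cov[OF that] by (simp add: cls_eq[OF N])
  have neg: "cls N (x - y) = cls N (x + y)" if "y \<in> M" for x y
    using d[OF that] subgrp_minus[OF N, of "2 * y"] by (simp add: cls_eq[OF N])
  have "x \<in> N \<or> x - a \<in> N \<or> x - b \<in> N \<or> x - (a + b) \<in> N" if x: "x \<in> M" for x
  proof -
    have *: "x - y \<in> N \<longleftrightarrow> cls N x = cls N y" for y by (simp add: cls_eq[OF N])
    have **: "cls N a \<noteq> cls N 0" "cls N b \<noteq> cls N 0" "cls N a \<noteq> cls N b"
      using ab by (auto simp: cls_eq[OF N])
    have sums: "cls N (a + b) = cls N (p + q)" if "cls N a = cls N p" "cls N b = cls N q" for p q
      using that by (rule cls_add[OF N])
    have r: "cls N (u + (u + v)) = cls N v" "cls N (v + (u + v)) = cls N u" "cls N (u + v + u) = cls N v"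
      "cls N (u + v + v) = cls N u" "cls N (v + u) = cls N (u + v)"
      using d[OF uv(1)] d[OF uv(2)] by (auto simp: cls_eq[OF N] algebra_simps)
    have z: "x \<in> N \<longleftrightarrow> cls N x = cls N 0" by (simp add: cls_0[OF N])
    show ?thesis unfolding * z
      using cov'[OF ab(1)] cov'[OF ab(2)] cov'[OF x] ** sums r by metis
  qed
  with k ab show ?thesis by (simp add: klein_def)
qed

lemma klein_list:
  assumes k: "klein N M a b" and c: "c - (a + b) \<in> N"
  shows "indep N [0, a, b, c]" "covers N M [0, a, b, c]" "set [0, a, b, c] \<subseteq> M"
proof -
  have N: "subgrp N" and M: "subgrp M" "N \<subseteq> M" and d: "2 * a \<in> N" "2 * b \<in> N"
    and ab: "a \<in> M" "b \<in> M" "a \<notin> N" "b \<notin> N" "a - b \<notin> N"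
    and cov: "\<And>x. x \<in> M \<Longrightarrow> x \<in> N \<or> x - a \<in> N \<or> x - b \<in> N \<or> x - (a + b) \<in> N"
    using k by (auto simp: klein_def)
  have cs: "cls N c = cls N (a + b)" using c by (simp add: cls_eq[OF N])
  have "c - (a + b) + (a + b) \<in> M" using c M ab by (blast intro: subgrp_closed)
  then show "set [0, a, b, c] \<subseteq> M" using ab subgrp_0[OF M(1)] by simp
  have "a + b \<in> N \<longleftrightarrow> a - b \<in> N"
    using d(2) by (intro subgrp_shift[OF N]) simp
  then have "cls N 0 \<noteq> cls N (a + b)" using ab by (metis cls_0[OF N])
  moreover have "cls N a \<noteq> cls N (a + b)" "cls N b \<noteq> cls N (a + b)"
    using ab by (auto simp: cls_eq[OF N] subgrp_uminus_iff[OF N])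
  moreover have "cls N 0 \<noteq> cls N a" "cls N 0 \<noteq> cls N b" "cls N a \<noteq> cls N b"
    using ab by (auto simp: cls_eq[OF N] subgrp_uminus_iff[OF N])
  ultimately show "indep N [0, a, b, c]" unfolding indep_def using cs by auto
  have "x - c \<in> N" if "x - (a + b) \<in> N" for x
    using that cs by (metis cls_eq[OF N])
  then show "covers N M [0, a, b, c]" using cov unfolding covers_def by auto
qed

text \<open>Over the identity class of \<open>V / M\<close> lie 0 and the \<open>n\<close>s, over
  any other class one entry of \<open>b\<close> and its three shifts by \<open>u\<close>,
  \<open>v\<close>, \<open>w\<close>. The separate cycles \<open>[n1, n2, n3]\<close>,
  \<open>b\<close> and \<open>passes u v w b\<close> therefore have the correct labels and sums in
  total; what remains is to find one cycle with the same labels and sums, and only classes modulo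
  \<open>N\<close> matter for that.\<close>

lemma sharp_klein_lift:
  assumes nk: "klein N M n1 n2" "n3 - (n1 + n2) \<in> N" and wk: "klein N M u v" "w - (u + v) \<in> N"
    and b: "sharp M b"
    and labels: "mset (map (cls N) xs) = mset (map (cls N) ([n1, n2, n3] @ b @ passes u v w b))"
    and sums: "mset (map (cls N) (csums xs)) =
      mset (map (cls N) ([n1, n2, n3] @ csums b @ csums (passes u v w b)))"
  shows "sharp N xs"
proof -
  have N: "subgrp N" and M: "subgrp M" "N \<subseteq> M" and d: "\<And>x. x \<in> M \<Longrightarrow> 2 * x \<in> N" and uv: "u \<in> M" "v \<in> M"
    "u \<notin> N" "v \<notin> N" "u - v \<notin> N"
    using wk(1) by (auto simp: klein_def)
  have ob: "odd (length b)" "b \<noteq> []" using b by (auto simp: sharp_def)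
  note nl = klein_list[OF nk]
  note wl = klein_list[OF wk]
  have dw: "2 * w \<in> N" "2 * u \<in> N" "2 * v \<in> N" using d wl(3) by auto
  have c1: "cls N (u + v) = cls N w" "cls N (v + w) = cls N u" "cls N (w + u) = cls N v"
  proof -
    show 1: "cls N (u + v) = cls N w" using wk(2) by (simp add: cls_eq[OF N] subgrp_diff_commute[OF N])
    have "cls N (v + w) = cls N (v + (u + v))" using 1 by (intro cls_add[OF N]) auto
    also have "\<dots> = cls N u" using dw by (simp add: cls_eq[OF N] algebra_simps)
    finally show "cls N (v + w) = cls N u" .
    have "cls N (w + u) = cls N ((u + v) + u)" using 1 by (intro cls_add[OF N]) auto
    also have "\<dots> = cls N v" using dw by (simp add: cls_eq[OF N] algebra_simps)
    finally show "cls N (w + u) = cls N v" .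
  qed
  have wl': "indep N [0, u + v, v + w, w + u]" "set [0, u + v, v + w, w + u] \<subseteq> M"
  proof -
    have "indep N [0, u + v, v + w, w + u] = indep N [0, u, v, w]"
      by (rule indep_mset) (simp add: c1)
    then show "indep N [0, u + v, v + w, w + u]" using wl by simp
    show "set [0, u + v, v + w, w + u] \<subseteq> M" using wl(3) M by (auto intro: subgrp_add)
  qed
  have plus0: "(+) (0 :: 'a) = (\<lambda>x. x)" by (rule ext) simp
  have fib: "mset (fibres ((0, [0, n1, n2, n3]) # map (\<lambda>x. (x, [0, p, q, r])) B)) =
      add_mset 0 (mset ([n1, n2, n3] @ B)) + mset (fibres (map (\<lambda>x. (x, [p, q, r])) B))" for B :: "'a list" and p q r
    using mset_fibres_append[of "[(0, [0, n1, n2, n3])]" "map (\<lambda>x. (x, [0, p, q, r])) B"]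
    by (simp add: mset_fibres_Cons[of 0 _ B]) (simp add: fibres_def plus0)
  have i: "indep N (fibres ((0, [0, n1, n2, n3]) # map (\<lambda>x. (x, [0, p, q, r])) B))"
    if "indep M (0 # B)" "indep N [0, p, q, r]" "set [0, p, q, r] \<subseteq> M" for B p q r
    using that nl by (intro indep_fibres[OF N M]) (auto simp: comp_def)
  have "covers N UNIV (fibres ((0, [0, n1, n2, n3]) # map (\<lambda>x. (x, [0, u, v, w])) b))"
    using b nl(2) wl(2) by (intro covers_fibres[OF N M(1)]) (auto simp: comp_def sharp_def)
  moreover have L: "mset (map (cls N) (fibres ((0, [0, n1, n2, n3]) # map (\<lambda>x. (x, [0, u, v, w])) b))) =
      mset (map (cls N) (0 # xs))"
    using labels unfolding mset_map fib by (simp add: mset_passes)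
  ultimately have "covers N UNIV (0 # xs)" using covers_mset[OF N] by blast
  moreover have "indep N (0 # xs)"
    using i[of b u v w] L b wl indep_mset by (metis sharp_def)
  moreover have "indep N (0 # csums xs)"
  proof -
    have "mset (map (cls N) (fibres ((0, [0, n1, n2, n3]) # map (\<lambda>x. (x, [0, u + v, v + w, w + u])) (csums b)))) =
      mset (map (cls N) (0 # csums xs))"
      using sums unfolding mset_map fib by (simp add: mset_csums_passes[OF ob(1)])
    then show ?thesis
      using i[of "csums b" "u + v" "v + w" "w + u"] b wl' indep_mset by (metis sharp_def)
  qed
  moreover have "odd (length xs)"
  proof -
    have "length xs = length ([n1, n2, n3] @ b @ passes u v w b)"
      using labels by (metis size_mset length_map)
    then show ?thesis using ob by (simp add: passes_def)
  qed
  ultimately show ?thesis by (simp add: sharp_def)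
qed

lemma klein_complement:
  assumes k: "klein N M u v" and n: "n \<in> M" "n \<notin> N"
  obtains m where "klein N M m n" "(n - m) - (m + n) \<in> N"
proof -
  have N: "subgrp N" and d: "\<And>x. x \<in> M \<Longrightarrow> 2 * x \<in> N" and uv: "u \<in> M" "v \<in> M" "u \<notin> N" "v \<notin> N" "u - v \<notin> N"
    using k by (auto simp: klein_def)
  obtain m where m: "m \<in> M" "m \<notin> N" "m - n \<notin> N"
  proof (cases "u - n \<in> N")
    case True
    then have "v - n \<notin> N" using subgrp_diff[OF N, of "u - n" "v - n"] uv by auto
    then show ?thesis using that uv by blast
  next
    case False
    then show ?thesis using that uv by blast
  qed
  have "- (2 * m) \<in> N" using d[OF m(1)] by (rule subgrp_minus[OF N])
  then have "(n - m) - (m + n) \<in> N" by simp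
  then show thesis using that klein_basis[OF k m(1) n(1) m(2) n(2) m(3)] by blast
qed

text \<open>Merging creates an edge from \<open>s\<close> to \<open>s + w0\<close>, whose sum
  \<open>2 * s + w0\<close> has to serve as a nonzero label in \<open>M / N\<close>. At most one of
  the candidates \<open>u\<close>, \<open>v\<close> for \<open>w0\<close> fails, since
  \<open>u - v\<close> is not in \<open>N\<close>. The third label is chosen as an exact difference
  so that later identities hold without a congruence.\<close>

lemma klein_frame:
  assumes k: "klein N M u v" and s: "2 * s \<in> M"
  obtains w0 w1 n1 n3 where
    "klein N M w0 w1" "klein N M n1 (2 * s + w0)" "n3 - (n1 + (2 * s + w0)) \<in> N" "n3 = 2 * s + w0 - n1"
    "w0 \<in> M" "w1 \<in> M" "n1 \<in> M" "n3 \<in> M"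
proof -
  have N: "subgrp N" and M: "subgrp M" "N \<subseteq> M" and uv: "u \<in> M" "v \<in> M" "u \<notin> N" "v \<notin> N" "u - v \<notin> N"
    using k by (auto simp: klein_def)
  obtain w0 w1 where w: "w0 \<in> M" "w1 \<in> M" "w0 \<notin> N" "w1 \<notin> N" "w0 - w1 \<notin> N" "2 * s + w0 \<notin> N"
  proof (cases "2 * s + u \<in> N")
    case True
    then have "2 * s + v \<notin> N" using subgrp_diff[OF N, of "2 * s + u" "2 * s + v"] uv by auto
    moreover have "v - u \<notin> N" using uv subgrp_diff_commute[OF N] by blast
    ultimately show ?thesis using that[of v u] uv by blast
  next
    case False
    then show ?thesis using that[of u v] uv by blast
  qed
  have "2 * s + w0 \<in> M" using s w M by (blast intro: subgrp_closed)
  then obtain n1 where n: "klein N M n1 (2 * s + w0)" "(2 * s + w0 - n1) - (n1 + (2 * s + w0)) \<in> N"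
    using klein_complement[OF k _ w(6)] by blast
  have "n1 \<in> M" using n(1) by (simp add: klein_def)
  then show thesis using that[of w0 w1 n1 "2 * s + w0 - n1"] klein_basis[OF k w(1-5)] n w(1,2)
      subgrp_diff[OF M(1) \<open>2 * s + w0 \<in> M\<close>] by blast
qed

text \<open>The three lifts other than \<open>b\<close> of a cyclic arrangement \<open>b\<close> of the quotient form one cycle, and so do
  \<open>n1\<close>, \<open>n2\<close>, \<open>n3\<close>. The three cycles are merged by exchanging edges with the same set of sums.\<close>

lemma triple_sharp_klein:
  assumes k: "klein N M u v" and t: "triple_sharp M"
  shows "triple_sharp N"
proof -
  have N: "subgrp N" and M: "subgrp M" "N \<subseteq> M" and d: "\<And>x. x \<in> M \<Longrightarrow> 2 * x \<in> N"
    using k by (auto simp: klein_def)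
  obtain s t ys r where b0: "sharp M (s # t # ys @ [r])" "2 * s \<in> M" "r + s - t \<in> M"
    using t by (auto simp: triple_sharp_def)
  obtain w0 w1 n1 n3 where w: "klein N M w0 w1" and n: "klein N M n1 (2 * s + w0)"
      "n3 - (n1 + (2 * s + w0)) \<in> N" and n3: "n3 = 2 * s + w0 - n1" and
      inM: "w0 \<in> M" "w1 \<in> M" "n1 \<in> M" "n3 \<in> M"
    using klein_frame[OF k b0(2)] .
  define n2 where "n2 = 2 * s + w0"
  note n = n[folded n2_def] note n3 = n3[folded n2_def]
  have n2M: "n2 \<in> M" using n(1) by (simp add: klein_def)
  define w2 where "w2 = w0 + w1"
  \<comment> \<open>The entry \<open>t\<close> may be moved within its class modulo
    \<open>M\<close>. This choice makes the new edge from \<open>n1\<close> to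
    \<open>t' + w1\<close> have the sum \<open>r + s\<close> of the removed closing edge of
    \<open>b\<close>.\<close>
  define t' where "t' = r + s - n1 - w1"
  define b where "b = s # t' # ys @ [r]"
  have "t' - t = (r + s - t) - n1 - w1" by (simp add: t'_def)
  also have "\<dots> \<in> M" using b0 inM M by (blast intro: subgrp_closed)
  finally have "cls M t = cls M t'" by (simp add: cls_eq[OF M(1)] subgrp_diff_commute[OF M(1)])
  then have b: "sharp M b" using b0(1) by (intro sharp_cong[OF M(1) _ b0(1)]) (simp add: b_def)
  define T where "T = (t' + w1) # alternate w0 w1 (ys @ [r]) @ alternate w1 w2 b @ alternate w2 w0 b"
  have P: "passes w0 w1 w2 b = (s + w0) # T" by (simp add: passes_def T_def b_def)
  \<comment> \<open>Removed are the edges between \<open>n1\<close> and \<open>n3\<close>, between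
    \<open>r\<close> and \<open>s\<close>, and between the first two entries of
    \<open>passes\<close>. The new edges join \<open>n1\<close> to \<open>t' + w1\<close>,
    \<open>s + w0\<close> to \<open>s\<close>, and \<open>r\<close> to \<open>n3\<close>; their sums
    are \<open>r + s\<close>, \<open>n2\<close> and the lost sum in \<open>passes\<close>.\<close>
  define xs where "xs = n2 # n1 # (T @ [s + w0] @ b) @ [n3]"
  have T: "T \<noteq> []" "hd T = t' + w1" by (auto simp: T_def)
  have cP: "csums (passes w0 w1 w2 b) = (s + w0 + (t' + w1)) # psums (T @ [s + w0])"
    unfolding P csums_def by (simp add: T_def)
  have b': "b \<noteq> []" "last b = r" "hd b = s" by (auto simp: b_def)
  have "csums xs = psums ([n2, n1] @ (T @ [s + w0]) @ b @ [n3, n2])" by (simp add: csums_def xs_def)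
  also have "\<dots> = [n2 + n1, n1 + (t' + w1)] @ psums (T @ [s + w0]) @ [s + w0 + s] @ psums b @ [r + n3, n3 + n2]"
    using T b' psums_append[of "[n2, n1]" "(T @ [s + w0]) @ b @ [n3, n2]"]
      psums_append[of "[s + w0]" "b @ [n3, n2]"] by (simp add: psums_append)
  also have "mset \<dots> = mset ([n2 + n1, n2, n3 + n2] @ csums b @ csums (passes w0 w1 w2 b))"
  proof -
    have "n1 + (t' + w1) = r + s" "s + w0 + s = n2" "r + n3 = s + w0 + (t' + w1)"
      by (auto simp: t'_def n2_def n3 algebra_simps)
    then show ?thesis using b' by (simp add: cP csums_psums)
  qed
  finally have sums: "mset (csums xs) = mset ([n2 + n1, n2, n3 + n2] @ csums b @ csums (passes w0 w1 w2 b))" .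
  have dn: "2 * n1 \<in> N" "2 * n2 \<in> N" using d inM n2M by auto
  have c: "cls N (n2 + n1) = cls N n3" "cls N (n3 + n2) = cls N n1"
    using dn subgrp_diff[OF N dn(2,1)] by (auto simp: cls_eq[OF N] n3 algebra_simps)
  have "sharp N xs"
  proof (rule sharp_klein_lift[OF n w _ b])
    show "w2 - (w0 + w1) \<in> N" using subgrp_0[OF N] by (simp add: w2_def)
    show "mset (map (cls N) xs) = mset (map (cls N) ([n1, n2, n3] @ b @ passes w0 w1 w2 b))"
      by (simp add: P xs_def)
    show "mset (map (cls N) (csums xs)) =
        mset (map (cls N) ([n1, n2, n3] @ csums b @ csums (passes w0 w1 w2 b)))"
      unfolding mset_map sums by (simp add: c)
  qed
  \<comment> \<open>The distinguished triple of the merged cycle is \<open>n3\<close>,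
    \<open>n2\<close>, \<open>n1\<close>, which lies in \<open>M\<close>.\<close>
  moreover have "n3 + n2 - n1 \<in> N" using c(2) by (simp add: cls_eq[OF N])
  ultimately show ?thesis unfolding triple_sharp_def xs_def using dn(2) by blast
qed

text \<open>Here \<open>b\<close> is cut twice, between \<open>x\<close> and \<open>y\<close> and
  between \<open>p'\<close> and \<open>q'\<close>, while \<open>passes\<close> is cut at its closing
  edge. The merged cycle contains \<open>n3\<close>, \<open>n2\<close>, \<open>n1\<close> in a row,
  so one extension already leads back to the triple condition.\<close>

lemma edge_sharp_klein:
  assumes k: "klein N M u v" and t: "edge_sharp M"
  shows "triple_sharp N"
proof -
  have N: "subgrp N" and M: "subgrp M" "N \<subseteq> M" and d: "\<And>x. x \<in> M \<Longrightarrow> 2 * x \<in> N"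
    using k by (auto simp: klein_def)
  obtain x y ys p q qs z where b0: "sharp M (x # y # ys @ p # q # qs @ [z])" "2 * x \<in> M"
    "p - (x + z) \<in> M" "q - (x + y) \<in> M"
    using t by (auto simp: edge_sharp_def)
  obtain w0 w1 n1 n3 where w: "klein N M w0 w1" and n: "klein N M n1 (2 * x + w0)"
      "n3 - (n1 + (2 * x + w0)) \<in> N" and n3: "n3 = 2 * x + w0 - n1" and
      inM: "w0 \<in> M" "w1 \<in> M" "n1 \<in> M" "n3 \<in> M"
    using klein_frame[OF k b0(2)] .
  define n2 where "n2 = 2 * x + w0"
  note n = n[folded n2_def] note n3 = n3[folded n2_def]
  have n2M: "n2 \<in> M" using n(1) by (simp add: klein_def)
  define w2 where "w2 = w0 + w1"
  \<comment> \<open>\<open>p'\<close> and \<open>q'\<close> stay in the classes of \<open>p\<close>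
    and \<open>q\<close> modulo \<open>M\<close>. They are solved from the requirements that the new
    edges from \<open>p'\<close> to \<open>n3\<close> and from \<open>n1\<close> to
    \<open>q'\<close> repeat the sums of the closing edge of \<open>passes\<close> and of the edge
    from \<open>x\<close> to \<open>y\<close>; the edge from \<open>z + w2\<close> to
    \<open>y\<close> then has the sum \<open>p' + q'\<close>.\<close>
  define p' where "p' = z + x + w0 + w2 - n3"
  define q' where "q' = x + y - n1"
  define b where "b = x # y # ys @ p' # q' # qs @ [z]"
  have "p' - p = w0 + w2 - n3 - (p - (x + z))" by (simp add: p'_def)
  also have "\<dots> \<in> M" using b0 inM M unfolding w2_def by (meson subgrp_add subgrp_diff)
  finally have "cls M p = cls M p'" by (simp add: cls_eq[OF M(1)] subgrp_diff_commute[OF M(1)])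
  moreover have "q - q' = q - (x + y) + n1" by (simp add: q'_def)
  then have "cls M q = cls M q'" using b0 inM M by (metis cls_eq subgrp_add)
  ultimately have b: "sharp M b" using b0(1) by (intro sharp_cong[OF M(1) _ b0(1)]) (simp add: b_def)
  define P where "P = passes w0 w1 w2 b"
  have ob: "odd (length b)" using b by (simp add: sharp_def)
  have b': "b \<noteq> []" "last b = z" "hd b = x" by (auto simp: b_def)
  have P: "P \<noteq> []" "hd P = x + w0" "last P = z + w2"
    using b' ob by (auto simp: P_def passes_def hd_alternate last_alternate)
  define xs where "xs = n2 # n1 # ((q' # qs @ [z]) @ [x] @ P @ (y # ys @ [p'])) @ [n3]"
  have cb: "csums b = [x + y] @ psums (y # ys @ [p']) @ [p' + q'] @ psums (q' # qs @ [z]) @ [z + x]"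
    using psums_append[of "[x]" "(y # ys @ [p']) @ (q' # qs @ [z])"] psums_append[of "y # ys @ [p']" "q' # qs @ [z]"]
    by (simp add: csums_psums b_def)
  have "csums xs = psums ([n2, n1] @ (q' # qs @ [z]) @ [x] @ P @ (y # ys @ [p']) @ [n3, n2])"
    by (simp add: csums_def xs_def)
  also have "\<dots> = [n2 + n1, n1 + q'] @ psums (q' # qs @ [z]) @ [z + x] @ [x + (x + w0)] @ psums P @
      [z + w2 + y] @ psums (y # ys @ [p']) @ [p' + n3, n3 + n2]"
    using P psums_append[of "[n2, n1]" "(q' # qs @ [z]) @ [x] @ P @ (y # ys @ [p']) @ [n3, n2]"]
      psums_append[of "q' # qs @ [z]" "[x] @ P @ (y # ys @ [p']) @ [n3, n2]"]
      psums_append[of "[x]" "P @ (y # ys @ [p']) @ [n3, n2]"]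
      psums_append[of "P" "(y # ys @ [p']) @ [n3, n2]"]
      psums_append[of "y # ys @ [p']" "[n3, n2]"]
    by simp
  also have "mset \<dots> = mset ([n2 + n1, n2, n3 + n2] @ csums b @ csums P)"
  proof -
    have "n1 + q' = x + y" "x + (x + w0) = n2" "z + w2 + y = p' + q'" "p' + n3 = z + w2 + (x + w0)"
      by (auto simp: p'_def q'_def n2_def n3 algebra_simps)
    then show ?thesis using P by (simp add: cb csums_psums)
  qed
  finally have sums: "mset (csums xs) = mset ([n2 + n1, n2, n3 + n2] @ csums b @ csums P)" .
  have dn: "2 * n1 \<in> N" "2 * n2 \<in> N" using d inM n2M by auto
  have c: "cls N (n2 + n1) = cls N n3" "cls N (n3 + n2) = cls N n1"
    using dn subgrp_diff[OF N dn(2,1)] by (auto simp: cls_eq[OF N] n3 algebra_simps)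
  have "sharp N xs"
  proof (rule sharp_klein_lift[OF n w _ b])
    show "w2 - (w0 + w1) \<in> N" using subgrp_0[OF N] by (simp add: w2_def)
    show "mset (map (cls N) xs) = mset (map (cls N) ([n1, n2, n3] @ b @ passes w0 w1 w2 b))"
      by (simp add: P_def xs_def b_def)
    show "mset (map (cls N) (csums xs)) =
        mset (map (cls N) ([n1, n2, n3] @ csums b @ csums (passes w0 w1 w2 b)))"
      unfolding mset_map P_def[symmetric] sums by (simp add: c)
  qed
  moreover have "n3 + n2 - n1 \<in> N" using c(2) by (simp add: cls_eq[OF N])
  ultimately show ?thesis unfolding triple_sharp_def xs_def using dn(2) by blast
qed

subsection \<open>From cycles to paths\<close>

text \<open>\<open>x\<close> is the element that is not used as a label of the path.\<close>

definition path_sharp :: "'v::comm_ring_1 set \<Rightarrow> bool" where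
  "path_sharp L \<longleftrightarrow> (\<exists>x xs. xs \<noteq> [] \<and> indep L (x # xs) \<and> covers L UNIV (x # xs) \<and>
     indep L (hd xs # psums xs @ [last xs]))"

lemma sharp_rotate: assumes "xs \<noteq> []" "subgrp N" "sharp N (xs @ [r])" shows "sharp N (r # xs)"
proof -
  have "mset (csums (r # xs)) = mset (csums (xs @ [r]))"
    using assms(1) psums_append[of "[r]" "xs @ [r]"] by (simp add: csums_psums csums_def psums_append)
  then have "indep N (0 # csums (r # xs)) \<longleftrightarrow> indep N (0 # csums (xs @ [r]))"
    by (intro indep_mset) (simp add: mset_map)
  moreover have "indep N (0 # r # xs) \<longleftrightarrow> indep N (0 # xs @ [r])"
    by (intro indep_mset) simp
  moreover have "covers N UNIV (0 # r # xs)"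
    by (rule covers_mset[OF assms(2), of "0 # xs @ [r]"]) (use assms(3) in \<open>auto simp: sharp_def\<close>)
  ultimately show ?thesis using assms(3) by (simp add: sharp_def)
qed

text \<open>The cycle \<open>us\<close> over the identity class of \<open>V / K\<close> and the
  cycle \<open>blocks b us\<close> over the other classes together use every class modulo
  \<open>L\<close> once as a label and once as a sum. A path that omits one label has one vertex for
  each of these sums, so it suffices that its vertex sums reproduce them.\<close>

lemma path_sharpI:
  assumes L: "subgrp L" and K: "subgrp K" "L \<subseteq> K" "odd_torsion L K" and us: "harmonious L K us"
    and b: "sharp K b" and xs: "xs \<noteq> []"
    and labels: "mset (x # xs) = mset (us @ blocks b us)"
    and sums: "mset (map (cls L) (hd xs # psums xs @ [last xs])) = mset (map (cls L) (csums us @ csums (blocks b us)))"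
  shows "path_sharp L"
proof -
  have us': "us \<noteq> []" "set us \<subseteq> K" "indep L us" "indep L (csums us)" "covers L K us"
    using us by (auto simp: harmonious_def)
  have b': "b \<noteq> []" "indep K (0 # b)" "indep K (0 # csums b)" "covers K UNIV (0 # b)"
    using b by (auto simp: sharp_def)
  have plus0: "(+) (0 :: 'a) = (\<lambda>x. x)" by (rule ext) simp
  have cs: "set (csums us) \<subseteq> K" using us' set_csums[OF K(1)] by blast
  have "indep L (fibres ((0, us) # map (\<lambda>x. (x, us)) b))"
    using us' b' by (intro indep_fibres[OF L K(1,2)]) (auto simp: comp_def)
  moreover have "covers L UNIV (fibres ((0, us) # map (\<lambda>x. (x, us)) b))"
    using us' b' by (intro covers_fibres[OF L K(1)]) (auto simp: comp_def)
  moreover have "mset (fibres ((0, us) # map (\<lambda>x. (x, us)) b)) = mset (x # xs)"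
    unfolding labels using mset_fibres_append[of "[(0, us)]" "map (\<lambda>x. (x, us)) b"]
    by (simp add: mset_blocks) (simp add: fibres_def plus0)
  ultimately have "indep L (x # xs)" "covers L UNIV (x # xs)"
    using indep_mset covers_mset[OF L] by (metis mset_map)+
  moreover have "indep L (hd xs # psums xs @ [last xs])"
  proof -
    let ?F = "(0, csums us) # map (\<lambda>x. (x, map ((*) 2) us)) (psums b) @ [(last b + hd b, csums us)]"
    have "indep L (fibres ?F)"
    proof (intro indep_fibres[OF L K(1,2)])
      show "indep K (map fst ?F)" using b' by (simp add: csums_psums comp_def)
      have "set (map ((*) 2) us) \<subseteq> K" using us'(2) subgrp_numeral[OF K(1)] by auto
      moreover have "indep L (map ((*) 2) us)" using us' indep_double[OF L K(1,3)] by blast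
      ultimately show "set vs \<subseteq> K \<and> indep L vs" if "(x, vs) \<in> set ?F" for x vs
        using that cs us' by auto
    qed
    moreover have "mset (fibres ?F) = mset (csums us @ csums (blocks b us))"
      using mset_fibres_append[of "[(0, csums us)]" "map (\<lambda>x. (x, map ((*) 2) us)) (psums b) @ [(last b + hd b, csums us)]"]
      by (simp add: mset_csums_blocks[OF b'(1) us'(1)]) (simp add: fibres_def plus0)
    ultimately show ?thesis using sums indep_mset by (metis mset_map)
  qed
  ultimately show ?thesis using xs unfolding path_sharp_def by blast
qed

text \<open>An element that is an involution only modulo \<open>K\<close> is corrected by half of
  its double, and halves exist in \<open>K / L\<close>.\<close>

lemma odd_torsion_exact:
  assumes "subgrp L" "subgrp K" "odd_torsion L K" "2 * s \<in> K"
  obtains s' where "s' - s \<in> K" "2 * s' \<in> L"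
proof -
  obtain y where y: "y \<in> K" "2 * y - 2 * s \<in> L"
    using odd_torsion_half[OF assms] by blast
  then have "- y \<in> K" "- (2 * y - 2 * s) \<in> L" using assms subgrp_minus by blast+
  then show thesis using that[of "s - y"] by (simp add: algebra_simps)
qed

text \<open>Without \<open>s'\<close> the sums \<open>t'\<close> and, modulo \<open>L\<close>,
  \<open>r\<close> are missing. Cutting \<open>us\<close> between its last entry and 0 and gluing 0
  to \<open>t'\<close> produces the sum \<open>t'\<close>; the free end at \<open>r\<close> has sum
  \<open>r\<close>; and the end at \<open>last us\<close> restores the closing sum of
  \<open>us\<close>.\<close>

lemma path_sharp_triple:
  assumes L: "subgrp L" and K: "subgrp K" "L \<subseteq> K" "odd_torsion L K" and us: "harmonious L K us"
    and t: "triple_sharp K"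
  shows "path_sharp L"
proof -
  obtain s t ys r where b0: "sharp K (s # t # ys @ [r])" "2 * s \<in> K" "r + s - t \<in> K"
    using t by (auto simp: triple_sharp_def)
  obtain s' where s': "s' - s \<in> K" "2 * s' \<in> L" using odd_torsion_exact[OF L K(1,3) b0(2)] .
  define t' where "t' = r + s'"
  define b where "b = r # s' # t' # ys"
  have "t' - t = (r + s - t) + (s' - s)" by (simp add: t'_def)
  then have "t' - t \<in> K" using b0(3) s'(1) subgrp_add[OF K(1)] by metis
  then have "cls K t = cls K t'" "cls K s = cls K s'"
    using s'(1) by (auto simp: cls_eq[OF K(1)] intro: subgrp_diff_commute[OF K(1), THEN iffD1])
  then have "sharp K ((s' # t' # ys) @ [r])" by (intro sharp_cong[OF K(1) _ b0(1)]) simp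
  then have b: "sharp K b" unfolding b_def by (intro sharp_rotate[OF _ K(1)]) simp
  obtain us2 where us2: "us = 0 # us2" using us by (cases us) (auto simp: harmonious_def)
  define R where "R = blocks b us2"
  have plus0: "(+) (0 :: 'a) = (\<lambda>x. x)" by (rule ext) simp
  have D: "blocks b us = r # s' # t' # ys @ R" by (simp add: us2 blocks_Cons R_def plus0 b_def)
  have usn: "us \<noteq> []" "hd us = 0" by (auto simp: us2)
  define xs where "xs = rev us @ (t' # ys @ R @ [r])"
  show ?thesis
  proof (rule path_sharpI[OF L K us b])
    show "xs \<noteq> []" by (simp add: xs_def)
    show "mset (s' # xs) = mset (us @ blocks b us)" by (simp add: D xs_def)
    have "psums xs = rev (psums us) @ [t'] @ psums (t' # ys @ R @ [r])"
      using psums_append[of "rev us" "t' # ys @ R @ [r]"] usn by (simp add: xs_def psums_rev last_rev)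
    moreover have "hd xs = last us" "last xs = r" by (auto simp: xs_def us2 hd_append hd_rev)
    ultimately have 1: "mset (hd xs # psums xs @ [last xs]) = {#last us, t', r#} + mset (psums us) + mset (psums (t' # ys @ R @ [r]))"
      by simp
    have 2: "mset (csums us @ csums (blocks b us)) =
      {#last us, r + s', s' + t'#} + mset (psums us) + mset (psums (t' # ys @ R @ [r]))"
      using csums_psums[OF usn(1)] usn(2) by (simp add: D) (simp add: csums_def)
    have "cls L (s' + t') = cls L r" using s'(2) by (simp add: cls_eq[OF L] t'_def algebra_simps)
    then show "mset (map (cls L) (hd xs # psums xs @ [last xs])) = mset (map (cls L) (csums us @ csums (blocks b us)))"
      unfolding mset_map 1 2 by (simp add: t'_def)
  qed
qed

text \<open>Without \<open>x'\<close> the sums \<open>p'\<close> and \<open>q'\<close> are missing.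
  The edge between \<open>p'\<close> and \<open>q'\<close> is cut as well, and its sum is regained
  modulo \<open>L\<close> by joining \<open>z\<close> to \<open>y\<close>. Then \<open>q'\<close> is
  an end of the path, \<open>p'\<close> is glued to the entry 0 of \<open>us\<close>, and
  \<open>last us\<close> is the other end.\<close>

lemma path_sharp_edge:
  assumes L: "subgrp L" and K: "subgrp K" "L \<subseteq> K" "odd_torsion L K" and us: "harmonious L K us"
    and t: "edge_sharp K"
  shows "path_sharp L"
proof -
  obtain x y ys p q qs z where b0: "sharp K (x # y # ys @ p # q # qs @ [z])" "2 * x \<in> K"
    "p - (x + z) \<in> K" "q - (x + y) \<in> K"
    using t by (auto simp: edge_sharp_def)
  obtain x' where x': "x' - x \<in> K" "2 * x' \<in> L" using odd_torsion_exact[OF L K(1,3) b0(2)] .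
  define p' where "p' = x' + z"
  define q' where "q' = x' + y"
  define b where "b = z # x' # y # ys @ p' # q' # qs"
  have "p - p' = p - (x + z) - (x' - x)" "q - q' = q - (x + y) - (x' - x)" by (simp_all add: p'_def q'_def)
  then have "p - p' \<in> K" "q - q' \<in> K" using b0(3,4) x'(1) subgrp_diff[OF K(1)] by metis+
  then have "cls K p = cls K p'" "cls K q = cls K q'" "cls K x = cls K x'"
    using x'(1) by (auto simp: cls_eq[OF K(1)] intro: subgrp_diff_commute[OF K(1), THEN iffD1])
  then have "sharp K ((x' # y # ys @ p' # q' # qs) @ [z])" by (intro sharp_cong[OF K(1) _ b0(1)]) simp
  then have b: "sharp K b" unfolding b_def by (intro sharp_rotate[OF _ K(1)]) simp
  obtain us2 where us2: "us = 0 # us2" using us by (cases us) (auto simp: harmonious_def)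
  define R where "R = blocks b us2"
  have plus0: "(+) (0 :: 'a) = (\<lambda>x. x)" by (rule ext) simp
  have D: "blocks b us = z # x' # y # ys @ p' # q' # qs @ R" by (simp add: us2 blocks_Cons R_def plus0 b_def)
  define xs where "xs = (q' # qs @ R @ [z]) @ (y # ys @ [p']) @ us"
  show ?thesis
  proof (rule path_sharpI[OF L K us b])
    show "xs \<noteq> []" by (simp add: xs_def)
    show "mset (x' # xs) = mset (us @ blocks b us)" by (simp add: D xs_def)
    have "psums xs = psums (q' # qs @ R @ [z]) @ [z + y] @ psums (y # ys @ [p']) @ [p'] @ psums us"
      using psums_append[of "q' # qs @ R @ [z]" "(y # ys @ [p']) @ us"] psums_append[of "y # ys @ [p']" us]
      by (simp add: xs_def us2)
    moreover have "hd xs = q'" "last xs = last us" by (auto simp: xs_def us2)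
    ultimately have 1: "mset (hd xs # psums xs @ [last xs]) =
      {#last us, q', p', z + y#} + mset (psums us) + mset (psums (y # ys @ [p'])) + mset (psums (q' # qs @ R @ [z]))"
      by simp
    have "csums (blocks b us) = [z + x', x' + y] @ psums (y # ys @ [p']) @ [p' + q'] @ psums (q' # qs @ R @ [z])"
      using psums_append[of "y # ys @ [p']" "q' # qs @ R @ [z]"] by (simp add: D csums_def)
    then have 2: "mset (csums us @ csums (blocks b us)) =
      {#last us, x' + y, z + x', p' + q'#} + mset (psums us) + mset (psums (y # ys @ [p'])) + mset (psums (q' # qs @ R @ [z]))"
      using csums_psums[of us] us2 by simp
    have "cls L (p' + q') = cls L (z + y)"
      using x'(2) by (simp add: cls_eq[OF L] p'_def q'_def algebra_simps)
    then show "mset (map (cls L) (hd xs # psums xs @ [last xs])) = mset (map (cls L) (csums us @ csums (blocks b us)))"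
      unfolding mset_map 1 2 by (simp add: p'_def q'_def add.commute)
  qed
qed

text \<open>The two sums at the entry 0 of a harmonious cycle are the labels of its neighbours. When
  0 is omitted, the neighbours become the ends of a path and keep these sums.\<close>

lemma path_sharp_odd:
  assumes L: "subgrp L" "L \<noteq> UNIV" and us: "harmonious L UNIV us"
  shows "path_sharp L"
proof -
  obtain us2 where us2: "us = 0 # us2" using us by (cases us) (auto simp: harmonious_def)
  have us': "indep L us" "indep L (csums us)" "covers L UNIV us" using us by (auto simp: harmonious_def)
  have "us2 \<noteq> []"
    using us'(3) L(2) by (auto simp: us2 covers_def)
  moreover have "csums us = hd us2 # psums us2 @ [last us2]"
    using calculation psums_append[of "[0]" us2] by (simp add: csums_psums us2)
  ultimately show ?thesis using us' unfolding path_sharp_def us2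
    by (intro exI[of _ 0] exI[of _ us2]) simp
qed

subsection \<open>Base cases\<close>

lemma triple_sharp_base_klein:
  assumes k: "klein N UNIV u v" shows "triple_sharp N"
proof -
  have N: "subgrp N" and d: "\<And>x. 2 * x \<in> N" using k by (auto simp: klein_def)
  note l = klein_list[OF k, of "u + v"]
  have c: "cls N (u + (u + v)) = cls N v" "cls N (u + v + v) = cls N u"
    using d[of u] d[of v] by (auto simp: cls_eq[OF N] algebra_simps)
  have "sharp N [u, v, u + v]"
  proof -
    have "mset (map (cls N) (0 # csums [u, v, u + v])) = mset (map (cls N) [0, u, v, u + v])"
      using c by (simp add: csums_def add.commute)
    then have "indep N (0 # csums [u, v, u + v])"
      using l(1) subgrp_0[OF N] indep_mset by fastforce
    then show ?thesis using l(1,2) subgrp_0[OF N] by (simp add: sharp_def)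
  qed
  then have "sharp N (u # v # [] @ [u + v])" by simp
  moreover have "u + v + u - v \<in> N" using d[of u] by (simp add: algebra_simps)
  ultimately show ?thesis unfolding triple_sharp_def using d[of u] by blast
qed

text \<open>One cycle serves both noncyclic groups of order 8 with a fitting basis:
  \<open>2 * w\<close> is 0 in the elementary abelian group and \<open>v\<close> in Z_2 x Z_4. In
  the edge condition the roles of \<open>x\<close>, \<open>y\<close>, \<open>p\<close>,
  \<open>q\<close>, \<open>z\<close> are played by \<open>u + v\<close>, \<open>u + v + w\<close>,
  \<open>v\<close>, \<open>w\<close>, \<open>u\<close>.\<close>

lemma edge_sharp_base:
  assumes k: "klein N M u v" and w: "w \<notin> M" "2 * w \<in> M" "2 * w \<in> N \<or> 2 * w - v \<in> N"
    and cov: "\<And>x. x \<in> M \<or> x - w \<in> M"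
  shows "edge_sharp N"
proof -
  have N: "subgrp N" and M: "subgrp M" "N \<subseteq> M" and uv: "2 * u \<in> N" "2 * v \<in> N" "u \<in> M" "v \<in> M" using k by (auto simp: klein_def)
  note l = klein_list[OF k, of "u + v"]
  define b where "b = [u + v, u + v + w, v + w, u + w, v, w, u]"
  let ?F = "[(0, [0, u, v, u + v]), (w, [0, u, v, u + v])]"
  have F: "indep N (fibres ?F)"
    using l(1,3) subgrp_0[OF N] w(1) by (intro indep_fibres[OF N M])
      (auto simp: indep_Cons[OF M(1)] subgrp_uminus_iff[OF M(1)])
  have "covers M UNIV [0, w]" using cov by (auto simp: covers_def)
  then have C: "covers N UNIV (fibres ?F)"
    using l(2) subgrp_0[OF N] by (intro covers_fibres[OF N M(1)]) auto
  have "mset (fibres ?F) = mset (0 # b)" by (simp add: fibres_def b_def add_ac)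
  then have e: "mset (map (cls N) (fibres ?F)) = mset (map (cls N) (0 # b))" by (simp only: mset_map)
  then have 1: "indep N (0 # b)" "covers N UNIV (0 # b)"
    using F C indep_mset[OF e] covers_mset[OF N e] by blast+
  have 2: "csums b = [u + v + (u + v + w), u + v + w + (v + w), v + w + (u + w), u + w + v, v + w, w + u, u + (u + v)]"
    by (simp add: csums_def b_def)
  have c: "cls N (u + v + (u + v + w)) = cls N w" "cls N (u + (u + v)) = cls N v"
    using subgrp_add[OF N uv(1,2)] uv by (auto simp: cls_eq[OF N] algebra_simps)
  have "mset (map (cls N) (csums b)) = mset (map (cls N) b)"
    using w(3)
  proof
    assume "2 * w \<in> N"
    moreover have "u + v + w + (v + w) - u = 2 * v + 2 * w" "v + w + (u + w) - (u + v) = 2 * w"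
      by (auto simp: algebra_simps)
    ultimately have "cls N (u + v + w + (v + w)) = cls N u" "cls N (v + w + (u + w)) = cls N (u + v)"
      using subgrp_add[OF N uv(2)] by (metis cls_eq[OF N])+
    then show ?thesis unfolding 2 using c by (simp add: b_def add_ac)
  next
    assume *: "2 * w - v \<in> N"
    have "u + v + w + (v + w) - (u + v) = (2 * w - v) + 2 * v" "v + w + (u + w) - u = (2 * w - v) + 2 * v" by (auto simp: algebra_simps)
    then have "cls N (u + v + w + (v + w)) = cls N (u + v)" "cls N (v + w + (u + w)) = cls N u"
      using subgrp_add[OF N * uv(2)] by (metis cls_eq[OF N])+
    then show ?thesis unfolding 2 using c by (simp add: b_def add_ac)
  qed
  then have "indep N (0 # csums b)" using 1 by (subst indep_mset[of N _ "0 # b"]) auto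
  then have "sharp N b" using 1 by (simp add: sharp_def b_def)
  then have "sharp N ((u + v) # (u + v + w) # [v + w, u + w] @ v # w # [] @ [u])" by (simp add: b_def)
  moreover have "2 * (u + v) \<in> N" using subgrp_add[OF N uv(1,2)] by (simp add: algebra_simps)
  moreover have "v - (u + v + u) = - (2 * u)" "w - (u + v + (u + v + w)) = - (2 * u + 2 * v)" by (auto simp: algebra_simps)
  then have "v - (u + v + u) \<in> N" "w - (u + v + (u + v + w)) \<in> N"
    using uv N by (metis subgrp_minus subgrp_add)+
  ultimately show ?thesis unfolding edge_sharp_def by blast
qed

text \<open>Pigeonhole: a list that meets all classes and is no longer than an independent list has
  no room for repetitions. It reduces the verification of an explicit cycle to membership.\<close>

lemma indep_of_covers:
  assumes N: "subgrp N" and zs: "indep N zs" and ys: "covers N UNIV ys" "length ys \<le> length zs"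
  shows "indep N ys"
proof -
  have "cls N ` set zs \<subseteq> cls N ` set ys"
    using ys(1) cls_eq[OF N] unfolding covers_def by (fastforce simp: image_iff)
  then have "card (set (map (cls N) zs)) \<le> card (set (map (cls N) ys))"
    by (intro card_mono) auto
  moreover have "card (set (map (cls N) zs)) = length zs"
    using zs distinct_card[of "map (cls N) zs"] by (simp add: indep_def)
  moreover have "card (set (map (cls N) ys)) \<le> length ys" using card_length[of "map (cls N) ys"] by simp
  ultimately have "card (set (map (cls N) ys)) = length (map (cls N) ys)" using ys(2) by simp
  then show ?thesis unfolding indep_def by (rule card_distinct)
qed

section \<open>Zigzags through two arithmetic progressions\<close>

definition zigzag :: "(int \<Rightarrow> 'b) \<Rightarrow> int \<Rightarrow> (int \<Rightarrow> 'b) \<Rightarrow> int \<Rightarrow> int \<Rightarrow> nat \<Rightarrow> 'b list" where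
  "zigzag A a B b d n = map (\<lambda>j. if even j then A (a + d * int (j div 2)) else B (b + d * int (j div 2))) [0..<n]"

definition progression :: "(int \<Rightarrow> 'b) \<Rightarrow> int \<Rightarrow> int \<Rightarrow> nat \<Rightarrow> 'b list" where
  "progression C a d n = map (\<lambda>j. C (a + d * int j)) [0..<n]"

text \<open>Each step of a zigzag advances just one of the two indices by \<open>d\<close>, so the
  index of the adjacent sum advances by \<open>d\<close> as well.\<close>

lemma psums_zigzag:
  assumes "\<And>i j. A i + B j = C (i + j)"
  shows "psums (zigzag A a B b d n) = progression C (a + b) d (n - 1)"
proof -
  have 1: "int (j div 2) + int (Suc j div 2) = int j" for j by presburger
  have "(if even j then A (a + d * int (j div 2)) else B (b + d * int (j div 2))) +
    (if even (Suc j) then A (a + d * int (Suc j div 2)) else B (b + d * int (Suc j div 2))) = C (a + b + d * int j)" for j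
  proof (cases "even j")
    case True
    have "A (a + d * int (j div 2)) + B (b + d * int (Suc j div 2)) = C (a + b + d * (int (j div 2) + int (Suc j div 2)))"
      using assms[of "a + d * int (j div 2)" "b + d * int (Suc j div 2)"] by (simp add: algebra_simps)
    then show ?thesis using True unfolding 1 by simp
  next
    case False
    have "A (a + d * int (Suc j div 2)) + B (b + d * int (j div 2)) = C (a + b + d * (int (j div 2) + int (Suc j div 2)))"
      using assms[of "a + d * int (Suc j div 2)" "b + d * int (j div 2)"] by (simp add: algebra_simps)
    then show ?thesis using False unfolding 1 by (simp add: add.commute)
  qed
  then show ?thesis unfolding zigzag_def progression_def psums_map_upt by simp
qed

lemma length_zigzag [simp]: "length (zigzag A a B b d n) = n"
  by (simp add: zigzag_def)

lemma zigzag_eq_Nil [simp]: "zigzag A a B b d n = [] \<longleftrightarrow> n = 0"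
  by (simp add: zigzag_def)

lemma hd_zigzag [simp]: "n > 0 \<Longrightarrow> hd (zigzag A a B b d n) = A a"
  by (simp add: zigzag_def hd_map)

lemma last_zigzag_even [simp]: "m > 0 \<Longrightarrow> last (zigzag A a B b d (2 * m)) = B (b + d * (int m - 1))"
proof -
  assume m: "m > 0"
  have "(2 * m - 1) div 2 = m - 1" "odd (2 * m - 1)" using m by presburger+
  then show ?thesis using m by (simp add: zigzag_def last_map of_nat_diff)
qed

lemma last_zigzag_odd [simp]: "m > 0 \<Longrightarrow> last (zigzag A a B b d (2 * m - 1)) = A (a + d * (int m - 1))"
proof -
  assume m: "m > 0"
  have "(2 * m - 1 - 1) div 2 = m - 1" "even (2 * m - 1 - 1)" using m by presburger+
  then show ?thesis using m by (simp add: zigzag_def last_map of_nat_diff)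
qed

lemma zigzag_first:
  assumes "d = 1 \<or> d = -1" "0 \<le> d * (i - a)" "d * (i - a) < int ((n + 1) div 2)"
  shows "A i \<in> set (zigzag A a B b d n)"
proof -
  define j where "j = nat (d * (i - a))"
  have j: "int j = d * (i - a)" using assms(2) by (simp add: j_def)
  then have "2 * j < n" "a + d * int j = i" using assms(1,3) by auto
  then have "A i = (if even (2 * j) then A (a + d * int (2 * j div 2)) else B (b + d * int (2 * j div 2)))" by simp
  then show ?thesis unfolding zigzag_def using \<open>2 * j < n\<close> by (auto intro!: image_eqI[of _ _ "2 * j"])
qed

lemma zigzag_second:
  assumes "d = 1 \<or> d = -1" "0 \<le> d * (i - b)" "d * (i - b) < int (n div 2)"
  shows "B i \<in> set (zigzag A a B b d n)"
proof -
  define j where "j = nat (d * (i - b))"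
  have j: "int j = d * (i - b)" using assms(2) by (simp add: j_def)
  then have "2 * j + 1 < n" "b + d * int j = i" using assms(1,3) by auto
  then have "B i = (if even (2 * j + 1) then A (a + d * int ((2 * j + 1) div 2)) else B (b + d * int ((2 * j + 1) div 2)))" by simp
  then show ?thesis unfolding zigzag_def using \<open>2 * j + 1 < n\<close> by (auto intro!: image_eqI[of _ _ "2 * j + 1"])
qed

lemma progression_mem:
  assumes "d = 1 \<or> d = -1" "0 \<le> d * (i - a)" "d * (i - a) < int n"
  shows "C i \<in> set (progression C a d n)"
  using assms unfolding progression_def by (auto intro!: image_eqI[of _ _ "nat (d * (i - a))"])

text \<open>A computer search found this arrangement of \<open>Z\<^sub>2 \<times> Z\<^sub>8\<^sub>k\<close>. Both the labels and the sums
  decompose into arithmetic progressions that tile the two cosets of \<open>Z\<^sub>8\<^sub>k\<close>.\<close>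

lemma triple_sharp_base:
  fixes N :: "'v::comm_ring_1 set" and g t :: 'v and k :: nat
  assumes N: "subgrp N" and t: "2 * t \<in> N" and k: "k > 0"
    and g: "\<And>i. of_int i * g \<in> N \<longleftrightarrow> 8 * int k dvd i"
    and tg: "\<And>i. t - of_int i * g \<notin> N"
    and cov: "\<And>v. \<exists>i. v - of_int i * g \<in> N \<or> v - (t + of_int i * g) \<in> N"
  shows "triple_sharp N"
proof -
  define K where "K = int k"
  have K: "K \<ge> 1" using k by (simp add: K_def)
  \<comment> \<open>Zigzags of length \<open>2 * k\<close> use \<open>k\<close> indices on either
    side. The three of length \<open>no\<close> leave out the indices \<open>8 * K\<close>,
    \<open>2 * K\<close> and \<open>5 * K\<close> of \<open>px\<close>: the first is the identity,
    the other two are inserted as single entries.\<close>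
  define no where "no = 2 * k - 1"
  have no: "no > 0" "2 * k - 1 = no" "2 * k - Suc 0 = no" "Suc no div 2 = k" "no div 2 = k - 1" "int (k - 1) = K - 1" "int (k - Suc 0) = K - 1" "int no = 2 * K - 1"
    "int (no - 1) = 2 * K - 2" "int (no - Suc 0) = 2 * K - 2"
    using k by (auto simp: no_def K_def)
  have last_no: "last (zigzag A a B b d no) = A (a + d * (K - 1))" for A B :: "int \<Rightarrow> 'v" and a b d
    using last_zigzag_odd[OF k, of A a B b d] by (simp add: no_def K_def)
  define px where "px i = of_int i * g" for i :: int
  define py where "py i = t + of_int i * g" for i :: int
  \<comment> \<open>\<open>pz i\<close> and \<open>px i\<close> represent the same class; keeping
    them apart lets sums of two entries of the coset of \<open>t\<close> be computed as equations in
    the ring.\<close>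
  define pz where "pz i = 2 * t + of_int i * g" for i :: int
  have add: "px i + px j = px (i + j)" "px i + py j = py (i + j)" "py i + px j = py (i + j)" "py i + py j = pz (i + j)" for i j
    by (auto simp: px_def py_def pz_def algebra_simps)
  define xs where "xs = zigzag py (4*K) px (4*K) (-1) (2*k) @ zigzag px (3*K) py (7*K) (-1) (2*k) @
    zigzag py (6*K) px (8*K-1) (-1) (no) @ [px (5*K)] @ zigzag px (5*K+1) px (K+1) 1 (no) @
    zigzag py 1 py (4*K+1) 1 (2*k) @ zigzag px K py (3*K) (-1) (2*k) @ [px (2*K)] @
    zigzag px (6*K+1) px (4*K+1) 1 (no) @ zigzag py (K+1) py (7*K+1) 1 (2*k)"
  have cs: "csums xs =
    progression py (4*K + 4*K) (-1) no @ [px (6*K + 1)] @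
    progression py (3*K + 7*K) (-1) no @ [pz (12*K + 1)] @
    progression py (6*K + (8*K-1)) (-1) (no-1) @ [py (10*K+1), px (10*K+1)] @
    progression px (5*K+1 + (K+1)) 1 (no-1) @ [py (6*K+1)] @
    progression pz (1 + (4*K+1)) 1 no @ [py (6*K)] @
    progression py (K + 3*K) (-1) no @ [py (4*K+1), px (8*K+1)] @
    progression px (6*K+1 + (4*K+1)) 1 (no-1) @ [py (8*K+1)] @
    progression pz (K+1 + (7*K+1)) 1 no @ [pz (12*K)]"
  proof -
    note sums = psums_zigzag[where A=px and B=px and C=px, OF add(1)] psums_zigzag[where A=px and B=py and C=py, OF add(2)]
      psums_zigzag[where A=py and B=px and C=py, OF add(3)] psums_zigzag[where A=py and B=py and C=pz, OF add(4)]
    have c: "psums (x # ys) = (x + hd ys) # psums ys" if "ys \<noteq> []" for x :: 'v and ys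
      using that by (cases ys) auto
    show ?thesis unfolding csums_def xs_def
      using k no(1) by (simp add: psums_append c sums add K_def[symmetric] last_no no(2,3))
  qed
  define zs where "zs = map px (map int [0..<8*k]) @ map py (map int [0..<8*k])"
  have XN: "px i - px j \<in> N \<longleftrightarrow> 8 * K dvd i - j" for i j
    using g[of "i - j"] by (simp add: px_def K_def algebra_simps)
  have "indep N (map px (map int [0..<8*k]))"
  proof -
    have "map px (map int [0..<8*k]) = map (\<lambda>i. of_int i * g) (map int [0..<8*k])" by (simp add: px_def)
    moreover have "distinct (map (\<lambda>i. i mod (8 * int k)) (map int [0..<8*k]))"
    proof -
      have "map (\<lambda>i. i mod (8 * int k)) (map int [0..<8*k]) = map int [0..<8*k]"
        by (rule nth_equalityI) auto
      moreover have "distinct (map int [0..<8*k])" by (simp add: distinct_map)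
      ultimately show ?thesis by (simp only:)
    qed
    ultimately show ?thesis using indep_multiples[OF N g] by metis
  qed
  moreover have "indep N (map py (map int [0..<8*k]))"
  proof -
    have "map py is = map ((+) t) (map px is)" for "is"
      by (simp add: px_def py_def)
    moreover have "indep N (map ((+) t) ys) \<longleftrightarrow> indep N ys" for ys
      by (induction ys) (auto simp: indep_Cons[OF N])
    ultimately show ?thesis using \<open>indep N (map px (map int [0..<8*k]))\<close> by metis
  qed
  moreover have "px i - py j \<notin> N" for i j
  proof
    assume "px i - py j \<in> N"
    then have "- (px i - py j) \<in> N" by (rule subgrp_minus[OF N])
    then show False using tg[of "i - j"] by (simp add: px_def py_def algebra_simps)
  qed
  ultimately have zs: "indep N zs" unfolding zs_def by (auto simp: indep_append[OF N])
  have lzs: "length zs = 16 * k" by (simp add: zs_def)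
  \<comment> \<open>The index \<open>8 * K\<close> instead of 0 represents the class of
    \<open>t\<close>, because the tiles are the intervals from \<open>j * K + 1\<close> to
    \<open>(j + 1) * K\<close>. The index 0 of \<open>px\<close> is covered by the leading
    0.\<close>
  have tile: "covers N UNIV (0 # ys)"
    if x: "\<And>i. 1 \<le> i \<Longrightarrow> i < 8 * K \<Longrightarrow> cls N (px i) \<in> cls N ` set ys"
      and y: "\<And>i. 1 \<le> i \<Longrightarrow> i \<le> 8 * K \<Longrightarrow> cls N (py i) \<in> cls N ` set ys" for ys
    unfolding covers_def
  proof
    fix v
    have "cls N v \<in> insert (cls N 0) (cls N ` set ys)"
      using cov[of v]
    proof (elim exE disjE)
      fix i assume i: "v - of_int i * g \<in> N"
      have "8 * K dvd i - i mod (8 * K)" by (simp add: dvd_minus_mod)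
      then have "cls N v = cls N (px (i mod (8 * K)))" using i XN by (metis px_def cls_eq[OF N])
      moreover have "0 \<le> i mod (8 * K)" "i mod (8 * K) < 8 * K" using K by auto
      moreover have "px 0 = 0" by (simp add: px_def)
      ultimately show ?thesis using x[of "i mod (8 * K)"] by (cases "i mod (8 * K) = 0") auto
    next
      fix i assume i: "v - (t + of_int i * g) \<in> N"
      define r where "r = (if i mod (8 * K) = 0 then 8 * K else i mod (8 * K))"
      have "8 * K dvd i - i mod (8 * K)" by (simp add: dvd_minus_mod)
      then have "8 * K dvd i - r" by (auto simp: r_def mod_eq_0_iff_dvd)
      then have "px i - px r \<in> N" using XN by blast
      then have "v - py r \<in> N"
        using subgrp_add[OF N i, of "px i - px r"] by (simp add: px_def py_def algebra_simps)
      then have "cls N v = cls N (py r)" by (simp add: cls_eq[OF N])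
      moreover have "1 \<le> r" "r \<le> 8 * K"
      proof -
        define m where "m = i mod (8 * K)"
        have "0 \<le> m" "m < 8 * K" "r = (if m = 0 then 8 * K else m)" using K by (auto simp: r_def m_def)
        then show "1 \<le> r" "r \<le> 8 * K" using K by auto
      qed
      ultimately show ?thesis using y[of r] by auto
    qed
    then show "\<exists>x\<in>set (0 # ys). v - x \<in> N" using cls_eq[OF N] by auto
  qed
  have labels: "covers N UNIV (0 # xs)"
  proof (rule tile)
    fix i assume i: "1 \<le> i" "i < 8 * K"
    consider "1 \<le> i \<and> i \<le> K" | "K+1 \<le> i \<and> i \<le> 2*K-1" | "i = 2*K" | "2*K+1 \<le> i \<and> i \<le> 3*K" | "3*K+1 \<le> i \<and> i \<le> 4*K"
      | "4*K+1 \<le> i \<and> i \<le> 5*K-1" | "i = 5*K" | "5*K+1 \<le> i \<and> i \<le> 6*K" | "6*K+1 \<le> i \<and> i \<le> 7*K" | "7*K+1 \<le> i \<and> i \<le> 8*K-1"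
      using i by linarith
    then have "px i \<in> set xs"
      unfolding xs_def set_append Un_iff
      by cases (simp_all add: zigzag_first zigzag_second no K_def[symmetric])
    then show "cls N (px i) \<in> cls N ` set xs" by blast
  next
    fix i assume i: "1 \<le> i" "i \<le> 8 * K"
    consider "1 \<le> i \<and> i \<le> K" | "K+1 \<le> i \<and> i \<le> 2*K" | "2*K+1 \<le> i \<and> i \<le> 3*K" | "3*K+1 \<le> i \<and> i \<le> 4*K"
      | "4*K+1 \<le> i \<and> i \<le> 5*K" | "5*K+1 \<le> i \<and> i \<le> 6*K" | "6*K+1 \<le> i \<and> i \<le> 7*K" | "7*K+1 \<le> i \<and> i \<le> 8*K"
      using i by linarith
    then have "py i \<in> set xs"
      unfolding xs_def set_append Un_iff
      by cases (simp_all add: zigzag_first zigzag_second no K_def[symmetric])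
    then show "cls N (py i) \<in> cls N ` set xs" by blast
  qed
  have per: "cls N (px (i + 8 * K)) = cls N (px i)" "cls N (py (i + 8 * K)) = cls N (py i)" "cls N (pz i) = cls N (px i)" for i
  proof -
    have "of_int (8 * K) * g \<in> N" using g[of "8 * K"] by (simp add: K_def)
    then show "cls N (px (i + 8 * K)) = cls N (px i)" "cls N (py (i + 8 * K)) = cls N (py i)"
      by (auto simp: cls_eq[OF N] px_def py_def algebra_simps)
    show "cls N (pz i) = cls N (px i)" using t by (simp add: cls_eq[OF N] px_def pz_def)
  qed
  define S where "S = set (csums xs)"
  \<comment> \<open>The sums inside a zigzag form a progression; those listed in
    \<open>joints\<close> come from the transitions between segments and fill the gaps between the
    progressions.\<close>
  have sub: "set (progression py (4*K + 4*K) (-1) no) \<subseteq> S" "set (progression py (3*K + 7*K) (-1) no) \<subseteq> S"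
    "set (progression py (6*K + (8*K-1)) (-1) (no-1)) \<subseteq> S" "set (progression px (5*K+1 + (K+1)) 1 (no-1)) \<subseteq> S"
    "set (progression pz (1 + (4*K+1)) 1 no) \<subseteq> S" "set (progression py (K + 3*K) (-1) no) \<subseteq> S"
    "set (progression px (6*K+1 + (4*K+1)) 1 (no-1)) \<subseteq> S" "set (progression pz (K+1 + (7*K+1)) 1 no) \<subseteq> S"
    and joints: "{px (6*K + 1), pz (12*K + 1), py (10*K+1), px (10*K+1), py (6*K+1), py (6*K), py (4*K+1), px (8*K+1),
      py (8*K+1), pz (12*K)} \<subseteq> S"
    unfolding S_def cs by auto
  have sums: "covers N UNIV (0 # csums xs)"
  proof (rule tile, unfold S_def[symmetric])
    have memX: "cls N (px i) \<in> cls N ` S"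
      if "px i \<in> S \<or> px (i + 8 * K) \<in> S \<or> pz i \<in> S \<or> pz (i + 8 * K) \<in> S" for i
      using that per by (metis image_eqI)
    fix i assume i: "1 \<le> i" "i < 8 * K"
    consider "i = 1" | "2 \<le> i \<and> i \<le> 2*K" | "i = 2*K+1" | "2*K+2 \<le> i \<and> i \<le> 4*K-1" | "i = 4*K" | "i = 4*K+1"
      | "4*K+2 \<le> i \<and> i \<le> 6*K" | "i = 6*K+1" | "6*K+2 \<le> i \<and> i \<le> 8*K-1"
      using i by linarith
    then have "px i \<in> S \<or> px (i + 8 * K) \<in> S \<or> pz i \<in> S \<or> pz (i + 8 * K) \<in> S"
    proof cases
      case 1
      then have "px (i + 8 * K) = px (8 * K + 1)" by (simp add: add.commute)
      then show ?thesis using joints by auto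
    next
      case 2
      then have "pz (i + 8 * K) \<in> set (progression pz (K+1 + (7*K+1)) 1 no)" by (intro progression_mem) (auto simp: no)
      then show ?thesis using sub by blast
    next
      case 3
      then have "px (i + 8 * K) = px (10 * K + 1)" by (simp add: add.commute)
      then show ?thesis using joints by auto
    next
      case 4
      then have "px (i + 8 * K) \<in> set (progression px (6*K+1 + (4*K+1)) 1 (no-1))" by (intro progression_mem) (auto simp: no)
      then show ?thesis using sub by blast
    next
      case 5
      then have "pz (i + 8 * K) = pz (12 * K)" by (simp add: add.commute)
      then show ?thesis using joints by auto
    next
      case 6
      then have "pz (i + 8 * K) = pz (12 * K + 1)" by (simp add: add.commute)
      then show ?thesis using joints by auto
    next
      case 7
      then have "pz i \<in> set (progression pz (1 + (4*K+1)) 1 no)" by (intro progression_mem) (auto simp: no)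
      then show ?thesis using sub by blast
    next
      case 8
      then show ?thesis using joints by auto
    next
      case 9
      then have "px i \<in> set (progression px (5*K+1 + (K+1)) 1 (no-1))" by (intro progression_mem) (auto simp: no)
      then show ?thesis using sub by blast
    qed
    then show "cls N (px i) \<in> cls N ` S" by (rule memX)
  next
    have memY: "cls N (py i) \<in> cls N ` S" if "py i \<in> S \<or> py (i + 8 * K) \<in> S" for i
      using that per by (metis image_eqI)
    fix i assume i: "1 \<le> i" "i \<le> 8 * K"
    consider "i = 1" | "2 \<le> i \<and> i \<le> 2*K" | "i = 2*K+1" | "2*K+2 \<le> i \<and> i \<le> 4*K" | "i = 4*K+1"
      | "4*K+2 \<le> i \<and> i \<le> 6*K-1" | "i = 6*K" | "i = 6*K+1" | "6*K+2 \<le> i \<and> i \<le> 8*K"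
      using i by linarith
    then have "py i \<in> S \<or> py (i + 8 * K) \<in> S"
    proof cases
      case 1
      then have "py (i + 8 * K) = py (8 * K + 1)" by (simp add: add.commute)
      then show ?thesis using joints by auto
    next
      case 2
      then have "py (i + 8 * K) \<in> set (progression py (3*K + 7*K) (-1) no)" by (intro progression_mem) (auto simp: no)
      then show ?thesis using sub by blast
    next
      case 3
      then have "py (i + 8 * K) = py (10 * K + 1)" by (simp add: add.commute)
      then show ?thesis using joints by auto
    next
      case 4
      then have "py i \<in> set (progression py (K + 3*K) (-1) no)" by (intro progression_mem) (auto simp: no)
      then show ?thesis using sub by blast
    next
      case 6
      then have "py (i + 8 * K) \<in> set (progression py (6*K + (8*K-1)) (-1) (no-1))" by (intro progression_mem) (auto simp: no)
      then show ?thesis using sub by blast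
    next
      case 9
      then have "py i \<in> set (progression py (4*K + 4*K) (-1) no)" by (intro progression_mem) (auto simp: no)
      then show ?thesis using sub by blast
    qed (use joints in auto)
    then show "cls N (py i) \<in> cls N ` S" by (rule memY)
  qed
  have len: "length xs = 16 * k - 1" using k by (simp add: xs_def no_def)
  have "length (csums xs) = length xs" by (simp add: csums_def)
  then have "indep N (0 # xs)" "indep N (0 # csums xs)"
    using indep_of_covers[OF N zs labels] indep_of_covers[OF N zs sums] lzs len k by auto
  moreover have "odd (length xs)" using len k by presburger
  ultimately have sh: "sharp N xs" using labels by (simp add: sharp_def)
  obtain ys where ys: "xs = py (4*K) # px (4*K) # ys @ [py (8*K)]"
  proof -
    have 1: "zigzag py (4*K) px (4*K) (-1) (2*k) = py (4*K) # px (4*K) # drop 2 (zigzag py (4*K) px (4*K) (-1) (2*k))"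
      using k by (auto simp: zigzag_def upt_conv_Cons numeral_2_eq_2)
    define R where "R = drop 2 (zigzag py (4*K) px (4*K) (-1) (2*k)) @ drop (2*k) xs"
    have "xs = zigzag py (4*K) px (4*K) (-1) (2*k) @ drop (2*k) xs" by (simp add: xs_def)
    then have "xs = py (4*K) # px (4*K) # R" by (subst (asm) 1) (simp add: R_def)
    moreover have "drop (2*k) xs \<noteq> []" "last (drop (2*k) xs) = py (8*K)"
      using k by (simp_all add: xs_def K_def)
    then have "R = butlast R @ [py (8*K)]"
      using append_butlast_last_id[of R] by (simp add: R_def)
    ultimately show thesis using that by metis
  qed
  \<comment> \<open>The triple is \<open>py (8*K)\<close>, \<open>py (4*K)\<close>,
    \<open>px (4*K)\<close>, consecutive across the end of the list.\<close>
  have "2 * py (4*K) = 2 * t + of_int (8 * K) * g" "py (8*K) + py (4*K) - px (4*K) = 2 * t + of_int (8 * K) * g"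
    by (auto simp: px_def py_def algebra_simps)
  moreover have "2 * t + of_int (8 * K) * g \<in> N" using t g[of "8 * K"] subgrp_add[OF N] by (simp add: K_def)
  ultimately show ?thesis using sh ys unfolding triple_sharp_def by metis
qed

subsection \<open>Noncyclic two-groups\<close>

definition two_primary :: "'v::comm_ring_1 set \<Rightarrow> bool" where
  "two_primary N \<longleftrightarrow> (\<forall>x. \<exists>j::nat. 2 ^ j * x \<in> N)"

text \<open>The quotient has two different involutions; among finite abelian 2-groups this singles
  out the noncyclic ones.\<close>

definition noncyclic :: "'v::comm_ring_1 set \<Rightarrow> bool" where
  "noncyclic N \<longleftrightarrow> (\<exists>u v. 2 * u \<in> N \<and> 2 * v \<in> N \<and> u \<notin> N \<and> v \<notin> N \<and> u - v \<notin> N)"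

lemma subgrp_add_iff: "subgrp N \<Longrightarrow> y \<in> N \<Longrightarrow> x + y \<in> N \<longleftrightarrow> x \<in> N"
  by (rule subgrp_shift) auto

lemma two_power_dvd: "(2::int) ^ a dvd 2 ^ b \<longleftrightarrow> a \<le> b"
proof
  assume *: "(2::int) ^ a dvd 2 ^ b"
  show "a \<le> b"
  proof (rule ccontr)
    assume "\<not> a \<le> b"
    then have "(2::int) ^ b < 2 ^ a" by simp
    then show False using * zdvd_not_zless[of "2 ^ b" "2 ^ a"] by simp
  qed
qed (rule le_imp_power_dvd)

lemma klein_adjoin:
  assumes N: "subgrp N" and uv: "2 * u \<in> N" "2 * v \<in> N" "u \<notin> N" "v \<notin> N" "u - v \<notin> N"
  shows "klein N (adjoin u (adjoin v N)) u v"
proof -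
  let ?M = "adjoin u (adjoin v N)"
  have M: "subgrp ?M" "N \<subseteq> ?M" "u \<in> ?M" "v \<in> ?M"
    using subgrp_adjoin[OF N, of v] subgrp_adjoin[OF subgrp_adjoin[OF N], of u v] adjoin_superset[of N v]
      adjoin_superset[of "adjoin v N" u] adjoin_self[OF N, of v] adjoin_self[OF subgrp_adjoin[OF N], of u v]
    by auto
  have "2 * x \<in> N \<and> (x \<in> N \<or> x - u \<in> N \<or> x - v \<in> N \<or> x - (u + v) \<in> N)" if x_in: "x \<in> ?M" for x
  proof -
    obtain i j n where x: "x = of_int i * u + (of_int j * v + n)" "n \<in> N"
      using x_in unfolding adjoin_def by auto
    have "2 * x = of_int i * (2 * u) + of_int j * (2 * v) + 2 * n" by (simp add: x algebra_simps)
    also have "\<dots> \<in> N" using N uv x by (blast intro: subgrp_closed)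
    finally have 1: "2 * x \<in> N" .
    have "of_int l = (of_int (l mod 2) + 2 * of_int (l div 2) :: 'a)" for l
      by (metis mod_mult_div_eq of_int_add of_int_mult of_int_numeral)
    note e = this[of i] this[of j]
    have "x - (of_int (i mod 2) * u + of_int (j mod 2) * v) =
        of_int (i div 2) * (2 * u) + of_int (j div 2) * (2 * v) + n"
      by (simp only: x(1) e) (simp add: algebra_simps)
    also have "\<dots> \<in> N" using N uv x by (blast intro: subgrp_closed)
    finally have "x - (of_int (i mod 2) * u + of_int (j mod 2) * v) \<in> N" .
    moreover have "i mod 2 = 0 \<or> i mod 2 = 1" "j mod 2 = 0 \<or> j mod 2 = 1" by auto
    ultimately show ?thesis using 1 by auto
  qed
  then show ?thesis using N M uv by (simp add: klein_def)
qed

lemma cls_superset: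
  assumes "subgrp M" "N \<subseteq> M" and that: "subgrp N"
  shows "cls M x = {y. \<exists>z\<in>cls N x. y - z \<in> M}"
proof -
  have "y - x \<in> M \<longleftrightarrow> (\<exists>z\<in>cls N x. y - z \<in> M)" for y
  proof
    assume "y - x \<in> M"
    then show "\<exists>z\<in>cls N x. y - z \<in> M" using subgrp_0[OF that] by (intro bexI[of _ x]) (auto simp: cls_def)
  next
    assume "\<exists>z\<in>cls N x. y - z \<in> M"
    then obtain z where "z - x \<in> M" "y - z \<in> M" using assms by (auto simp: cls_def)
    then show "y - x \<in> M" using subgrp_add[OF assms(1), of "y - z" "z - x"] by simp
  qed
  then show ?thesis by (auto simp: cls_def)
qed

lemma index_superset:
  assumes N: "subgrp N" "finite_index N" and M: "subgrp M" "N \<subseteq> M"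
  shows "finite_index M" and "N \<noteq> M \<Longrightarrow> card (range (cls M)) < card (range (cls N))"
proof -
  define f where "f S = {y. \<exists>z\<in>S. y - z \<in> M}" for S
  have f: "f (cls N x) = cls M x" for x using cls_superset[OF M N(1)] by (simp add: f_def)
  then have r: "range (cls M) = f ` range (cls N)" by (auto simp: image_image)
  then show "finite_index M" using N(2) by (simp add: finite_index_def)
  assume "N \<noteq> M"
  then obtain u where u: "u \<in> M" "u \<notin> N" using M by blast
  have "\<not> inj_on f (range (cls N))"
  proof
    assume "inj_on f (range (cls N))"
    moreover have "f (cls N u) = f (cls N 0)" using u(1) by (simp add: f cls_0[OF M(1)])
    ultimately have "cls N u = cls N 0" by (auto dest: inj_onD)
    then show False using u(2) cls_0[OF N(1)] by simp
  qed
  then have "card (f ` range (cls N)) \<noteq> card (range (cls N))"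
    using N(2) eq_card_imp_inj_on by (auto simp: finite_index_def)
  then show "card (range (cls M)) < card (range (cls N))"
    using card_image_le[of "range (cls N)" f] N(2) unfolding r finite_index_def by linarith
qed

lemma two_primary_superset: "two_primary N \<Longrightarrow> N \<subseteq> M \<Longrightarrow> two_primary M"
  unfolding two_primary_def by blast

lemma two_primary_order:
  assumes N: "subgrp N" "two_primary N"
  shows "\<exists>c::nat. \<forall>i. of_int i * x \<in> N \<longleftrightarrow> 2 ^ c dvd i"
proof -
  obtain j :: nat where j: "2 ^ j * x \<in> N" using N(2) by (auto simp: two_primary_def)
  then have "\<exists>j>0. of_nat j * x \<in> N" by (intro exI[of _ "2 ^ j"]) auto
  then obtain q :: nat where q: "q > 0" "\<And>i::int. of_int i * x \<in> N \<longleftrightarrow> int q dvd i"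
    using order_mod[OF N(1)] by metis
  have "int q dvd 2 ^ j" using q(2)[of "2 ^ j"] j by simp
  then have "q dvd 2 ^ j" by (metis int_dvd_int_iff of_nat_numeral of_nat_power)
  then obtain c where "q = 2 ^ c" using divides_primepow_nat[OF two_is_prime_nat] by blast
  then have "\<forall>i. of_int i * x \<in> N \<longleftrightarrow> 2 ^ c dvd i" using q(2) by simp
  then show ?thesis ..
qed

text \<open>An element of maximal order generates: otherwise some \<open>y\<close> outside its
  multiples has its double among them, and \<open>y\<close> yields either an element of larger order
  or a second involution.\<close>

lemma cyclic_generator:
  assumes N: "subgrp N" "finite_index N" "two_primary N" and nc: "\<not> noncyclic N"
  obtains g c where "\<And>i. of_int i * g \<in> N \<longleftrightarrow> 2 ^ c dvd i" "adjoin g N = UNIV"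
proof -
  define P where "P c \<longleftrightarrow> (\<exists>x. \<forall>i. of_int i * x \<in> N \<longleftrightarrow> 2 ^ c dvd i)" for c :: nat
  have bd: "c \<le> card (range (cls N))" if Pc: "P c" for c
  proof -
    obtain x where x: "\<And>i. of_int i * x \<in> N \<longleftrightarrow> 2 ^ c dvd i" using Pc by (auto simp: P_def)
    have "map (\<lambda>i. i mod 2 ^ c) (map int [0..<2 ^ c]) = map int [0..<2 ^ c]"
      by (rule nth_equalityI) auto
    moreover have "distinct (map int [0..<2 ^ c])" by (simp add: distinct_map)
    ultimately have "indep N (map (\<lambda>i. of_int i * x) (map int [0..<2 ^ c]))"
      using indep_multiples[OF N(1) x] by metis
    from indep_length[OF N(2) this] have "2 ^ c \<le> card (range (cls N))" by simp
    then show ?thesis using less_exp[of c] by linarith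
  qed
  have "P 0" unfolding P_def using subgrp_0[OF N(1)] by (intro exI[of _ 0]) auto
  define c where "c = Greatest P"
  have c: "P c" "\<And>d. P d \<Longrightarrow> d \<le> c"
    using GreatestI_nat[of P 0] Greatest_le_nat[of P] bd \<open>P 0\<close> unfolding c_def by blast+
  obtain g where g: "\<And>i. of_int i * g \<in> N \<longleftrightarrow> 2 ^ c dvd i" using c(1) by (auto simp: P_def)
  have "adjoin g N = UNIV"
  proof (rule ccontr)
    assume "adjoin g N \<noteq> UNIV"
    then obtain x where x: "x \<notin> adjoin g N" by blast
    have G: "subgrp (adjoin g N)" "N \<subseteq> adjoin g N" using N subgrp_adjoin adjoin_superset by blast+
    obtain j :: nat where j: "2 ^ j * x \<in> adjoin g N" "\<And>i. i < j \<Longrightarrow> 2 ^ i * x \<notin> adjoin g N"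
    proof -
      have "\<exists>j::nat. 2 ^ j * x \<in> adjoin g N" using N(3) G by (auto simp: two_primary_def)
      then show thesis using that[of "LEAST j. 2 ^ j * x \<in> adjoin g N"] LeastI_ex not_less_Least by (metis (mono_tags, lifting))
    qed
    have "j \<noteq> 0"
    proof
      assume "j = 0"
      then show False using j(1) x by simp
    qed
    then obtain j' where j': "j = Suc j'" by (cases j) auto
    define y where "y = 2 ^ j' * x"
    have y: "y \<notin> adjoin g N" "2 * y \<in> adjoin g N"
      using j j' by (auto simp: y_def mult.assoc)
    obtain i n where i: "2 * y = of_int i * g + n" "n \<in> N" using y(2) by (auto simp: adjoin_def)
    show False
    proof (cases "even i")
      \<comment> \<open>As \<open>2 * y\<close> is an odd multiple of \<open>g\<close> modulo
        \<open>N\<close>, the order of \<open>y\<close> exceeds that of \<open>g\<close>.\<close>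
      case False
      obtain d where d: "\<And>i. of_int i * y \<in> N \<longleftrightarrow> 2 ^ d dvd i"
        using two_primary_order[OF N(1,3), of y] by auto
      then have "P d" by (auto simp: P_def)
      then have dc: "d \<le> c" using c by blast
      have "y \<notin> N" using y G by blast
      then have "d \<noteq> 0" using d[of 1] by auto
      have "of_int (2 ^ d) * y \<in> N" by (simp only: d dvd_refl)
      moreover have "of_int (2 ^ d) * y = of_int (2 ^ (d - 1)) * (2 * y)"
        using \<open>d \<noteq> 0\<close> by (cases d) auto
      moreover have "of_int (2 ^ (d - 1)) * (2 * y) = of_int (2 ^ (d - 1) * i) * g + of_int (2 ^ (d - 1)) * n"
        unfolding i(1) by (simp add: algebra_simps)
      ultimately have "of_int (2 ^ (d - 1) * i) * g + of_int (2 ^ (d - 1)) * n \<in> N" by (simp only:)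
      then have "of_int (2 ^ (d - 1) * i) * g \<in> N"
        by (simp only: subgrp_add_iff[OF N(1) subgrp_of_int[OF N(1) i(2)]])
      then have "2 ^ c dvd 2 ^ (d - 1) * i" by (simp only: g)
      then have "(2::int) ^ c dvd 2 ^ (d - 1)" using False by (simp add: coprime_dvd_mult_left_iff)
      then have "c \<le> d - 1" by (simp add: two_power_dvd)
      then show False using dc \<open>d \<noteq> 0\<close> by linarith
    next
      case True
      then obtain i' where i': "i = 2 * i'" by blast
      \<comment> \<open>\<open>y'\<close> is an involution modulo \<open>N\<close> that is not a
        multiple of \<open>g\<close>, hence different from the involution \<open>u\<close> among the
        multiples.\<close>
      define y' where "y' = y - of_int i' * g"
      have gG: "of_int i' * g \<in> adjoin g N" for i' using adjoin_self[OF N(1)] subgrp_of_int[OF G(1)] by blast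
      have y': "2 * y' \<in> N" "y' \<notin> adjoin g N"
      proof -
        show "2 * y' \<in> N" using i by (simp add: y'_def i' algebra_simps)
        show "y' \<notin> adjoin g N" using y(1) subgrp_add_iff[OF G(1) gG[of i'], of "y - of_int i' * g"] by (simp add: y'_def)
      qed
      have "c \<noteq> 0"
      proof
        assume "c = 0"
        obtain d where d: "\<And>i. of_int i * y' \<in> N \<longleftrightarrow> 2 ^ d dvd i"
          using two_primary_order[OF N(1,3), of y'] by auto
        then have "P d" by (auto simp: P_def)
        then have "d = 0" using c \<open>c = 0\<close> by force
        then have "y' \<in> N" using d[of 1] by simp
        then show False using y' G by blast
      qed
      define u where "u = of_int (2 ^ (c - 1)) * g"
      have "u \<notin> N" using \<open>c \<noteq> 0\<close> unfolding u_def g two_power_dvd by auto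
      moreover have "2 * u = of_int (2 ^ c) * g" using \<open>c \<noteq> 0\<close> by (cases c) (auto simp: u_def)
      then have "2 * u \<in> N" by (simp only: g dvd_refl)
      moreover have "u - y' \<notin> N"
      proof
        assume "u - y' \<in> N"
        then have "u - (u - y') \<in> adjoin g N" using G gG unfolding u_def by (blast intro: subgrp_diff)
        then show False using y' by simp
      qed
      ultimately have "noncyclic N" unfolding noncyclic_def using y' G by blast
      then show False using nc by blast
    qed
  qed
  with g that show thesis by blast
qed

text \<open>Induction on the index. The extension step applies as long as some Klein four-group can
  be factored out with a noncyclic quotient; if none can, \<open>V / M\<close> is cyclic for the
  chosen \<open>M\<close>, and the order of \<open>V / M\<close> decides which base case
  \<open>V / N\<close> is.\<close>

lemma sharp_noncyclic:
  assumes "subgrp N" "finite_index N" "two_primary N" "noncyclic N"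
  shows "triple_sharp N \<or> edge_sharp N"
  using assms
proof (induction "card (range (cls N))" arbitrary: N rule: less_induct)
  case less
  note N = less.prems
  show ?case
  proof (cases "\<exists>u v M. klein N M u v \<and> noncyclic M")
    case True
    then obtain u v M where M: "klein N M u v" "noncyclic M" by blast
    then have M': "subgrp M" "N \<subseteq> M" "N \<noteq> M" by (auto simp: klein_def)
    have "triple_sharp M \<or> edge_sharp M"
      using less.hyps[OF index_superset(2)[OF N(1,2) M'] M'(1) index_superset(1)[OF N(1,2) M'(1,2)]
          two_primary_superset[OF N(3) M'(2)] M(2)] .
    then show ?thesis using triple_sharp_klein[OF M(1)] edge_sharp_klein[OF M(1)] by blast
  next
    case False
    obtain u v where uv: "2 * u \<in> N" "2 * v \<in> N" "u \<notin> N" "v \<notin> N" "u - v \<notin> N"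
      using N(4) by (auto simp: noncyclic_def)
    define M where "M = adjoin u (adjoin v N)"
    have k: "klein N M u v" unfolding M_def by (rule klein_adjoin[OF N(1) uv])
    have M: "subgrp M" "N \<subseteq> M" and d: "\<And>x. x \<in> M \<Longrightarrow> 2 * x \<in> N" and inM: "u \<in> M" "v \<in> M"
      and cov: "\<And>x. x \<in> M \<Longrightarrow> x \<in> N \<or> x - u \<in> N \<or> x - v \<in> N \<or> x - (u + v) \<in> N"
      using k by (auto simp: klein_def)
    have "\<not> noncyclic M" using False k by blast
    then obtain g c where g: "\<And>i. of_int i * g \<in> M \<longleftrightarrow> 2 ^ c dvd i" "adjoin g M = UNIV"
      using cyclic_generator[OF M(1) index_superset(1)[OF N(1,2) M] two_primary_superset[OF N(3) M(2)]] by metis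
    consider "c = 0" | "c = 1" | "c \<ge> 2" by linarith
    then show ?thesis
    proof cases
      case 1
      then have "g \<in> M" using g(1)[of 1] by simp
      then have "M = UNIV" using g(2) adjoin_subset[OF M(1) order_refl] by blast
      then show ?thesis using triple_sharp_base_klein k by blast
    next
      case 2
      have gM: "g \<notin> M" "2 * g \<in> M" using g(1)[of 1] g(1)[of 2] 2 by auto
      have cov': "x \<in> M \<or> x - g \<in> M" for x
      proof -
        obtain i m where x: "x = of_int i * g + m" "m \<in> M" using g(2) unfolding adjoin_def by blast
        show ?thesis
        proof (cases "even i")
          case True
          then show ?thesis using x g(1)[of i] 2 subgrp_add[OF M(1)] by auto
        next
          case False
          then have "of_int (i - 1) * g \<in> M" using g(1)[of "i - 1"] 2 by auto
          then have "of_int (i - 1) * g + m \<in> M" using x subgrp_add[OF M(1)] by blast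
          then show ?thesis by (simp add: x algebra_simps)
        qed
      qed
      \<comment> \<open>\<open>2 * g\<close> lies in one of the four classes of
        \<open>M / N\<close>; if it is nonzero there, it is made the second basis vector.\<close>
      have "\<exists>u v. klein N M u v \<and> (2 * g \<in> N \<or> 2 * g - v \<in> N)"
      proof -
        have "klein N M v u" "klein N M u (u + v)"
          using uv inM subgrp_add[OF M(1)] subgrp_diff_commute[OF N(1)] uv klein_list[OF k, of "u + v"] subgrp_0[OF N(1)]
          by (auto intro!: klein_basis[OF k] simp: indep_Cons[OF N(1)] subgrp_uminus_iff[OF N(1)])
        then show ?thesis using k cov[OF gM(2)] by blast
      qed
      then show ?thesis using edge_sharp_base[OF _ gM _ cov'] by blast
    next
      case 3
      define a where "a = of_int (2 ^ (c - 1)) * g"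
      define h where "h = of_int (2 ^ (c - 2)) * g"
      define r where "r = of_int (2 ^ c) * g"
      have rM: "r \<in> M" unfolding r_def g(1) by (rule dvd_refl)
      have nd: "\<not> (2::int) ^ c dvd 2 ^ (c - 1)" "\<not> (2::int) ^ c dvd 2 ^ (c - 2)"
        using 3 unfolding two_power_dvd by auto
      have aM: "a \<notin> M" and hM: "h \<notin> M" unfolding a_def h_def g(1) by (rule nd)+
      obtain c' where c': "c = Suc (Suc c')" using 3 by (metis add_2_eq_Suc le_Suc_ex)
      have a2: "2 * h = a" "2 * a = r" by (auto simp: a_def h_def r_def c')
      show ?thesis
      proof (cases "r \<in> N")
        case True
        \<comment> \<open>Here \<open>a\<close> is an involution modulo \<open>N\<close>, so
          \<open>u\<close> and \<open>a\<close> span another Klein four-group. In its quotient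
          \<open>h\<close> and \<open>v\<close> are different involutions, so this quotient is
          noncyclic, against the assumption.\<close>
        have "u - a \<notin> N" using aM inM M subgrp_diff[OF M(1), of u "u - a"] by auto
        then have k': "klein N (adjoin u (adjoin a N)) u a" (is "klein N ?M u a")
          using uv a2 True aM M by (intro klein_adjoin[OF N(1)]) auto
        have M': "x \<in> N \<or> x - u \<in> N \<or> x - a \<in> N \<or> x - (u + a) \<in> N" if "x \<in> ?M" for x
          using k' that by (auto simp: klein_def)
        have inM': "x \<in> M \<or> x - a \<in> M" if x: "x \<in> ?M" for x
        proof -
          have "x - u \<in> M \<longrightarrow> x \<in> M" "x - (u + a) \<in> M \<longrightarrow> x - a \<in> M"
            using subgrp_add[OF M(1) _ inM(1), of "x - u"] subgrp_add[OF M(1) _ inM(1), of "x - (u + a)"] by auto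
          then show ?thesis using M'[OF x] M(2) by blast
        qed
        have "h - a = - h" using a2(1) by simp
        then have "h \<notin> ?M" using inM'[of h] hM subgrp_uminus_iff[OF M(1), of h] by auto
        moreover have "v \<notin> ?M"
        proof
          assume "v \<in> ?M"
          moreover have "v - a \<notin> M" "v - (u + a) \<notin> M"
            using aM inM subgrp_diff[OF M(1), of v "v - a"] subgrp_diff[OF M(1), of "v - u" "v - (u + a)"]
              subgrp_diff[OF M(1), of v u] by auto
          moreover have "v - u \<notin> N" using uv subgrp_diff_commute[OF N(1)] by blast
          ultimately show False using M'[of v] M uv by blast
        qed
        moreover have "h - v \<notin> ?M"
        proof
          assume "h - v \<in> ?M"
          then have "h - v \<in> M \<or> h - v - a \<in> M" by (rule inM')
          then have "h - v + v \<in> M \<or> h - v - a + v \<in> M" using subgrp_add[OF M(1) _ inM(2)] by blast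
          then have "h \<in> M \<or> h - a \<in> M" by simp
          then show False using hM \<open>h - a = - h\<close> subgrp_uminus_iff[OF M(1), of h] by auto
        qed
        moreover have "2 * h \<in> ?M" "2 * v \<in> ?M" using k' a2 uv by (auto simp: klein_def)
        ultimately have "noncyclic ?M" unfolding noncyclic_def by blast
        then show ?thesis using False k' by blast
      next
        case rN: False
        \<comment> \<open>Now \<open>r\<close> is the involution among the multiples of
          \<open>g\<close>, which has order \<open>8 * 2 ^ c'\<close> modulo \<open>N\<close>, and
          \<open>t\<close> spans a complement of order 2.\<close>
        obtain t where t: "klein N M t r" using klein_complement[OF k rM rN] by blast
        then have t': "t \<in> M" "t \<notin> N" "t - r \<notin> N" "\<And>x. x \<in> M \<Longrightarrow> x \<in> N \<or> x - t \<in> N \<or> x - r \<in> N \<or> x - (t + r) \<in> N"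
          by (auto simp: klein_def)
        have mult: "of_int i * g = of_int j * r" if "i = 2 ^ c * j" for i j by (simp add: that r_def algebra_simps)
        have par: "of_int j * r - (if even j then 0 else r) \<in> N" for j
        proof -
          have "of_int j * r - (if even j then 0 else r) = of_int (j div 2) * (2 * r)"
            by (cases "even j") (auto elim!: evenE oddE simp: algebra_simps)
          then show ?thesis using d[OF rM] subgrp_of_int[OF N(1)] by simp
        qed
        have ord: "of_int i * g \<in> N \<longleftrightarrow> 8 * int (2 ^ c') dvd i" for i
        proof
          assume i: "of_int i * g \<in> N"
          then have "2 ^ c dvd i" using M by (metis g(1) subsetD)
          then obtain j where j: "i = 2 ^ c * j" by blast
          have "even j" using par[of j] i rN subgrp_diff[OF N(1), of "of_int j * r" "of_int j * r - r"]
            by (auto simp: mult[OF j] split: if_splits)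
          then show "8 * int (2 ^ c') dvd i" by (auto simp: j c')
        next
          assume "8 * int (2 ^ c') dvd i"
          then obtain l where "i = 8 * int (2 ^ c') * l" by blast
          then have "i = 2 ^ c * (2 * l)" by (simp add: c')
          then have "of_int i * g = of_int (2 * l) * r" by (rule mult)
          then show "of_int i * g \<in> N" using par[of "2 * l"] by simp
        qed
        have "triple_sharp N"
        proof (rule triple_sharp_base[OF N(1) d[OF t'(1)] _ ord])
          show "2 ^ c' > (0::nat)" by simp
          show "t - of_int i * g \<notin> N" for i
          proof
            assume *: "t - of_int i * g \<in> N"
            then have "t - (t - of_int i * g) \<in> M" using M t' subgrp_diff by blast
            then have "2 ^ c dvd i" using g(1) by simp
            then obtain j where j: "i = 2 ^ c * j" by blast
            have "t - of_int i * g + (of_int j * r - (if even j then 0 else r)) \<in> N"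
              using * par subgrp_add[OF N(1)] by blast
            then show False using t' by (auto simp: mult[OF j] split: if_splits)
          qed
          show "\<exists>i. v - of_int i * g \<in> N \<or> v - (t + of_int i * g) \<in> N" for v
          proof -
            obtain i m where v: "v = of_int i * g + m" "m \<in> M" using g(2) unfolding adjoin_def by blast
            have "v - of_int i * g = m" "v - (t + of_int i * g) = m - t"
              "v - of_int (i + 2 ^ c) * g = m - r" "v - (t + of_int (i + 2 ^ c) * g) = m - (t + r)"
              by (auto simp: v r_def algebra_simps)
            then show ?thesis using t'(4)[OF v(2)] by metis
          qed
        qed
        then show ?thesis by blast
      qed
    qed
  qed
qed

subsection \<open>Cyclic two-groups\<close>

definition doubled :: "'v::comm_ring_1 \<Rightarrow> 'v list \<Rightarrow> 'v list" where
  "doubled t C = concat (map (\<lambda>c. [c, c + t]) C)"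

lemma doubled_simps [simp]:
  "doubled t [] = []" "doubled t (c # C) = c # (c + t) # doubled t C"
  "doubled t (C @ D) = doubled t C @ doubled t D" "doubled t C = [] \<longleftrightarrow> C = []"
  by (auto simp: doubled_def)

lemma last_doubled: "C \<noteq> [] \<Longrightarrow> last (doubled t C) = last C + t"
  by (induction C) auto

lemma mset_doubled: "mset (doubled t C) = mset (C @ map (\<lambda>c. c + t) C)"
  by (induction C) auto

text \<open>The step inside a pair has sum \<open>2 c + t\<close>, the step between pairs
  \<open>c + c' + t\<close>. So the doubles and the adjacent sums of \<open>C\<close> have to be
  distinct jointly, which is the condition on \<open>C\<close> used below.\<close>

lemma mset_psums_doubled:
  "mset (psums (doubled t C)) = mset (map (\<lambda>x. x + t) (map ((*) 2) C @ psums C))"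
proof (induction C rule: psums.induct)
  case (1 x y C)
  then show ?case by (simp add: algebra_simps)
qed (auto simp: algebra_simps)

text \<open>Continuing \<open>C\<close> by its translate \<open>C + t\<close> closes up to a cycle of \<open>V / L\<close>. Deleting \<open>x\<close> from the doubled
  list joins its two neighbours. Since \<open>2 x = t\<close> and \<open>0\<close> and \<open>x\<close> both succeed their
  translates by \<open>- g\<close>, the sums that are lost at \<open>x\<close> are recovered at the two ends.\<close>

lemma path_sharp_antiperiodic:
  assumes L: "subgrp L" and t: "2 * t \<in> L" and C: "C = (0 # As) @ x # Bs"
    and x: "2 * x - t \<in> L" "x - last (0 # As) - g \<in> L" and l: "last C - (t - g) \<in> L"
    and labels: "indep L (C @ map (\<lambda>c. c + t) C)" "covers L UNIV (C @ map (\<lambda>c. c + t) C)"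
    and sums: "indep L (map ((*) 2) C @ psums C @ [last C + t])"
  shows "path_sharp L"
proof -
  define a where "a = last (0 # As)"
  define xs where "xs = doubled t (0 # As) @ (x + t) # doubled t Bs"
  have m: "mset (map (cls L) (x # xs)) = mset (map (cls L) (C @ map (\<lambda>c. c + t) C))"
  proof -
    have "mset (x # xs) = mset (C @ map (\<lambda>c. c + t) C)" by (simp add: xs_def C mset_doubled)
    then show ?thesis by (simp only: mset_map)
  qed
  have lD: "last (doubled t (0 # As)) = a + t" by (subst last_doubled) (auto simp: a_def)
  have ends: "hd xs = 0" "last xs = last C + t"
  proof -
    show "hd xs = 0" by (simp add: xs_def)
    show "last xs = last C + t" by (cases "Bs = []") (auto simp: xs_def C last_doubled)
  qed
  define R where "R = psums ((x + t) # doubled t Bs)"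
  have p1: "psums xs = psums (doubled t (0 # As)) @ (a + t + (x + t)) # R"
    unfolding xs_def R_def using lD by (subst psums_append) auto
  have "psums (doubled t C) = psums (doubled t (0 # As) @ x # (x + t) # doubled t Bs)" by (simp add: C)
  also have "\<dots> = psums (doubled t (0 # As)) @ (a + t + x) # (x + (x + t)) # R"
    unfolding R_def using lD by (subst psums_append) auto
  finally have p2: "psums (doubled t C) = psums (doubled t (0 # As)) @ (a + t + x) # (x + (x + t)) # R" .
  \<comment> \<open>The two sums lost at \<open>x\<close> reappear at the ends of the path; the sum
    of the edge that bridges the gap replaces the closing sum from \<open>last C + t\<close> to the
    translate of the entry 0.\<close>
  have e: "cls L 0 = cls L (x + (x + t))" "cls L (last C + t) = cls L (a + t + x)"
    "cls L (a + t + (x + t)) = cls L (last C + t + t)"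
  proof -
    have l1: "last C - (t - g) \<in> L" "2 * x - t \<in> L" "x - a - g \<in> L" using l x by (auto simp: a_def)
    have "x + (x + t) = (2 * x - t) + 2 * t" by (simp add: algebra_simps)
    then have "x + (x + t) \<in> L" using l1 t subgrp_add[OF L] by metis
    then show "cls L 0 = cls L (x + (x + t))" by (metis cls_0[OF L])
    have *: "last C - a - x = (last C - (t - g)) - (2 * x - t) + (x - a - g)"
      by (simp add: algebra_simps)
    have "last C - a - x \<in> L" unfolding * by (rule subgrp_add[OF L subgrp_diff[OF L l1(1,2)] l1(3)])
    then show "cls L (last C + t) = cls L (a + t + x)" "cls L (a + t + (x + t)) = cls L (last C + t + t)"
      using subgrp_minus[OF L, of "last C - a - x"] by (auto simp: cls_eq[OF L] algebra_simps)
  qed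
  have "mset (map (cls L) (hd xs # psums xs @ [last xs])) =
      mset (map (cls L) (psums (doubled t C) @ [last C + t + t]))"
    unfolding p1 p2 ends list.map map_append e mset_append mset.simps by simp
  also have "\<dots> = mset (map (cls L) (map (\<lambda>x. x + t) (map ((*) 2) C @ psums C @ [last C + t])))"
  proof -
    have "mset (psums (doubled t C) @ [last C + t + t]) =
        mset (map (\<lambda>x. x + t) (map ((*) 2) C @ psums C @ [last C + t]))"
      by (simp add: mset_psums_doubled)
    then show ?thesis by (simp only: mset_map)
  qed
  finally have s: "mset (map (cls L) (hd xs # psums xs @ [last xs])) =
      mset (map (cls L) (map (\<lambda>x. x + t) (map ((*) 2) C @ psums C @ [last C + t])))" .
  have "indep L (map (\<lambda>x. x + t) ys) \<longleftrightarrow> indep L ys" for ys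
    by (induction ys) (auto simp: indep_Cons[OF L])
  then have "indep L (hd xs # psums xs @ [last xs])" using sums indep_mset[OF s] by blast
  moreover have "indep L (x # xs)" using labels indep_mset[OF m] by blast
  moreover have "covers L UNIV (x # xs)" using labels covers_mset[OF L sym[OF m]] by blast
  moreover have "xs \<noteq> []" by (simp add: xs_def)
  ultimately show ?thesis unfolding path_sharp_def by blast
qed

lemma indep_map_upt: assumes "subgrp L"
  shows "indep L (map f [0..<k]) \<longleftrightarrow> (\<forall>i<k. \<forall>j<k. f i - f j \<in> L \<longrightarrow> i = j)"
  unfolding indep_def by (auto simp: distinct_map inj_on_def cls_eq[OF assms])

text \<open>\<open>C\<close> consists of \<open>h\<close> rows of length \<open>m\<close>; along a
  row the multiple of \<open>g\<close> grows by one, and row \<open>l\<close> is shifted by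
  \<open>w l\<close> and by \<open>l\<close> times \<open>t\<close>. Modulo \<open>K\<close>,
  doubles are even and adjacent sums odd multiples of \<open>g\<close>. Equal multiples are told
  apart by doubling in \<open>K / L\<close> or, at the row ends, by the harmonious sums of
  \<open>us\<close>.\<close>

lemma path_sharp_cyclic:
  assumes L: "subgrp L" and K: "subgrp K" "L \<subseteq> K" "odd_torsion L K"
    and us: "harmonious L K us" "odd (length us)"
    and g: "adjoin g K = UNIV" "\<And>i. of_int i * g \<in> K \<longleftrightarrow> 4 * int r dvd i" and r: "r \<ge> 2"
  shows "path_sharp L"
proof -
  define h where "h = length us"
  define w where "w l = us ! (l mod h)" for l
  have usf: "us \<noteq> []" "hd us = 0" "set us \<subseteq> K" "indep L us" "covers L K us" "indep L (csums us)"
    using us(1) by (auto simp: harmonious_def)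
  then have h: "h > 0" "odd h" using us by (auto simp: h_def)
  have wK: "w l \<in> K" for l using usf h by (auto simp: w_def h_def)
  have wper: "w (l + h) = w l" "w h = 0" "w 0 = 0" for l
    using usf h by (auto simp: w_def hd_conv_nth)
  have w_inj: "l mod h = l' mod h" if "w l - w l' \<in> L" for l l'
  proof -
    have "map w [0..<h] = us" by (rule nth_equalityI) (auto simp: w_def h_def)
    then have "\<forall>i<h. \<forall>j<h. w i - w j \<in> L \<longrightarrow> i = j" using usf indep_map_upt[OF L] by metis
    moreover have "w (l mod h) = w l" for l by (simp add: w_def)
    ultimately show ?thesis using that h by (metis mod_less_divisor)
  qed
  have csw: "map (\<lambda>l. w l + w (Suc l)) [0..<h] = csums us"
  proof -
    have "csums us = psums (map w [0..<Suc h])"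
    proof -
      have "map w [0..<h] = us" by (rule nth_equalityI) (auto simp: w_def h_def)
      then show ?thesis using usf by (simp add: csums_def wper)
    qed
    then show ?thesis using psums_map_upt[of w "Suc h"] by simp
  qed
  have ws_inj: "l mod h = l' mod h" if "w l + w (Suc l) - (w l' + w (Suc l')) \<in> L" for l l'
  proof -
    have "indep L (map (\<lambda>l. w l + w (Suc l)) [0..<h])" using usf(6) csw by simp
    then have "\<forall>i<h. \<forall>j<h. (w i + w (Suc i)) - (w j + w (Suc j)) \<in> L \<longrightarrow> i = j"
      unfolding indep_map_upt[OF L] .
    moreover have "w l = w (l mod h)" "w (Suc l) = w (Suc (l mod h))" for l by (simp_all add: w_def mod_Suc_eq)
    then have "w (l mod h) + w (Suc (l mod h)) - (w (l' mod h) + w (Suc (l' mod h))) \<in> L" using that by simp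
    ultimately show ?thesis using h by simp
  qed
  define m where "m = 2 * r"
  have m: "m > 2" "even m" using r by (auto simp: m_def)
  have gK: "of_int i * g \<in> K \<longleftrightarrow> 2 * int m dvd i" for i using g(2) by (simp add: m_def)
  have "of_int (2 * int m) * g \<in> K" unfolding gK by (rule dvd_refl)
  then have "- (of_int (2 * int m) * g) \<in> K" by (rule subgrp_minus[OF K(1)])
  \<comment> \<open>\<open>m\<close> times \<open>g\<close> is an involution only modulo
    \<open>K\<close>; adding \<open>\<tau>\<close> makes it an involution modulo
    \<open>L\<close>.\<close>
  then obtain \<tau> where \<tau>: "\<tau> \<in> K" "2 * \<tau> - - (of_int (2 * int m) * g) \<in> L"
    using odd_torsion_half[OF L K(1,3)] by blast
  define t where "t = of_int (int m) * g + \<tau>"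
  have t2: "2 * t \<in> L" using \<tau>(2) by (simp add: t_def algebra_simps)
  have tL: "of_nat j * t \<in> L" if "even j" for j :: nat
    using that t2 subgrp_of_nat[OF L t2, of "j div 2"] by (auto elim!: evenE simp: algebra_simps)
  have cmp: "2 * int m dvd i - j" "i = j \<Longrightarrow> a - b \<in> L"
    if "(of_int i * g + a) - (of_int j * g + b) \<in> L" "a \<in> K" "b \<in> K" for i j a b
  proof -
    have "of_int (i - j) * g = ((of_int i * g + a) - (of_int j * g + b)) - a + b" by (simp add: algebra_simps)
    also have "\<dots> \<in> K" using that K by (meson subgrp_add subgrp_diff subsetD)
    finally show "2 * int m dvd i - j" by (simp only: gK)
    show "a - b \<in> L" if "i = j" using \<open>(of_int i * g + a) - (of_int j * g + b) \<in> L\<close> that by simp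
  qed
  define k where "k = h * m"
  \<comment> \<open>Because of the offset \<open>-1\<close> the row breaks avoid the end of the
    list: \<open>c 1 = 0\<close>, and modulo \<open>L\<close> the list ends at
    \<open>c k = t - g\<close>, from which a step by \<open>g\<close> leads to
    \<open>c (Suc k) = t\<close>. Here the odd number \<open>h\<close> of rows enters.\<close>
  define c where "c I = of_int (int (I mod m) - 1) * g + w (I div m) + of_nat (I div m) * t" for I
  define d where "d i = c (Suc i)" for i
  define C where "C = map d [0..<k]"
  have "m \<le> k" using h by (simp add: k_def)
  then have "k > 1" using m(1) by linarith
  moreover have "k div m = h" "k mod m = 0" using m by (auto simp: k_def)
  ultimately have divk: "k div m = h" "k mod m = 0" "k > 1" by auto
  \<comment> \<open>The positions from 1 to \<open>k\<close> miss the first place of row 0; the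
    first place of row \<open>h\<close> stands in for it.\<close>
  have idx: "I = J"
    if IJ: "1 \<le> I" "I \<le> k" "1 \<le> J" "J \<le> k" "I mod m = J mod m" "(I div m) mod h = (J div m) mod h" for I J
  proof -
    have up: "I div m < h" if "I \<le> k" "I mod m \<noteq> 0" for I
    proof -
      have "I div m \<le> h" using div_le_mono[OF that(1), of m] divk by simp
      moreover have "I div m \<noteq> h"
      proof
        assume "I div m = h"
        then have "I = k + I mod m" unfolding k_def by (metis mult.commute mult_div_mod_eq)
        then show False using that by simp
      qed
      ultimately show ?thesis by simp
    qed
    have lo: "I div m \<ge> 1" "I div m \<le> h" if "1 \<le> I" "I \<le> k" "I mod m = 0" for I
    proof -
      have "I div m * m = I" using that by (metis add.right_neutral div_mult_mod_eq)
      then show "I div m \<ge> 1" using that(1) by (metis less_one mult_is_0 not_le)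
      show "I div m \<le> h" using div_le_mono[OF that(2), of m] divk by simp
    qed
    have "I div m = J div m"
    proof (cases "I mod m = 0")
      case True
      define i j where "i = I div m - 1" and "j = J div m - 1"
      have ij: "I div m = Suc i" "J div m = Suc j" "i < h" "j < h"
        using lo[OF IJ(1,2) True] lo[OF IJ(3,4)] True IJ(5) by (auto simp: i_def j_def)
      moreover have "Suc i mod h = Suc j mod h" using IJ(6) ij by simp
      ultimately have "i = j" by (auto simp: mod_Suc split: if_splits)
      then show ?thesis using ij by simp
    next
      case False
      then show ?thesis using up[OF IJ(2)] up[OF IJ(4)] IJ(5,6) by simp
    qed
    then show ?thesis using IJ(5) by (metis div_mult_mod_eq)
  qed
  define e where "e I = int (I mod m) - 1" for I
  have e: "-1 \<le> e I" "e I \<le> int m - 2" for I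
  proof -
    have "I mod m < m" using m by simp
    then show "-1 \<le> e I" "e I \<le> int m - 2" by (auto simp: e_def)
  qed
  have e_eq: "I mod m = J mod m" if "int m dvd e I - e J" for I J
  proof -
    have "int m dvd int (I mod m) - int (J mod m)" using that by (simp add: e_def)
    then have "int (I mod m) mod int m = int (J mod m) mod int m" by (simp add: mod_eq_dvd_iff)
    then show ?thesis by (metis of_nat_mod of_nat_eq_iff mod_mod_trivial)
  qed
  have c_e: "c I = of_int (e I) * g + w (I div m) + of_nat (I div m) * t" for I by (simp add: c_def e_def)
  \<comment> \<open>A shift by \<open>t\<close> moves the multiple of \<open>g\<close> by
    \<open>m\<close>, which is visible modulo \<open>2 * m\<close>. The numbers \<open>z\<close> and
    \<open>z'\<close> treat pairs in \<open>C\<close>, pairs in its translate and mixed pairs at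
    once.\<close>
  have inj: "I = J \<and> even (z + z')"
    if IJ: "1 \<le> I" "I \<le> k" "1 \<le> J" "J \<le> k" and eq: "c I + of_nat z * t - (c J + of_nat z' * t) \<in> L"
    for I J z z'
  proof -
    let ?p = "I div m + z" and ?q = "J div m + z'"
    have K': "w (I div m) + of_nat ?p * \<tau> \<in> K" "w (J div m) + of_nat ?q * \<tau> \<in> K"
      using wK \<tau>(1) K by (auto intro!: subgrp_add subgrp_of_nat simp del: of_nat_add)
    have "c I + of_nat z * t = of_int (e I + int ?p * int m) * g + (w (I div m) + of_nat ?p * \<tau>)"
      "c J + of_nat z' * t = of_int (e J + int ?q * int m) * g + (w (J div m) + of_nat ?q * \<tau>)"
      by (auto simp: c_e t_def algebra_simps)
    then have D: "2 * int m dvd (e I + int ?p * int m) - (e J + int ?q * int m)"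
      using cmp(1)[OF _ K'] eq by metis
    then have "int m dvd (e I - e J) + int m * (int ?p - int ?q)"
      by (metis (no_types, lifting) dvd_mult_right add_diff_add mult.commute left_diff_distrib)
    then have "int m dvd e I - e J" by (simp add: dvd_add_left_iff)
    then have s: "I mod m = J mod m" by (rule e_eq)
    then have "e I = e J" by (simp add: e_def)
    then have "2 * int m dvd (int ?p - int ?q) * int m" using D by (simp add: left_diff_distrib)
    then have "2 dvd int ?p - int ?q" using m by simp
    then obtain z2 where z2: "int ?p - int ?q = 2 * z2" by blast
    have "c I + of_nat z * t - (c J + of_nat z' * t) = w (I div m) - w (J div m) + of_int (int ?p - int ?q) * t"
      using \<open>e I = e J\<close> by (simp add: c_e algebra_simps)
    also have "of_int (int ?p - int ?q) * t = of_int z2 * (2 * t)" unfolding z2 by (simp add: algebra_simps)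
    finally have "w (I div m) - w (J div m) + of_int z2 * (2 * t) \<in> L" using eq by simp
    then have "w (I div m) - w (J div m) \<in> L"
      using subgrp_add_iff[OF L subgrp_of_int[OF L t2]] by blast
    then have "I = J" using idx[OF IJ s] w_inj by blast
    moreover from this have "int z - int z' = 2 * z2" using z2 by simp
    then have "even (z + z')" by presburger
    ultimately show ?thesis by blast
  qed
  have step: "c (Suc I) = c I + g" if "I mod m + 1 < m" for I
  proof -
    have "Suc I mod m = Suc (I mod m)" "Suc I div m = I div m"
      using that by (simp_all add: mod_Suc div_Suc)
    then show ?thesis by (simp add: c_def algebra_simps)
  qed
  have wrap: "Suc I mod m = 0" "Suc I div m = Suc (I div m)" if "I mod m + 1 = m" for I
    using that by (simp_all add: mod_Suc div_Suc)
  \<comment> \<open>The part of \<open>c I + c (Suc I)\<close> in \<open>K\<close>, once the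
    multiple of \<open>g\<close> is written as \<open>2 * e I + 1\<close> throughout. At a row end
    the actual multiple is smaller by \<open>m\<close>, and the difference turns an extra
    \<open>t\<close> into \<open>\<tau>\<close>.\<close>
  define v where "v I = (if I mod m + 1 < m then 2 * w (I div m) else \<tau> + (w (I div m) + w (Suc (I div m))))" for I
  have vK: "v I \<in> K" for I
    using wK \<tau>(1) K(1) by (auto simp: v_def intro: subgrp_add subgrp_numeral)
  have sum: "c I + c (Suc I) - (of_int (2 * e I + 1) * g + v I) \<in> L" for I
  proof (cases "I mod m + 1 < m")
    case True
    then have "c I + c (Suc I) - (of_int (2 * e I + 1) * g + v I) = of_nat (I div m) * (2 * t)"
      unfolding step[OF True] by (simp add: c_e v_def algebra_simps)
    then show ?thesis using subgrp_of_nat[OF L t2] by simp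
  next
    case False
    then have I: "I mod m + 1 = m" using m by (metis Suc_eq_plus1 Suc_lessI mod_less_divisor not_less_zero gr0I)
    then have "int m = e I + 2" by (simp add: e_def)
    then have "(of_nat m :: 'a) = of_int (e I) + 2" by (metis of_int_of_nat_eq of_int_add of_int_numeral)
    moreover have "e (Suc I) = - 1" by (simp add: e_def wrap[OF I])
    ultimately have "c I + c (Suc I) - (of_int (2 * e I + 1) * g + v I) = of_nat (I div m) * (2 * t) + (t - of_int (int m) * g - \<tau>)"
      using I by (simp add: c_e v_def wrap[OF I] algebra_simps)
    also have "t - of_int (int m) * g - \<tau> = 0" by (simp add: t_def)
    finally show ?thesis using subgrp_of_nat[OF L t2] by simp
  qed
  have dbl: "2 * c I - (of_int (2 * e I) * g + 2 * w (I div m)) \<in> L" for I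
  proof -
    have "2 * c I - (of_int (2 * e I) * g + 2 * w (I div m)) = of_nat (I div m) * (2 * t)"
      by (simp add: c_e algebra_simps)
    then show ?thesis using subgrp_of_nat[OF L t2] by simp
  qed
  have e_eq2: "I mod m = J mod m" if dv: "2 * int m dvd 2 * (e I - e J)" for I J
  proof -
    obtain j where "2 * (e I - e J) = 2 * int m * j" using dv unfolding dvd_def by blast
    then have "e I - e J = int m * j" by simp
    then show ?thesis by (intro e_eq) simp
  qed
  have tr: "y - y' \<in> L" if "x - x' \<in> L" "x - y \<in> L" "x' - y' \<in> L" for x x' y y'
  proof -
    have "y - y' = (x - x') - (x - y) + (x' - y')" by simp
    then show ?thesis using that L by (metis subgrp_add subgrp_diff)
  qed
  have w2K: "2 * w l \<in> K" for l by (rule subgrp_numeral[OF K(1) wK])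
  have inj_dbl: "I = J" if IJ: "1 \<le> I" "I \<le> k" "1 \<le> J" "J \<le> k" and eq: "2 * c I - 2 * c J \<in> L" for I J
  proof -
    note D = tr[OF eq dbl dbl]
    have s: "I mod m = J mod m" using cmp(1)[OF D w2K w2K] by (intro e_eq2) (simp add: algebra_simps)
    then have "2 * w (I div m) - 2 * w (J div m) \<in> L" using cmp(2)[OF D w2K w2K] by (simp add: e_def)
    then have "2 * (w (I div m) - w (J div m)) \<in> L" by (simp add: algebra_simps)
    then have "w (I div m) - w (J div m) \<in> L" by (rule odd_torsion_double[OF L K(3) subgrp_diff[OF K(1) wK wK]])
    then show ?thesis using idx[OF IJ s] w_inj by blast
  qed
  have inj_sum: "I = J"
    if IJ: "1 \<le> I" "I \<le> k" "1 \<le> J" "J \<le> k" and eq: "c I + c (Suc I) - (c J + c (Suc J)) \<in> L" for I J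
  proof -
    note D = tr[OF eq sum sum]
    have s: "I mod m = J mod m" using cmp(1)[OF D vK vK] by (intro e_eq2) (simp add: algebra_simps)
    then have vv: "v I - v J \<in> L" using cmp(2)[OF D vK vK] by (simp add: e_def)
    have "(I div m) mod h = (J div m) mod h"
    proof (cases "I mod m + 1 < m")
      case True
      then have "2 * (w (I div m) - w (J div m)) \<in> L" using vv s by (simp add: v_def algebra_simps)
      then have "w (I div m) - w (J div m) \<in> L" by (rule odd_torsion_double[OF L K(3) subgrp_diff[OF K(1) wK wK]])
      then show ?thesis by (rule w_inj)
    next
      case False
      then have "w (I div m) + w (Suc (I div m)) - (w (J div m) + w (Suc (J div m))) \<in> L"
        using vv s by (simp add: v_def)
      then show ?thesis by (rule ws_inj)
    qed
    then show ?thesis using idx[OF IJ s] by blast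
  qed
  have cross: "2 * c I - (c J + c (Suc J)) \<notin> L" for I J
  proof
    assume "2 * c I - (c J + c (Suc J)) \<in> L"
    from cmp(1)[OF tr[OF this dbl sum] w2K vK] have "2 dvd 2 * e I - (2 * e J + 1)"
      by (rule dvd_mult_left)
    then show False by presburger
  qed
  have c1: "c 1 = 0" using m by (simp add: c_def wper)
  have ck: "c k - (t - g) \<in> L" "c (Suc k) - t \<in> L"
  proof -
    have S: "Suc k mod m = 1" "Suc k div m = h" using divk m by (simp_all add: mod_Suc div_Suc)
    obtain h' where h': "h = 2 * h' + 1" using h(2) oddE by blast
    have "c k - (t - g) = of_nat h' * (2 * t)" "c (Suc k) - t = of_nat h' * (2 * t)"
      using divk by (simp_all add: c_def S wper) (simp_all add: h' algebra_simps)
    then show "c k - (t - g) \<in> L" "c (Suc k) - t \<in> L" using subgrp_of_nat[OF L t2] by simp_all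
  qed
  have lC: "length C = k" by (simp add: C_def)
  have last: "last C = c k" using divk(3) by (simp add: C_def d_def last_map)
  have sums: "indep L (map ((*) 2) C @ psums C @ [last C + t])"
  proof -
    have "psums C = map (\<lambda>i. d i + d (Suc i)) [0..<k - 1]" by (simp add: C_def psums_map_upt)
    moreover have "cls L (last C + t) = cls L (d (k - 1) + d (Suc (k - 1)))"
      using ck(2) divk(3) subgrp_minus[OF L ck(2)] by (simp add: last d_def cls_eq[OF L])
    moreover have "[0..<k] = [0..<k - 1] @ [k - 1]" using divk(3) by (metis Suc_diff_1 upt_Suc_append zero_le less_trans zero_less_one)
    ultimately have "map (cls L) (psums C @ [last C + t]) = map (cls L) (map (\<lambda>i. d i + d (Suc i)) [0..<k])" by simp
    then have "indep L (map ((*) 2) C @ psums C @ [last C + t]) \<longleftrightarrow>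
        indep L (map ((*) 2) C @ map (\<lambda>i. d i + d (Suc i)) [0..<k])"
      unfolding indep_def map_append[of "cls L" "map ((*) 2) C"] by (simp only:)
    also have "\<dots>"
      unfolding indep_append[OF L]
    proof (intro conjI ballI)
      have "map ((*) 2) C = map (\<lambda>i. 2 * d i) [0..<k]" by (simp add: C_def)
      then show "indep L (map ((*) 2) C)"
        using inj_dbl[of "Suc _" "Suc _"] by (simp add: indep_map_upt[OF L] d_def Suc_le_eq)
      show "indep L (map (\<lambda>i. d i + d (Suc i)) [0..<k])"
        using inj_sum[of "Suc _" "Suc _"] by (simp add: indep_map_upt[OF L] d_def Suc_le_eq)
      show "x - y \<notin> L" if "x \<in> set (map ((*) 2) C)" "y \<in> set (map (\<lambda>i. d i + d (Suc i)) [0..<k])" for x y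
        using that cross by (auto simp: C_def d_def)
    qed
    finally show ?thesis by simp
  qed
  have labels: "indep L (C @ map (\<lambda>c. c + t) C)"
    unfolding indep_append[OF L]
  proof (intro conjI ballI)
    show "indep L C" unfolding C_def indep_map_upt[OF L] d_def using inj[of "Suc _" "Suc _" 0 0] by (simp add: Suc_le_eq)
    have "map (\<lambda>c. c + t) C = map (\<lambda>i. d i + t) [0..<k]" by (simp add: C_def)
    then show "indep L (map (\<lambda>c. c + t) C)"
      using inj[of "Suc _" "Suc _" 0 0] by (simp add: indep_map_upt[OF L] d_def Suc_le_eq)
    show "x - y \<notin> L" if "x \<in> set C" "y \<in> set (map (\<lambda>c. c + t) C)" for x y
      using that inj[of "Suc _" "Suc _" 0 1] by (auto simp: C_def d_def Suc_le_eq)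
  qed
  have cov: "covers L UNIV (C @ map (\<lambda>c. c + t) C)"
    unfolding covers_def
  proof
    fix y
    obtain i \<kappa> where y: "y = of_int i * g + \<kappa>" "\<kappa> \<in> K" using g(1) unfolding adjoin_def by blast
    define s where "s = nat ((i + 1) mod int m)"
    define j where "j = (i + 1) div int m"
    have s: "int s = (i + 1) mod int m" "s < m" using m by (auto simp: s_def nat_less_iff)
    have i: "i = int s - 1 + j * int m"
      using mod_div_mult_eq[of "i + 1" "int m"] unfolding s(1) j_def by linarith
    have "\<kappa> - of_int j * \<tau> \<in> K" using y \<tau>(1) K(1) by (blast intro: subgrp_diff subgrp_of_int)
    then obtain u where u: "u \<in> set us" "\<kappa> - of_int j * \<tau> - u \<in> L" using usf(5) unfolding covers_def by blast
    then obtain l0 where l0: "l0 < h" "us ! l0 = u" by (auto simp: in_set_conv_nth h_def)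
    \<comment> \<open>If the first place of row 0 is wanted, row \<open>h\<close> is used instead,
      since \<open>c 0\<close> is not an entry of \<open>C\<close>.\<close>
    define l where "l = (if s = 0 \<and> l0 = 0 then h else l0)"
    have l: "w l = u" using l0 by (auto simp: l_def w_def)
    define I where "I = l * m + s"
    have I: "I mod m = s" "I div m = l" using s(2) m by (auto simp: I_def)
    have "1 \<le> I" "I \<le> k"
    proof -
      have "l \<noteq> 0 \<or> s \<noteq> 0" using h by (auto simp: l_def)
      then have "I \<noteq> 0" using m by (auto simp: I_def)
      then show "1 \<le> I" by simp
      show "I \<le> k"
      proof (cases "s = 0 \<and> l0 = 0")
        case True
        then show ?thesis by (simp add: I_def l_def k_def)
      next
        case False
        then have "l = l0" by (auto simp: l_def)
        then have "I \<le> l0 * m + m" using s(2) by (simp add: I_def)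
        also have "\<dots> = Suc l0 * m" by simp
        also have "\<dots> \<le> k" unfolding k_def using l0(1) by (intro mult_le_mono1) simp
        finally show ?thesis .
      qed
    qed
    then have cI: "c I \<in> set C" by (auto simp: C_def d_def intro!: image_eqI[of _ _ "I - 1"])
    have eI: "y - c I = (\<kappa> - of_int j * \<tau> - u) + of_int (j - int l) * t"
      using l by (simp add: y(1) c_def I i t_def algebra_simps)
    obtain z where z: "j - int l = 2 * z \<or> j - int l = 2 * z + 1" by (metis evenE oddE)
    then show "\<exists>x\<in>set (C @ map (\<lambda>c. c + t) C). y - x \<in> L"
    proof
      assume "j - int l = 2 * z"
      then have "y - c I = (\<kappa> - of_int j * \<tau> - u) + of_int z * (2 * t)" unfolding eI by (simp add: algebra_simps)
      then show ?thesis using cI u(2) subgrp_add[OF L] subgrp_of_int[OF L t2] by (metis UnI1 set_append)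
    next
      assume "j - int l = 2 * z + 1"
      then have "y - (c I + t) = (\<kappa> - of_int j * \<tau> - u) + of_int z * (2 * t)" using eI by (simp add: algebra_simps)
      moreover have "c I + t \<in> set (C @ map (\<lambda>c. c + t) C)" using cI by auto
      ultimately show ?thesis using u(2) subgrp_add[OF L] subgrp_of_int[OF L t2] by metis
    qed
  qed
  \<comment> \<open>The omitted label is \<open>r g + u + l t\<close> with \<open>u\<close> a half
    of \<open>\<tau>\<close> modulo \<open>L\<close>, so that its double is
    \<open>m g + \<tau> = t\<close>.\<close>
  obtain \<xi> where \<xi>: "\<xi> \<in> K" "2 * \<xi> - \<tau> \<in> L" using odd_torsion_half[OF L K(1,3) \<tau>(1)] by blast
  then obtain u where u: "u \<in> set us" "\<xi> - u \<in> L" using usf(5) unfolding covers_def by blast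
  then obtain l where l: "l < h" "us ! l = u" by (auto simp: in_set_conv_nth h_def)
  define J where "J = l * m + r"
  \<comment> \<open>The omitted label must be reached by a step inside a row. This is where
    \<open>r \<ge> 2\<close> is used, and why a quotient of order 4 does not fit.\<close>
  have rm: "r + 1 < m" using r by (simp add: m_def)
  have J: "J mod m = r" "J div m = l" "2 \<le> J" "Suc J \<le> k"
  proof -
    show "J mod m = r" "J div m = l" using rm by (auto simp: J_def)
    show "2 \<le> J" using r by (simp add: J_def)
    have "Suc J \<le> Suc l * m" using rm by (simp add: J_def)
    also have "\<dots> \<le> k" unfolding k_def using l(1) by (intro mult_le_mono1) simp
    finally show "Suc J \<le> k" .
  qed
  define x where "x = c (Suc J)"
  have x1: "x - c J - g \<in> L" using step[of J] rm J subgrp_0[OF L] by (simp add: x_def)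
  have x2: "2 * x - t \<in> L"
  proof -
    have "w l = u" using l by (simp add: w_def)
    then have "c J = of_int (int r - 1) * g + u + of_nat l * t" by (simp add: c_def J)
    then have "x = of_nat r * g + u + of_nat l * t" using step[of J] rm J by (simp add: x_def algebra_simps)
    then have "2 * x - t = (2 * \<xi> - \<tau>) - 2 * (\<xi> - u) + of_nat l * (2 * t)" by (simp add: t_def m_def algebra_simps)
    also have "\<dots> \<in> L"
      by (rule subgrp_add[OF L subgrp_diff[OF L \<xi>(2) subgrp_numeral[OF L u(2)]] subgrp_of_nat[OF L t2]])
    finally show ?thesis .
  qed
  have "C = map d [0..<J] @ d J # map d [Suc J..<k]"
  proof -
    have "[0..<J + (k - J)] = [0..<J] @ [J..<J + (k - J)]" by (rule upt_add_eq_append) simp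
    then show ?thesis using J(4) by (simp add: C_def upt_conv_Cons)
  qed
  moreover have "map d [0..<J] = 0 # map d [1..<J]"
    using J(3) c1 by (simp add: upt_conv_Cons d_def)
  moreover have "last (map d [0..<J]) = c J" using J(3) by (simp add: last_map d_def)
  ultimately obtain As Bs where "C = (0 # As) @ x # Bs" "last (0 # As) = c J"
    by (metis d_def x_def)
  then show ?thesis
    using path_sharp_antiperiodic[OF L t2 _ x2 _ _ labels cov sums] x1 ck(1) last by metis
qed

text \<open>The labels 0, \<open>2 * g\<close>, \<open>3 * g\<close> have the vertex sums 0,
  \<open>2 * g\<close>, \<open>5 * g\<close>, \<open>3 * g\<close>, and \<open>5 * g\<close> is in
  the class of the omitted \<open>g\<close>.\<close>

lemma path_sharp_order4:
  assumes L: "subgrp L" and g: "adjoin g L = UNIV" "\<And>i. of_int i * g \<in> L \<longleftrightarrow> 4 dvd i"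
  shows "path_sharp L"
proof -
  have n: "of_nat i * g \<in> L \<longleftrightarrow> 4 dvd i" for i :: nat
    using g(2)[of "int i"] by (simp add: int_dvd_int_iff[of 4, simplified])
  have gn: "g \<notin> L" "2 * g \<notin> L" "3 * g \<notin> L" "4 * g \<in> L"
    using n[of 1] n[of 2] n[of 3] n[of 4] by auto
  have cov: "covers L UNIV [0, g, 2 * g, 3 * g]"
    using covers_multiples[of 4 g L] L g gn(4) by (simp add: upt_rec)
  have ind: "indep L [0, g, 2 * g, 3 * g]"
    using gn by (simp add: indep_Cons[OF L] subgrp_uminus_iff[OF L] algebra_simps)
  have m1: "mset (map (cls L) [0, g, 2 * g, 3 * g]) = mset (map (cls L) [g, 0, 2 * g, 3 * g])" by simp
  have "cls L (2 * g + 3 * g) = cls L g" using gn(4) by (simp add: cls_eq[OF L] algebra_simps)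
  then have m2: "mset (map (cls L) [0, g, 2 * g, 3 * g]) = mset (map (cls L) [0, 0 + 2 * g, 2 * g + 3 * g, 3 * g])" by simp
  have "covers L UNIV (g # [0, 2 * g, 3 * g])" using covers_mset[OF L m1 cov] .
  moreover have "indep L (g # [0, 2 * g, 3 * g])" using ind indep_mset[OF m1] by simp
  moreover have "indep L (hd [0, 2 * g, 3 * g] # psums [0, 2 * g, 3 * g] @ [last [0, 2 * g, 3 * g]])"
    using ind indep_mset[OF m2] by simp
  ultimately show ?thesis unfolding path_sharp_def by blast
qed

text \<open>Among the proper subgroups of \<open>K\<close> above \<open>L\<close> one of least index
  is taken; adjoining an element lowers the index, so the result must be \<open>K\<close>.\<close>

lemma maximal_subgroup:
  assumes L: "subgrp L" "finite_index L" and K: "subgrp K" "L \<subseteq> K" "L \<noteq> K"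
  obtains H z where "subgrp H" "L \<subseteq> H" "H \<subseteq> K" "z \<in> K" "z \<notin> H" "adjoin z H = K"
proof -
  define P where "P H \<longleftrightarrow> subgrp H \<and> L \<subseteq> H \<and> H \<subseteq> K \<and> H \<noteq> K" for H
  have "P L" using L K by (simp add: P_def)
  then obtain H where H: "P H" and min: "\<And>H'. P H' \<Longrightarrow> card (range (cls H)) \<le> card (range (cls H'))"
    using ex_has_least_nat[of P L "\<lambda>H. card (range (cls H))"] by blast
  then have H': "subgrp H" "L \<subseteq> H" "H \<subseteq> K" "H \<noteq> K" by (auto simp: P_def)
  then obtain z where z: "z \<in> K" "z \<notin> H" by blast
  have A: "subgrp (adjoin z H)" "H \<subseteq> adjoin z H" "z \<in> adjoin z H" "adjoin z H \<subseteq> K"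
    using subgrp_adjoin[OF H'(1)] adjoin_superset adjoin_self[OF H'(1)] adjoin_subset[OF K(1) H'(3) z(1)] by auto
  have "adjoin z H = K"
  proof (rule ccontr)
    assume "adjoin z H \<noteq> K"
    then have "P (adjoin z H)" using A H' by (auto simp: P_def)
    then have "card (range (cls H)) \<le> card (range (cls (adjoin z H)))" by (rule min)
    moreover have "H \<noteq> adjoin z H" using A z by blast
    then have "card (range (cls (adjoin z H))) < card (range (cls H))"
      using index_superset[OF L H'(1,2)] index_superset(2)[OF H'(1) _ A(1,2)] by blast
    ultimately show False by simp
  qed
  then show thesis using that H' z by blast
qed

text \<open>For a quotient of order 4 with \<open>K\<close> larger than \<open>L\<close>, a subgroup
  \<open>H\<close> below \<open>K\<close> replaces \<open>K\<close>: then \<open>V / H\<close> is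
  cyclic of order \<open>4 * q\<close> with odd \<open>q > 1\<close>, which is long enough.\<close>

lemma path_sharp_cyclic_quotient:
  assumes L: "subgrp L" "finite_index L" and K: "subgrp K" "L \<subseteq> K" "odd_torsion L K"
    and g: "adjoin g K = UNIV" "\<And>i. of_int i * g \<in> K \<longleftrightarrow> 2 ^ c dvd i" and c: "c \<ge> 2"
  shows "path_sharp L"
proof (cases "c = 2")
  case False
  then obtain c' where c': "c = Suc (Suc (Suc c'))" using c by (metis One_nat_def Suc_1 add_2_eq_Suc le_Suc_ex nat.exhaust add_0_right)
  obtain us where us: "harmonious L K us" "odd (length us)" using harmonious_exists[OF L K] by blast
  have "of_int i * g \<in> K \<longleftrightarrow> 4 * int (2 ^ Suc c') dvd i" for i unfolding g(2) by (simp add: c')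
  moreover have "(2::nat) \<le> 2 ^ Suc c'" by simp
  ultimately show ?thesis using path_sharp_cyclic[OF L(1) K us g(1)] by blast
next
  case c2: True
  have g4: "of_int i * g \<in> K \<longleftrightarrow> 4 dvd i" for i unfolding g(2) by (simp add: c2)
  show ?thesis
  proof (cases "L = K")
    case True
    then show ?thesis using path_sharp_order4[OF L(1)] g(1) g4 by simp
  next
    case False
    obtain H z where H: "subgrp H" "L \<subseteq> H" "H \<subseteq> K" "z \<in> K" "z \<notin> H" "adjoin z H = K"
      using maximal_subgroup[OF L K(1,2) False] .
    obtain q :: nat where q: "odd q" "q > 1" "\<And>i::int. of_int i * z \<in> H \<longleftrightarrow> int q dvd i"
      using odd_torsion_order[OF L(1) H(1,2) K(3) H(4,5)] by metis
    have H': "odd_torsion L H" using K(3) H(3) by (auto simp: odd_torsion_def)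
    obtain us where us: "harmonious L H us" "odd (length us)" using harmonious_exists[OF L H(1,2) H'] by blast
    have qz: "of_int (int q) * z \<in> H" unfolding q(3) by (rule dvd_refl)
    have g4K: "of_int 4 * g \<in> K" unfolding g4 by (rule dvd_refl)
    then obtain a k where ak: "of_int 4 * g = of_int a * z + k" "k \<in> H" using H(6) unfolding adjoin_def by auto
    have "of_int (int q) * (of_int 4 * g) = of_int a * (of_int (int q) * z) + of_int (int q) * k"
      unfolding ak(1) by (simp add: algebra_simps)
    also have "\<dots> \<in> H" using qz ak(2) H(1) by (blast intro: subgrp_add subgrp_of_int)
    finally have q4: "of_int (int q) * (of_int 4 * g) \<in> H" .
    \<comment> \<open>Modulo \<open>H\<close> the summand \<open>q g\<close> has order 4 and
      \<open>z\<close> has order \<open>q\<close>; the orders are coprime, so \<open>g'\<close> has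
      order \<open>4 * q\<close>.\<close>
    define g' where "g' = of_int (int q) * g + z"
    have ord: "of_int i * g' \<in> H \<longleftrightarrow> 4 * int q dvd i" for i
    proof
      assume i: "of_int i * g' \<in> H"
      have "of_int (i * int q) * g = of_int i * g' - of_int i * z" by (simp add: g'_def algebra_simps)
      also have "\<dots> \<in> K" using i H K by (meson subgrp_diff subgrp_of_int subsetD)
      finally have "4 dvd i * int q" by (simp only: g4)
      moreover have "coprime 4 (int q)" using q(1) by (simp add: coprime_power_left_iff[of 2 2, simplified])
      ultimately have "4 dvd i" by (simp add: coprime_dvd_mult_left_iff)
      then obtain j where j: "i = 4 * j" by blast
      have "of_int i * z = of_int i * g' - of_int j * (of_int (int q) * (of_int 4 * g))"
        by (simp add: g'_def j algebra_simps)
      also have "\<dots> \<in> H" using i q4 H(1) by (blast intro: subgrp_diff subgrp_of_int)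
      finally have "int q dvd i" by (simp only: q(3))
      with \<open>4 dvd i\<close> \<open>coprime 4 (int q)\<close> show "4 * int q dvd i" by (simp add: divides_mult)
    next
      assume "4 * int q dvd i"
      then obtain j where j: "i = 4 * int q * j" by blast
      have "of_int i * g' = of_int (int q * j) * (of_int (int q) * (of_int 4 * g)) + of_int (4 * j) * (of_int (int q) * z)"
        by (simp add: g'_def j algebra_simps)
      also have "\<dots> \<in> H" using qz q4 H(1) by (blast intro: subgrp_add subgrp_of_int)
      finally show "of_int i * g' \<in> H" .
    qed
    define G where "G = adjoin g' H"
    have G: "subgrp G" "H \<subseteq> G" "g' \<in> G"
      using subgrp_adjoin[OF H(1)] adjoin_superset adjoin_self[OF H(1)] by (auto simp: G_def)
    \<comment> \<open>Bezout for 4 and the odd number \<open>q\<close>, which is 1 or -1 modulo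
      4.\<close>
    have coprime_mem: "y \<in> G" if y: "of_int 4 * y \<in> G" "of_int (int q) * y \<in> G" for y
    proof -
      have "\<exists>b. int q = 1 + 4 * b \<or> int q = 4 * b - 1" using q(1) by presburger
      then obtain b where "int q = 1 + 4 * b \<or> int q = 4 * b - 1" by blast
      then show ?thesis
      proof
        assume b: "int q = 1 + 4 * b"
        have "of_int (int q) * y - of_int b * (of_int 4 * y) \<in> G" using y G(1) by (blast intro: subgrp_diff subgrp_of_int)
        then show ?thesis unfolding b by (simp add: algebra_simps)
      next
        assume b: "int q = 4 * b - 1"
        have "of_int b * (of_int 4 * y) - of_int (int q) * y \<in> G" using y G(1) by (blast intro: subgrp_diff subgrp_of_int)
        then show ?thesis unfolding b by (simp add: algebra_simps)
      qed
    qed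
    have "of_int 4 * g' - of_int (int q) * (of_int 4 * g) \<in> G" using G q4 by (blast intro: subgrp_diff subgrp_of_int)
    then have "of_int 4 * z \<in> G" by (simp add: g'_def algebra_simps)
    then have zG: "z \<in> G" using coprime_mem qz G(2) by blast
    then have KG: "K \<subseteq> G" using adjoin_subset[OF G(1,2) zG] H(6) by simp
    have "g' - z \<in> G" using G zG by (blast intro: subgrp_diff)
    then have "of_int (int q) * g \<in> G" by (simp add: g'_def)
    moreover have "of_int 4 * g \<in> G" using g4K KG by blast
    ultimately have "g \<in> G" using coprime_mem by blast
    then have "adjoin g' H = UNIV" using adjoin_subset[OF G(1) KG, of g] g(1) G_def by auto
    then show ?thesis using path_sharp_cyclic[OF L(1) H(1,2) H' us _ ord] q by simp
  qed
qed

section \<open>Splitting off the odd part\<close>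

definition odd_part :: "'v::comm_ring_1 set \<Rightarrow> 'v set" where
  "odd_part L = {x. \<exists>j::nat. odd j \<and> of_nat j * x \<in> L}"

lemma odd_part:
  assumes L: "subgrp L"
  shows "subgrp (odd_part L)" "L \<subseteq> odd_part L" "odd_torsion L (odd_part L)"
proof -
  show "odd_torsion L (odd_part L)" by (auto simp: odd_torsion_def odd_part_def)
  show "L \<subseteq> odd_part L" by (auto simp: odd_part_def intro: exI[of _ 1])
  show "subgrp (odd_part L)"
    unfolding subgrp_def
  proof (intro conjI ballI)
    show "0 \<in> odd_part L" using subgrp_0[OF L] by (auto simp: odd_part_def intro: exI[of _ 1])
    fix x y assume "x \<in> odd_part L" "y \<in> odd_part L"
    then obtain i j :: nat where ij: "odd i" "of_nat i * x \<in> L" "odd j" "of_nat j * y \<in> L" by (auto simp: odd_part_def)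
    have "of_nat (i * j) * (x - y) = of_nat j * (of_nat i * x) - of_nat i * (of_nat j * y)" by (simp add: algebra_simps)
    also have "\<dots> \<in> L" using ij L by (blast intro: subgrp_diff subgrp_of_nat)
    finally show "x - y \<in> odd_part L" using ij by (auto simp: odd_part_def intro!: exI[of _ "i * j"])
  qed
qed

text \<open>With \<open>n = 2 ^ a * b\<close> and \<open>b\<close> odd, every
  \<open>2 ^ a * x\<close> lies in the odd part \<open>K\<close>, so \<open>V / K\<close> is a
  2-group. The hypothesis \<open>two\<close> says that \<open>V / K\<close> does not have order 2,
  the only cyclic order left uncovered.\<close>

lemma path_sharp_main:
  assumes L: "subgrp L" "finite_index L" "L \<noteq> UNIV" and exp: "n > 0" "\<And>x. of_nat n * x \<in> L"
    and two: "\<And>g. g \<notin> odd_part L \<Longrightarrow> 2 * g \<in> odd_part L \<Longrightarrow> \<exists>v. v \<notin> odd_part L \<and> v - g \<notin> odd_part L"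
  shows "path_sharp L"
proof -
  define K where "K = odd_part L"
  have K: "subgrp K" "L \<subseteq> K" "odd_torsion L K" using odd_part[OF L(1)] by (auto simp: K_def)
  have fK: "finite_index K" using index_superset(1)[OF L(1,2) K(1,2)] .
  have "two_primary K"
  proof -
    obtain a b where ab: "n = 2 ^ a * b" "odd b" using exp(1) by (metis nat_neq_iff not_less0 prime_power_canonical two_is_prime_nat mult.commute)
    have "2 ^ a * x \<in> K" for x
    proof -
      have "of_nat b * (2 ^ a * x) = of_nat n * x" by (simp add: ab algebra_simps)
      then show ?thesis using exp(2)[of x] ab(2) unfolding K_def odd_part_def by fastforce
    qed
    then show ?thesis unfolding two_primary_def by blast
  qed
  obtain us where us: "harmonious L K us" using harmonious_exists[OF L(1,2) K] by blast
  show ?thesis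
  proof (cases "noncyclic K")
    case True
    then show ?thesis
      using sharp_noncyclic[OF K(1) fK \<open>two_primary K\<close>] path_sharp_triple[OF L(1) K us] path_sharp_edge[OF L(1) K us] by blast
  next
    case False
    obtain g c where g: "\<And>i. of_int i * g \<in> K \<longleftrightarrow> 2 ^ c dvd i" "adjoin g K = UNIV"
      using cyclic_generator[OF K(1) fK \<open>two_primary K\<close> False] by metis
    consider "c = 0" | "c = 1" | "c \<ge> 2" by linarith
    then show ?thesis
    proof cases
      case 1
      then have "g \<in> K" using g(1)[of 1] by simp
      then have "K = UNIV" using g(2) adjoin_subset[OF K(1) order_refl] by blast
      then show ?thesis using path_sharp_odd[OF L(1,3)] us by simp
    next
      case 2
      then have "g \<notin> K" "2 * g \<in> K" using g(1)[of 1] g(1)[of 2] by auto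
      then obtain v where v: "v \<notin> K" "v - g \<notin> K" using two unfolding K_def by blast
      have "v \<in> adjoin g K" using g(2) by simp
      then obtain i x where ix: "v = of_int i * g + x" "x \<in> K" unfolding adjoin_def by blast
      have "of_int i * g \<in> K \<or> of_int (i - 1) * g \<in> K" unfolding g(1) by (simp add: 2)
      then have "of_int i * g + x \<in> K \<or> of_int (i - 1) * g + x \<in> K" using ix(2) subgrp_add[OF K(1)] by blast
      then show ?thesis using v by (simp add: ix(1) algebra_simps)
    next
      case 3
      then show ?thesis using path_sharp_cyclic_quotient[OF L(1,2) K g(2,1)] by blast
    qed
  qed
qed

subsection \<open>Path labellings of finite abelian groups\<close>

text \<open>Handshake: each edge label is counted at both of its ends.\<close>

lemma sum_list_psums: "xs \<noteq> [] \<Longrightarrow> hd xs + (sum_list (psums xs) + last xs) = 2 * sum_list xs"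
  by (induction xs rule: psums.induct) (auto simp: algebra_simps)

lemma nth_path_sums:
  assumes "xs \<noteq> []" "v \<le> length xs"
  shows "(hd xs # psums xs @ [last xs]) ! v = (if v = 0 then 0 else xs ! (v - 1)) + (if v < length xs then xs ! v else 0)"
proof -
  have p: "psums xs ! i = xs ! i + xs ! Suc i" if "Suc i < length xs" for i
  proof -
    have "i < length xs - 1" using that by simp
    then show ?thesis using psums_map_upt[of "(!) xs" "length xs"] by (simp add: map_nth)
  qed
  consider "v = 0" | "0 < v" "v < length xs" | "v = length xs" using assms(2) by linarith
  then show ?thesis
  proof cases
    case 2
    then obtain i where "v = Suc i" by (cases v) auto
    moreover from this have "i < length xs - Suc 0" using 2 by simp
    ultimately show ?thesis using 2 p[of i] by (simp add: nth_append)
  qed (use assms in \<open>auto simp: hd_conv_nth last_conv_nth nth_append\<close>)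
qed

text \<open>\<open>\<phi>\<close> is a homomorphism from the additive group only; the ring
  multiplication of the domain serves to write integer multiples.\<close>

locale presentation = comm_group A for A :: "('a, 'm) monoid_scheme" (structure) +
  fixes \<phi> :: "'v::comm_ring_1 \<Rightarrow> 'a"
  assumes fin: "finite (carrier A)" and hom: "\<phi> (x + y) = \<phi> x \<otimes> \<phi> y" and surj: "range \<phi> = carrier A"
begin

lemma closed [simp]: "\<phi> x \<in> carrier A"
  using surj by auto

lemma map_zero: "\<phi> 0 = \<one>"
  using hom[of 0 0] closed[of 0] by (simp add: l_cancel_one)

definition ker where "ker = {x. \<phi> x = \<one>}"

lemma ker_iff: "x - y \<in> ker \<longleftrightarrow> \<phi> x = \<phi> y"
proof -
  have "\<phi> x = \<phi> (x - y) \<otimes> \<phi> y" using hom[of "x - y" y] by simp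
  then show ?thesis unfolding ker_def using r_cancel[of "\<phi> (x - y)" "\<phi> y" "\<one>"] by simp
qed

lemma subgrp_ker: "subgrp ker"
proof -
  have "\<phi> (x - y) = \<one>" if "\<phi> x = \<one>" "\<phi> y = \<one>" for x y
    using ker_iff[of x y] that by (simp add: ker_def)
  then show ?thesis by (simp add: subgrp_def ker_def map_zero)
qed

lemma cls_ker: "cls ker x = cls ker y \<longleftrightarrow> \<phi> x = \<phi> y"
  by (simp add: cls_eq[OF subgrp_ker] ker_iff)

lemma indep_ker: "indep ker xs \<longleftrightarrow> distinct (map \<phi> xs)"
  unfolding indep_def by (induction xs) (auto simp: image_iff cls_ker)

lemma covers_ker: "covers ker UNIV xs \<longleftrightarrow> carrier A \<subseteq> \<phi> ` set xs"
  unfolding covers_def ker_iff surj[symmetric] by (auto simp: image_iff)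

lemma length_transversal: assumes "indep ker xs" "covers ker UNIV xs" shows "length xs = order A"
proof -
  have "set (map \<phi> xs) = carrier A" using assms(2) by (auto simp: covers_ker)
  then show ?thesis using assms(1) distinct_card[of "map \<phi> xs"] by (simp add: indep_ker order_def)
qed

lemma finite_index_ker: "finite_index ker"
proof -
  have "cls ker x = {y. \<phi> y = \<phi> x}" for x by (auto simp: cls_def ker_iff)
  then have "range (cls ker) = (\<lambda>a. {y. \<phi> y = a}) ` range \<phi>" by auto
  then show ?thesis unfolding finite_index_def surj using fin by simp
qed

lemma order_mult_ker: "of_nat (order A) * x \<in> ker"
proof -
  have "\<phi> (of_nat n * x) = \<phi> x [^] n" for n :: nat
    by (induction n) (auto simp: map_zero hom distrib_right m_comm)
  then show ?thesis using pow_order_eq_1[of "\<phi> x"] by (simp add: ker_def)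
qed

text \<open>\<open>xs\<close> lifts the edge labels through \<open>\<phi>\<close>. The list
  \<open>hd xs # psums xs @ [last xs]\<close> then lifts the vertex sums in the order of the
  vertices, an end vertex seeing a single label.\<close>

lemma antimagic_iff:
  assumes n: "order A = Suc (length xs)" and xs: "xs \<noteq> []" and f: "\<And>i. i < length xs \<Longrightarrow> f {i, Suc i} = \<phi> (xs ! i)"
  shows "antimagic_labeling A (path_graph (order A)) f \<longleftrightarrow> indep ker xs \<and> indep ker (hd xs # psums xs @ [last xs])"
proof -
  let ?ss = "hd xs # psums xs @ [last xs]"
  have E: "snd (path_graph (order A)) = (\<lambda>i. {i, Suc i}) ` {..<length xs}" by (auto simp: path_graph_def n)
  have V: "fst (path_graph (order A)) = {..<order A}" by (simp add: path_graph_def)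
  have nth_inj: "inj_on (\<lambda>v. \<phi> (ys ! v)) {..<length ys} \<longleftrightarrow> indep ker ys" for ys
    unfolding indep_ker distinct_conv_nth by (auto simp: inj_on_def)
  have lss: "length ?ss = order A" using xs by (simp add: n)
  have vs: "vertex_sum A (path_graph (order A)) f v = \<phi> (?ss ! v)" if v: "v < order A" for v
  proof -
    have N: "neighbours (path_graph (order A)) v = (if v = 0 then {} else {v - 1}) \<union> (if Suc v < order A then {Suc v} else {})"
      using v by (auto simp: neighbours_def path_graph_def doubleton_eq_iff)
    have l: "f {v - 1, v} = \<phi> (xs ! (v - 1))" if "v \<noteq> 0"
      using f[of "v - 1"] that v n by simp
    have r: "f {Suc v, v} = \<phi> (xs ! v)" if "Suc v < order A"
      using f[of v] that n by (simp add: insert_commute)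
    have s: "?ss ! v = (if v = 0 then 0 else xs ! (v - 1)) + (if v < length xs then xs ! v else 0)"
      using v n by (intro nth_path_sums[OF xs]) simp
    show ?thesis
      unfolding vertex_sum_def N s using l r v xs
      by (auto simp: n hom map_zero m_comm)
  qed
  have "f \<in> snd (path_graph (order A)) \<rightarrow> carrier A" unfolding E using f by auto
  moreover have "inj_on f (snd (path_graph (order A))) \<longleftrightarrow> indep ker xs"
  proof -
    have i: "inj_on (\<lambda>i. {i, Suc i}) {..<length xs}" by (auto simp: inj_on_def doubleton_eq_iff)
    have "inj_on f ((\<lambda>i. {i, Suc i}) ` {..<length xs}) \<longleftrightarrow> inj_on (\<lambda>i. \<phi> (xs ! i)) {..<length xs}"
      unfolding comp_inj_on_iff[OF i] using f by (intro inj_on_cong) simp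
    also have "\<dots> \<longleftrightarrow> indep ker xs"
      by (rule nth_inj)
    finally show ?thesis unfolding E .
  qed
  moreover have "inj_on (vertex_sum A (path_graph (order A)) f) {..<order A} \<longleftrightarrow> indep ker ?ss"
  proof -
    have "inj_on (vertex_sum A (path_graph (order A)) f) {..<order A} \<longleftrightarrow> inj_on (\<lambda>v. \<phi> (?ss ! v)) {..<order A}"
      using vs by (intro inj_on_cong) simp
    also have "\<dots> \<longleftrightarrow> indep ker ?ss"
      unfolding lss[symmetric] by (rule nth_inj)
    finally show ?thesis .
  qed
  ultimately show ?thesis unfolding antimagic_labeling_def V by blast
qed

lemma antimagic_path:
  assumes "path_sharp ker" shows "antimagic A (path_graph (order A))"
proof -
  obtain x xs where xs: "xs \<noteq> []" "indep ker (x # xs)" "covers ker UNIV (x # xs)"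
    "indep ker (hd xs # psums xs @ [last xs])" using assms unfolding path_sharp_def by blast
  have n: "order A = Suc (length xs)" using length_transversal[OF xs(2,3)] by simp
  \<comment> \<open>\<open>Min e\<close> recovers \<open>i\<close> from the edge between
    \<open>i\<close> and \<open>Suc i\<close>.\<close>
  define f where "f e = \<phi> (xs ! Min e)" for e :: "nat set"
  have "indep ker xs" using xs(2) by (simp add: indep_def)
  then have "antimagic_labeling A (path_graph (order A)) f"
    using antimagic_iff[OF n xs(1), of f] xs(4) by (simp add: f_def)
  then show ?thesis unfolding antimagic_def by blast
qed

text \<open>The odd part has a transversal of odd length, so it is proper when the order is even.
  Above it lies a maximal proper subgroup \<open>H\<close>, and adjoining the double of an element
  \<open>z\<close> outside \<open>H\<close> still misses \<open>z\<close>: if \<open>z\<close> were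
  \<open>2 i z\<close> modulo \<open>H\<close>, then \<open>2 ^ c * z\<close> in \<open>H\<close>
  would imply, by descent on \<open>c\<close>, that \<open>z\<close> is in \<open>H\<close>.\<close>

lemma even_index_subgroup:
  assumes "even (order A)"
  shows "\<exists>M z. subgrp M \<and> ker \<subseteq> M \<and> z \<notin> M \<and> 2 * z \<in> M \<and> (\<forall>v. v \<in> M \<or> v - z \<in> M)"
proof -
  note L = subgrp_ker finite_index_ker
  define K where "K = odd_part ker"
  have K: "subgrp K" "ker \<subseteq> K" "odd_torsion ker K" using odd_part[OF L(1)] by (auto simp: K_def)
  obtain us where us: "harmonious ker K us" "odd (length us)" using harmonious_exists[OF L K] by blast
  have "K \<noteq> UNIV"
  proof
    assume "K = UNIV"
    then have "length us = order A" using us(1) by (intro length_transversal) (auto simp: harmonious_def)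
    then show False using us(2) assms by simp
  qed
  then obtain H z where H: "subgrp H" "K \<subseteq> H" "z \<notin> H" "adjoin z H = UNIV"
    using maximal_subgroup[OF K(1) index_superset(1)[OF L K(1,2)], of UNIV] by (auto simp: subgrp_def)
  define M where "M = adjoin (2 * z) H"
  have M: "subgrp M" "H \<subseteq> M" "2 * z \<in> M"
    using subgrp_adjoin[OF H(1)] adjoin_superset adjoin_self[OF H(1)] by (auto simp: M_def)
  have "z \<notin> M"
  proof
    assume "z \<in> M"
    then obtain i x where ix: "z = of_int i * (2 * z) + x" "x \<in> H" by (auto simp: M_def adjoin_def)
    have j: "of_nat (order A) * z \<in> H" using order_mult_ker[of z] K H by blast
    obtain a b where ab: "order A = 2 ^ a * b" "odd b"
      using assms fin order_gt_0_iff_finite by (metis nat_neq_iff not_less0 prime_power_canonical two_is_prime_nat mult.commute)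
    have "2 ^ a * z \<in> K"
    proof -
      have "of_nat b * (2 ^ a * z) = of_nat (order A) * z" by (simp add: ab algebra_simps)
      then show ?thesis using order_mult_ker[of z] ab(2) unfolding K_def odd_part_def by fastforce
    qed
    then have a: "2 ^ a * z \<in> H" using H(2) by blast
    have "2 ^ c * z \<in> H \<Longrightarrow> z \<in> H" for c
    proof (induction c)
      case (Suc c)
      have "2 ^ c * z = of_int i * (2 ^ Suc c * z) + 2 ^ c * x"
        by (subst ix(1)) (simp add: algebra_simps)
      moreover have "2 ^ c * x \<in> H" using subgrp_of_nat[OF H(1) ix(2), of "2 ^ c"] by simp
      ultimately show ?case using Suc subgrp_add[OF H(1)] subgrp_of_int[OF H(1)] by metis
    qed simp
    then show False using a H(3) by blast
  qed
  moreover have "v \<in> M \<or> v - z \<in> M" for v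
  proof -
    have "v \<in> adjoin z H" using H(4) by simp
    then obtain i x where v: "v = of_int i * z + x" "x \<in> H" unfolding adjoin_def by blast
    obtain j where "i = 2 * j \<or> i = 2 * j + 1" by (metis evenE oddE)
    then have "v = of_int j * (2 * z) + x \<or> v - z = of_int j * (2 * z) + x" by (auto simp: v algebra_simps)
    moreover have "of_int j * (2 * z) + x \<in> M"
      using M(2) v(2) by (intro subgrp_add[OF M(1) subgrp_of_int[OF M(1,3)]]) blast
    ultimately show ?thesis by metis
  qed
  ultimately show ?thesis using M H(2) K(2) by blast
qed

text \<open>The sums of a path labelling add up to twice the sum of the labels, hence to an element of every
  subgroup \<open>M\<close> of index 2, whereas the number of summands outside \<open>M\<close> is \<open>n / 2\<close>.\<close>

lemma antimagic_obstruction: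
  assumes two: "[order A = 2] (mod 4)"
  shows "\<not> antimagic A (path_graph (order A))"
proof
  assume "antimagic A (path_graph (order A))"
  then obtain f where f: "antimagic_labeling A (path_graph (order A)) f" by (auto simp: antimagic_def)
  have n: "order A mod 4 = 2" using two by (simp add: cong_def)
  then have n': "even (order A)" "odd (order A div 2)" "order A \<ge> 2" by presburger+
  define xs where "xs = map (\<lambda>i. SOME x. \<phi> x = f {i, Suc i}) [0..<order A - 1]"
  have len: "order A = Suc (length xs)" "xs \<noteq> []" using n'(3) by (auto simp: xs_def)
  have "f {i, Suc i} = \<phi> (xs ! i)" if "i < length xs" for i
  proof -
    have "{i, Suc i} \<in> snd (path_graph (order A))" using that len(1) by (auto simp: path_graph_def)
    then have "f {i, Suc i} \<in> carrier A" using f by (auto simp: antimagic_labeling_def)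
    then have "\<exists>x. \<phi> x = f {i, Suc i}" using surj by (metis rangeE)
    then have "\<phi> (SOME x. \<phi> x = f {i, Suc i}) = f {i, Suc i}" by (rule someI_ex)
    then show ?thesis using that by (simp add: xs_def)
  qed
  then have ss: "indep ker (hd xs # psums xs @ [last xs])" using antimagic_iff[OF len] f by blast
  define ss where "ss = hd xs # psums xs @ [last xs]"
  obtain M z where M: "subgrp M" "ker \<subseteq> M" "z \<notin> M" "2 * z \<in> M" "\<And>v. v \<in> M \<or> v - z \<in> M"
    using even_index_subgroup[OF n'(1)] by auto
  \<comment> \<open>Index 2 turns membership into parity: the sum of two elements outside
    \<open>M\<close> is in \<open>M\<close>.\<close>
  have par: "sum_list ys \<in> M \<longleftrightarrow> even (length (filter (\<lambda>v. v \<notin> M) ys))" for ys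
  proof (induction ys)
    case (Cons y ys)
    show ?case
    proof (cases "y \<in> M")
      case True
      then show ?thesis using Cons subgrp_add_iff[OF M(1) True, of "sum_list ys"] by (simp add: add.commute)
    next
      case False
      have "y + s \<in> M \<longleftrightarrow> s \<notin> M" for s
      proof
        assume "y + s \<in> M"
        then show "s \<notin> M" using False subgrp_add_iff[OF M(1), of s y] by blast
      next
        assume "s \<notin> M"
        then have "s - z \<in> M" "y - z \<in> M" using M(5) False by blast+
        then have "(y - z) + (s - z) + 2 * z \<in> M" using M(1,4) by (blast intro: subgrp_add)
        then show "y + s \<in> M" by (simp add: algebra_simps)
      qed
      then show ?thesis using Cons False by simp
    qed
  qed (simp add: subgrp_0[OF M(1)])
  have "sum_list ss = 2 * sum_list xs" using sum_list_psums[OF len(2)] by (simp add: ss_def)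
  moreover have "2 * v \<in> M" for v
  proof -
    have "2 * v = 2 * (v - z) + 2 * z" by (simp add: algebra_simps)
    then show ?thesis using M(5)[of v] M(1,4) by (metis subgrp_add subgrp_numeral)
  qed
  ultimately have "even (length (filter (\<lambda>v. v \<notin> M) ss))" using par[of ss] by simp
  moreover have "length (filter (\<lambda>v. v \<notin> M) ss) = order A div 2"
  proof -
    have d: "distinct (map \<phi> ss)" using ss by (simp add: ss_def indep_ker)
    have wd: "\<phi> v = \<phi> w \<Longrightarrow> v \<in> M \<longleftrightarrow> w \<in> M" for v w
      using ker_iff[of v w] M(1,2) subgrp_shift[OF M(1), of v w] by blast
    have "length (map \<phi> ss) = card (carrier A)" using len by (simp add: ss_def order_def)
    then have "card (\<phi> ` set ss) = card (carrier A)" using distinct_card[OF d] by simp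
    then have all: "\<phi> ` set ss = carrier A" by (intro card_subset_eq[OF fin]) auto
    define S where "S = \<phi> ` (- M)"
    have "\<phi> ` set (filter (\<lambda>v. v \<notin> M) ss) = S"
    proof -
      have "\<phi> v \<in> \<phi> ` set (filter (\<lambda>v. v \<notin> M) ss)" if v: "v \<notin> M" for v
      proof -
        have "\<phi> v \<in> \<phi> ` set ss" by (simp add: all)
        then obtain w where w: "\<phi> v = \<phi> w" "w \<in> set ss" by (rule imageE)
        then have "w \<in> set (filter (\<lambda>v. v \<notin> M) ss)" using wd[OF w(1)] v by simp
        then show ?thesis unfolding w(1) by (rule imageI)
      qed
      then show ?thesis by (auto simp: S_def)
    qed
    moreover have "distinct (map \<phi> (filter (\<lambda>v. v \<notin> M) ss))" using d by (rule distinct_map_filter)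
    ultimately have l: "length (filter (\<lambda>v. v \<notin> M) ss) = card S"
      using distinct_card[of "map \<phi> (filter (\<lambda>v. v \<notin> M) ss)"] by simp
    have c: "carrier A = S \<union> \<phi> ` M" "S \<inter> \<phi> ` M = {}"
    proof -
      show "carrier A = S \<union> \<phi> ` M" unfolding S_def surj[symmetric] by blast
      show "S \<inter> \<phi> ` M = {}"
      proof (rule ccontr)
        assume "\<not> ?thesis"
        then obtain v w where "\<phi> v = \<phi> w" "v \<notin> M" "w \<in> M" unfolding S_def by blast
        then show False using wd[of v w] by simp
      qed
    qed
    \<comment> \<open>Translation by \<open>z\<close> exchanges \<open>M\<close> with its
      complement, so exactly half of the group elements come from outside \<open>M\<close>.\<close>
    have "bij_betw (\<lambda>a. a \<otimes> \<phi> z) (\<phi> ` M) S"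
    proof (rule bij_betw_imageI)
      show "inj_on (\<lambda>a. a \<otimes> \<phi> z) (\<phi> ` M)" by (auto simp: inj_on_def)
      have "v + z \<notin> M" if "v \<in> M" for v using that M(3) subgrp_add_iff[OF M(1) that, of z] by (simp add: add.commute)
      moreover have "\<exists>w\<in>M. \<phi> v = \<phi> w \<otimes> \<phi> z" if "v \<notin> M" for v
        using M(5)[of v] that by (intro bexI[of _ "v - z"]) (auto simp flip: hom)
      ultimately show "(\<lambda>a. a \<otimes> \<phi> z) ` \<phi> ` M = S"
        unfolding S_def by (auto simp: image_iff simp flip: hom)
    qed
    then have "card (\<phi> ` M) = card S" by (rule bij_betw_same_card)
    moreover have "card (carrier A) = card S + card (\<phi> ` M)"
      unfolding c(1) using c fin by (intro card_Un_disjoint) (auto intro: finite_subset)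
    ultimately show ?thesis using l by (simp add: order_def)
  qed
  ultimately show False using n'(2) by simp
qed

text \<open>If \<open>K\<close> is the odd part and \<open>V / K\<close> had only the classes of 0
  and \<open>g\<close>, then \<open>blocks [0, g] us\<close> would be a transversal of length twice
  an odd number, and the order would be 2 modulo 4.\<close>

lemma antimagic_exists:
  assumes two: "\<not> [order A = 2] (mod 4)"
  shows "antimagic A (path_graph (order A))"
proof (cases "ker = UNIV")
  \<comment> \<open>The trivial group is separate because its path has no edges, while
    \<open>path_sharp\<close> speaks of a nonempty list of labels.\<close>
  case True
  then have "\<phi> x = \<one>" for x unfolding ker_def by blast
  then have "carrier A = {\<one>}" unfolding surj[symmetric] by auto
  then have "path_graph (order A) = ({0}, {})" by (auto simp: order_def path_graph_def)
  then show ?thesis unfolding antimagic_def antimagic_labeling_def by simp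
next
  case False
  note L = subgrp_ker finite_index_ker
  have "path_sharp ker"
  proof (rule path_sharp_main[OF L False])
    show "order A > 0" using fin order_gt_0_iff_finite by blast
    show "of_nat (order A) * x \<in> ker" for x by (rule order_mult_ker)
    define K where "K = odd_part ker"
    have K: "subgrp K" "ker \<subseteq> K" "odd_torsion ker K" using odd_part[OF L(1)] by (auto simp: K_def)
    obtain us where us: "harmonious ker K us" "odd (length us)" using harmonious_exists[OF L K] by blast
    show "\<exists>v. v \<notin> odd_part ker \<and> v - g \<notin> odd_part ker" if "g \<notin> odd_part ker" for g
    proof (rule ccontr)
      assume "\<not> ?thesis"
      then have cov: "covers K UNIV [0, g]" by (auto simp: K_def covers_def)
      have ind: "indep K [0, g]"
        using that by (simp add: indep_Cons[OF K(1)] subgrp_uminus_iff[OF K(1)] K_def[symmetric])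
      have "length (blocks [0, g] us) = order A"
        using indep_blocks[OF L(1) K(1,2) us(1) ind] covers_blocks[OF L(1) K(1) us(1) cov] by (rule length_transversal)
      moreover have "length (blocks [0, g] us) = 2 * length us" by (induction us) (auto simp: blocks_def)
      ultimately have "order A mod 4 = 2" using us(2) by presburger
      then show False using two by (simp add: cong_def)
    qed
  qed
  then show ?thesis by (rule antimagic_path)
qed

end

text \<open>Every finite abelian group is a quotient of \<open>'a \<Rightarrow> int\<close>, a type with enough algebraic structure to
  calculate in.\<close>

lemma presentation_exists:
  assumes "comm_group A" "finite (carrier A)"
  shows "presentation A (\<lambda>v. finprod A (\<lambda>a. a [^]\<^bsub>A\<^esub> (v a :: int)) (carrier A))"
proof -
  interpret comm_group A by (rule assms(1))
  let ?\<phi> = "\<lambda>v. finprod A (\<lambda>a. a [^]\<^bsub>A\<^esub> (v a :: int)) (carrier A)"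
  show ?thesis
  proof
    show "finite (carrier A)" by (rule assms(2))
    show "?\<phi> (v + w) = ?\<phi> v \<otimes>\<^bsub>A\<^esub> ?\<phi> w" for v w
    proof -
      have "?\<phi> (v + w) = finprod A (\<lambda>a. a [^]\<^bsub>A\<^esub> v a \<otimes>\<^bsub>A\<^esub> a [^]\<^bsub>A\<^esub> w a) (carrier A)"
        by (intro finprod_cong') (auto simp: int_pow_mult)
      then show ?thesis by (simp add: finprod_multf)
    qed
    show "range ?\<phi> = carrier A"
    proof
      show "range ?\<phi> \<subseteq> carrier A" by auto
      show "carrier A \<subseteq> range ?\<phi>"
      proof
        fix b assume b: "b \<in> carrier A"
        \<comment> \<open>The indicator function of \<open>b\<close> is a preimage of
          \<open>b\<close>.\<close>
        have "?\<phi> (\<lambda>a. if b = a then 1 else 0) = finprod A (\<lambda>a. if b = a then a else \<one>\<^bsub>A\<^esub>) (carrier A)"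
          by (intro finprod_cong') auto
        also have "\<dots> = b" using finprod_singleton[OF b assms(2), of "\<lambda>a. a"] by simp
        finally have "b = ?\<phi> (\<lambda>a. if b = a then 1 else 0)" by (rule sym)
        from image_eqI[of b ?\<phi> "\<lambda>a. if b = a then 1 else 0" UNIV, OF this] show "b \<in> range ?\<phi>" by simp
      qed
    qed
  qed
qed

theorem theorem4p3:
  fixes A :: "('a, 'm) monoid_scheme" and n :: nat
  assumes "comm_group A" and "finite (carrier A)" and "order A = n"
  shows "antimagic A (path_graph n) \<longleftrightarrow> \<not> [n = 2] (mod 4)"
  using presentation.antimagic_exists[OF presentation_exists[OF assms(1,2)]]
    presentation.antimagic_obstruction[OF presentation_exists[OF assms(1,2)]] assms(3) by blast

end
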